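(* Let $M,N\ge 2$ be integers and $0<p_0<1$. Consider the maps $f_0,\dots,f_M$ on $[0,1)$, the measure $\nu$ on $\Sigma=\{0,\dots,M\}^{\mathbb N}$, the compositions $f^n_\omega$ and the Lyapunov exponent $L_{p_0}$ defined in the context. Then the following hold. (i) Suppose $L_{p_0}<0$. Then for all $x,y\in[0,1)$ and $\nu$-almost all $\omega$, $\lim_{n\to\infty}|f^n_\omega(x)-f^n_\omega(y)|=0$. (ii) Suppose $L_{p_0}=0$. Then for every $\varepsilon>0$, all $x,y\in[0,1)$ and $\nu$-almost all $\omega$, $$\lim_{n\to\infty}\frac1n\left|\{0\le i<n:\ |f^i_\omega(x)-f^i_\omega(y)|<\varepsilon\}\right|=1.$$ Moreover, for all sufficiently small $\beta>0$ (that is, there is $\beta_0>0$ such that for every $0<\beta<\beta_0$), for all $x,y\in[0,1)$ and $\nu$-almost all $\omega$, either $|f^n_\omega(x)-f^n_\omega(y)|=0$ for some $n$, or $|f^n_\omega(x)-f^n_\omega(y)|>\beta$ for infinitely many $n$. (iii) Suppose $L_{p_0}>0$. Then for $\nu\times\lambda$-almost all $(\omega,x,y)\in\Sigma\times[0,1)^2$ the limit $$P(\varepsilon)=\lim_{n\to\infty}\frac1n\left|\{0\le i<n:\ |f^i_\omega(x)-f^i_\omega(y)|<\varepsilon\}\right|$$ exists for every $\varepsilon>0$, and $\lim_{\varepsilon\to0}P(\varepsilon)=0$.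
   Context: For integers $M,N\ge2$ the maps $f_i:[0,1)\to[0,1)$ are $f_0(x)=Nx \pmod 1$ and $f_i(x)=(x+i-1)/M$ for $1\le i\le M$. Let $\mathbf p=(p_0,\dots,p_M)$ with $p_i=(1-p_0)/M$ for $1\le i\le M$, and let $\nu$ be the $\mathbf p$-Bernoulli (product) measure on $\Sigma=\{0,1,\dots,M\}^{\mathbb N}$, whose elements are written $\omega=(\omega_0,\omega_1,\dots)$. For $\omega\in\Sigma$, $f^n_\omega=f_{\omega_{n-1}}\circ\cdots\circ f_{\omega_0}$, with $f^0_\omega$ the identity. The Lyapunov exponent is $L_{p_0}=p_0\ln N-(1-p_0)\ln M$. In (iii) $\lambda$ is two-dimensional Lebesgue measure on $[0,1)^2$. For a finite set, $|\cdot|$ denotes cardinality. *)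

theory Defs
  imports "HOL-Probability.Probability"
begin

text \<open>The maps are total functions on the reals; only their restriction to \<open>{0..<1}\<close> matters.\<close>

definition gen_map :: "nat \<Rightarrow> nat \<Rightarrow> nat \<Rightarrow> real \<Rightarrow> real" where
  "gen_map M N i x = (if i = 0 then frac (real N * x) else (x + real i - 1) / real M)"

lemma gen_map_in_unit:
  assumes "i \<le> M" "x \<in> {0..<1}"
  shows "gen_map M N i x \<in> {0..<1}"
  using assms by (auto simp: gen_map_def frac_ge_0 frac_lt_1 field_simps)

primrec compos :: "nat \<Rightarrow> nat \<Rightarrow> (nat \<Rightarrow> nat) \<Rightarrow> nat \<Rightarrow> real \<Rightarrow> real" where
  "compos M N \<omega> 0 = id"
| "compos M N \<omega> (Suc n) = gen_map M N (\<omega> n) \<circ> compos M N \<omega> n"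

definition prob_vec :: "nat \<Rightarrow> real \<Rightarrow> nat \<Rightarrow> real" where
  "prob_vec M p0 i = (if i = 0 then p0 else (1 - p0) / real M)"

definition symbol_measure :: "nat \<Rightarrow> real \<Rightarrow> nat measure" where
  "symbol_measure M p0 = point_measure {0..M} (\<lambda>i. ennreal (prob_vec M p0 i))"

definition bernoulli_measure :: "nat \<Rightarrow> real \<Rightarrow> (nat \<Rightarrow> nat) measure" where
  "bernoulli_measure M p0 = (\<Pi>\<^sub>M n\<in>UNIV. symbol_measure M p0)"

lemma space_bernoulli_measure: "space (bernoulli_measure M p0) = {\<omega>. \<forall>n. \<omega> n \<in> {0..M}}"
  by (auto simp: bernoulli_measure_def symbol_measure_def space_PiM space_point_measure PiE_iff)

lemma prob_space_symbol_measure: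
  assumes "M \<ge> 1" "0 < p0" "p0 < 1"
  shows "prob_space (symbol_measure M p0)"
proof -
  have nn: "prob_vec M p0 i \<ge> 0" for i
    using assms by (simp add: prob_vec_def)
  have "(\<Sum>i\<in>{0..M}. prob_vec M p0 i) = p0 + (\<Sum>i\<in>{1..M}. prob_vec M p0 i)"
    by (simp add: sum.atLeast_Suc_atMost prob_vec_def)
  also have "(\<Sum>i\<in>{1..M}. prob_vec M p0 i) = (\<Sum>i\<in>{1..M}. (1 - p0) / real M)"
    by (rule sum.cong) (auto simp: prob_vec_def)
  finally have s: "(\<Sum>i\<in>{0..M}. prob_vec M p0 i) = 1"
    using assms by simp
  show ?thesis
  proof
    have "emeasure (symbol_measure M p0) {0..M} = (\<Sum>i\<in>{0..M}. ennreal (prob_vec M p0 i))"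
      unfolding symbol_measure_def by (subst emeasure_point_measure_finite) auto
    also have "\<dots> = 1"
      using nn s by (simp add: sum_ennreal)
    finally show "emeasure (symbol_measure M p0) (space (symbol_measure M p0)) = 1"
      by (simp add: symbol_measure_def space_point_measure)
  qed
qed

lemma prob_space_bernoulli_measure:
  assumes "M \<ge> 1" "0 < p0" "p0 < 1"
  shows "prob_space (bernoulli_measure M p0)"
  unfolding bernoulli_measure_def using prob_space_symbol_measure[OF assms]
  by (intro prob_space_PiM)

definition lyapunov_exponent :: "nat \<Rightarrow> nat \<Rightarrow> real \<Rightarrow> real" where
  "lyapunov_exponent M N p0 = p0 * ln (real N) - (1 - p0) * ln (real M)"

definition orbit_dist :: "nat \<Rightarrow> nat \<Rightarrow> (nat \<Rightarrow> nat) \<Rightarrow> real \<Rightarrow> real \<Rightarrow> nat \<Rightarrow> real" where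
  "orbit_dist M N \<omega> x y n = \<bar>compos M N \<omega> n x - compos M N \<omega> n y\<bar>"

definition close_freq :: "nat \<Rightarrow> nat \<Rightarrow> (nat \<Rightarrow> nat) \<Rightarrow> real \<Rightarrow> real \<Rightarrow> real \<Rightarrow> nat \<Rightarrow> real" where
  "close_freq M N \<omega> x y \<epsilon> n = 1 / real n * real (card {i. 0 \<le> i \<and> i < n \<and> orbit_dist M N \<omega> x y i < \<epsilon>})"

text \<open>Lebesgue measure on the Borel subsets of the unit square. Passing to the completed
  \<open>\<sigma>\<close>-algebra would not change which properties hold almost everywhere.\<close>

definition unit_square_measure :: "(real \<times> real) measure" where
  "unit_square_measure = restrict_space lborel ({0..<1} \<times> {0..<1})"

end

theory Submission
  imports Defs
begin

text \<open>
  The slope of a composition depends only on the types of the symbols, expanding (the symbol \<open>0\<close>) or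
  contracting, and the logarithm of the slope is a random walk whose drift is the Lyapunov exponent. What
  complicates the picture are the discontinuities of the expanding map. The key observation
  (\<open>Et_integral_act\<close>) is that a uniformly distributed point stays uniform when the types are prescribed and
  only the contracting digits are random. Hence the image of the whole unit interval is cut by
  a discontinuity with conditional probability at most proportional to its current length (\<open>cut_probability\<close>). As
  long as there is no cut, all distances are multiplied by the slope.

  For a negative exponent, after sufficiently many contractions in a row the interval is never cut again with probability at
  least one half. As cuts lead to independent new attempts, almost surely some attempt succeeds (\<open>AE_eventually_uncut\<close>), and all
  orbits synchronize.

  For exponent zero the walk is a recurrent martingale with bounded increments. Its unboundedness from above forces every
  nonzero distance to exceed \<open>\<beta>\<close> again and again (\<open>recurrent_separation\<close>). For the frequencies, time is divided into
  cycles. Each begins with \<open>k\<close> contractions, if the symbols allow it, and then lasts until the walk returns or the interval is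
  cut. Optional stopping shows that the excursion below a fixed level survives up to time \<open>n\<close> with probability of order at least \<open>1 / n\<close>, even when cuts
  are taken into account (\<open>long_excursion\<close>). So the cycles have infinite mean length, while two orbits can be far apart
  only during the first \<open>k\<close> steps of each cycle.

  For a positive exponent densities are transported by transfer operators. Expansion reduces the variation of a density, contraction
  increases it and creates jumps whose mean height, over the digits, remains bounded. A function of integral zero therefore decays
  exponentially in the mean (\<open>transfer_mixing\<close>). Given the symbols the two orbits are independent, so the events that they
  are close at two different times decorrelate exponentially (\<open>decorrelation\<close>). A second moment argument yields the almost sure convergence
  of the frequencies to a deterministic limit. This limit is Hoelder continuous in \<open>\<epsilon>\<close> and vanishes at \<open>0\<close>,
  because the densities are bounded up to a random factor with a finite moment of small order (\<open>pair_close_modulus\<close>).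
\<close>

section \<open>Averages over words and over symbol types\<close>

text \<open>
  The average of \<open>F\<close> over words of a given length whose letters are drawn independently from \<open>A\<close> with
  weights \<open>p\<close>. The recursion removes the first letter, in step with the maps, which are applied in the
  order in which the letters are read.
\<close>

primrec word_avg :: "('a \<Rightarrow> real) \<Rightarrow> 'a set \<Rightarrow> nat \<Rightarrow> ('a list \<Rightarrow> real) \<Rightarrow> real" where
  "word_avg p A 0 F = F []"
| "word_avg p A (Suc n) F = (\<Sum>a\<in>A. p a * word_avg p A n (\<lambda>w. F (a # w)))"

locale weights =
  fixes p :: "'a \<Rightarrow> real" and A :: "'a set"
  assumes weight_nonneg: "\<And>a. a \<in> A \<Longrightarrow> 0 \<le> p a"
    and weight_sum: "(\<Sum>a\<in>A. p a) = 1"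
begin

abbreviation avg :: "nat \<Rightarrow> ('a list \<Rightarrow> real) \<Rightarrow> real" where
  "avg \<equiv> word_avg p A"

lemma avg_mono:
  assumes "\<And>w. length w = n \<Longrightarrow> set w \<subseteq> A \<Longrightarrow> F w \<le> G w"
  shows "avg n F \<le> avg n G"
  using assms
proof (induction n arbitrary: F G)
  case (Suc n)
  have "avg n (\<lambda>w. F (a # w)) \<le> avg n (\<lambda>w. G (a # w))" if "a \<in> A" for a
    using that by (intro Suc.IH Suc.prems) auto
  then show ?case
    by (auto intro!: sum_mono mult_left_mono weight_nonneg)
qed auto

lemma avg_cong:
  assumes "\<And>w. length w = n \<Longrightarrow> set w \<subseteq> A \<Longrightarrow> F w = G w"
  shows "avg n F = avg n G"
  using assms by (intro antisym avg_mono) auto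

lemma avg_add: "avg n (\<lambda>w. F w + G w) = avg n F + avg n G"
  by (induction n arbitrary: F G) (auto simp: algebra_simps sum.distrib)

lemma avg_cmult: "avg n (\<lambda>w. c * F w) = c * avg n F"
  by (induction n arbitrary: F) (auto simp: sum_distrib_left mult_ac)

lemma avg_diff: "avg n (\<lambda>w. F w - G w) = avg n F - avg n G"
  using avg_add[of n F "\<lambda>w. (-1) * G w"] avg_cmult[of n "-1" G] by simp

lemma avg_const: "avg n (\<lambda>w. c) = c"
  by (induction n) (auto simp: weight_sum simp flip: sum_distrib_right)

lemma avg_nonneg: "(\<And>w. length w = n \<Longrightarrow> set w \<subseteq> A \<Longrightarrow> 0 \<le> F w) \<Longrightarrow> 0 \<le> avg n F"
  using avg_mono[of n "\<lambda>_. 0" F] by (simp add: avg_const)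

lemma avg_sum: "finite I \<Longrightarrow> avg n (\<lambda>w. \<Sum>i\<in>I. F i w) = (\<Sum>i\<in>I. avg n (F i))"
  by (induction rule: finite_induct) (auto simp: avg_add avg_const)

lemma avg_append: "avg (m + n) F = avg m (\<lambda>u. avg n (\<lambda>w. F (u @ w)))"
  by (induction m arbitrary: F) auto

lemma avg_snoc: "avg (Suc n) F = avg n (\<lambda>u. \<Sum>a\<in>A. p a * F (u @ [a]))"
  using avg_append[of n 1 F] by simp

lemma avg_abs: "\<bar>avg n F\<bar> \<le> avg n (\<lambda>w. \<bar>F w\<bar>)"
proof -
  have "avg n F \<le> avg n (\<lambda>w. \<bar>F w\<bar>)" "avg n (\<lambda>w. (-1) * F w) \<le> avg n (\<lambda>w. \<bar>F w\<bar>)"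
    by (intro avg_mono; simp)+
  then show ?thesis unfolding avg_cmult by linarith
qed

text \<open>
  An event that depends on the first \<open>m\<close> letters has the same probability in all longer words.
\<close>

lemma avg_take:
  assumes "m \<le> n" shows "avg n (\<lambda>w. F (take m w)) = avg m F"
proof -
  have "avg n (\<lambda>w. F (take m w)) = avg (m + (n - m)) (\<lambda>w. F (take m w))"
    using assms by simp
  also have "\<dots> = avg m F"
    unfolding avg_append by (intro avg_cong) (simp add: avg_const)
  finally show ?thesis .
qed

end

text \<open>
  A symbol is expanding if it is \<open>0\<close> and contracting otherwise; the slope of its map depends on this
  type only. Correspondingly \<open>Ew\<close> averages over words of symbols and \<open>Eb\<close> over words of types, \<open>True\<close>
  being the expanding type, and \<open>Et t\<close>, introduced below, averages over the contracting digits when the word of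
  types \<open>t\<close> is given.
\<close>

locale random_maps =
  fixes M N :: nat and p0 :: real
  assumes M2: "2 \<le> M" and N2: "2 \<le> N" and p0_pos: "0 < p0" and p0_lt1: "p0 < 1"
begin

abbreviation "\<nu> \<equiv> bernoulli_measure M p0"
abbreviation "Ew \<equiv> word_avg (prob_vec M p0) {0..M}"
definition "bern z = (if z then p0 else 1 - p0)"
abbreviation "Eb \<equiv> word_avg bern UNIV"

lemma M_pos: "0 < M" and N_pos: "0 < N" using M2 N2 by auto

lemma sum_symbols:
  fixes F :: "nat \<Rightarrow> real"
  shows "(\<Sum>a\<in>{0..M}. prob_vec M p0 a * F a) = p0 * F 0 + (1 - p0) * ((\<Sum>i\<in>{1..M}. F i) / real M)"
proof -
  have "(\<Sum>a\<in>{0..M}. prob_vec M p0 a * F a) = p0 * F 0 + (\<Sum>a\<in>{1..M}. prob_vec M p0 a * F a)"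
    by (subst sum.atLeast_Suc_atMost) (auto simp: prob_vec_def)
  also have "(\<Sum>a\<in>{1..M}. prob_vec M p0 a * F a) = (\<Sum>a\<in>{1..M}. (1 - p0) / real M * F a)"
    by (rule sum.cong) (auto simp: prob_vec_def)
  finally show ?thesis by (simp add: sum_distrib_left sum_divide_distrib)
qed

sublocale W: weights "prob_vec M p0" "{0..M}"
proof
  show "0 \<le> prob_vec M p0 a" for a using p0_pos p0_lt1 by (simp add: prob_vec_def)
  show "(\<Sum>a\<in>{0..M}. prob_vec M p0 a) = 1"
    using sum_symbols[of "\<lambda>_. 1"] M2 by simp
qed

sublocale B: weights bern UNIV
  using p0_pos p0_lt1 by unfold_locales (auto simp: bern_def UNIV_bool)

lemma Eb_Suc: "Eb (Suc n) F = p0 * Eb n (\<lambda>t. F (True # t)) + (1 - p0) * Eb n (\<lambda>t. F (False # t))"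
  by (simp add: UNIV_bool bern_def)

lemma Eb_snoc: "Eb (Suc n) F = Eb n (\<lambda>t. p0 * F (t @ [True]) + (1 - p0) * F (t @ [False]))"
  by (subst B.avg_snoc) (simp add: UNIV_bool bern_def add.commute)

lemma Ew_snoc: "Ew (Suc n) F = Ew n (\<lambda>w. p0 * F (w @ [0]) + (1 - p0) * ((\<Sum>i\<in>{1..M}. F (w @ [i])) / real M))"
  by (subst W.avg_snoc) (simp add: sum_symbols)

primrec Et :: "bool list \<Rightarrow> (nat list \<Rightarrow> real) \<Rightarrow> real" where
  "Et [] F = F []"
| "Et (z # t) F = (if z then Et t (\<lambda>w. F (0 # w)) else (\<Sum>i\<in>{1..M}. Et t (\<lambda>w. F (i # w))) / real M)"

definition "types = map (\<lambda>a. a = (0::nat))"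

lemma types_simps [simp]: "types [] = []" "types (a # w) = (a = 0) # types w" "types (u @ w) = types u @ types w"
  "length (types w) = length w" "types (take k w) = take k (types w)"
  by (auto simp: types_def take_map)

lemma Ew_Suc: "Ew (Suc n) F = p0 * Ew n (\<lambda>w. F (0 # w)) + (1 - p0) * ((\<Sum>i\<in>{1..M}. Ew n (\<lambda>w. F (i # w))) / real M)"
  by (simp add: sum_symbols)

declare word_avg.simps(2) [simp del]

text \<open>
  The contracting digits are uniform and independent of the types because all contracting symbols have the
  same weight.
\<close>

lemma Ew_eq_Eb_Et: "Ew n F = Eb n (\<lambda>t. Et t F)"
proof (induction n arbitrary: F)
  case (Suc n)
  show ?case unfolding Ew_Suc Eb_Suc
    by (simp add: Suc.IH B.avg_sum divide_inverse B.avg_cmult mult.commute[of _ "inverse _"])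
qed auto

lemma Et_mono:
  assumes "\<And>w. types w = t \<Longrightarrow> set w \<subseteq> {0..M} \<Longrightarrow> F w \<le> G w"
  shows "Et t F \<le> Et t G"
  using assms
proof (induction t arbitrary: F G)
  case (Cons z t)
  show ?case
  proof (cases z)
    case True
    then show ?thesis by (auto intro!: Cons.IH Cons.prems)
  next
    case False
    then show ?thesis by (auto intro!: Cons.IH Cons.prems sum_mono divide_right_mono)
  qed
qed auto

lemma Et_cong:
  assumes "\<And>w. types w = t \<Longrightarrow> set w \<subseteq> {0..M} \<Longrightarrow> F w = G w"
  shows "Et t F = Et t G"
  using assms by (intro antisym Et_mono) auto

lemma Et_add: "Et t (\<lambda>w. F w + G w) = Et t F + Et t G"
  by (induction t arbitrary: F G) (auto simp: sum.distrib add_divide_distrib)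

lemma Et_cmult: "Et t (\<lambda>w. c * F w) = c * Et t F"
  by (induction t arbitrary: F) (auto simp: simp flip: sum_distrib_left)

lemma Et_divide: "Et t (\<lambda>w. F w / c) = Et t F / c"
  using Et_cmult[of t "inverse c" F] by (simp add: divide_inverse mult.commute)

lemma Et_const: "Et t (\<lambda>w. c) = c"
  using M_pos by (induction t) auto

lemma Et_sum: "finite I \<Longrightarrow> Et t (\<lambda>w. \<Sum>i\<in>I. F i w) = (\<Sum>i\<in>I. Et t (F i))"
  by (induction rule: finite_induct) (auto simp: Et_add Et_const)

lemma Et_snoc: "Et (t @ [z]) F = Et t (\<lambda>w. if z then F (w @ [0]) else (\<Sum>i\<in>{1..M}. F (w @ [i])) / real M)"
  by (cases z; induction t arbitrary: F) auto

lemma Et_type: "Et t (\<lambda>w. F (types w) w) = Et t (F t)"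
  by (rule Et_cong) simp

lemma Ew_type: "Ew n (\<lambda>w. F (types w)) = Eb n F"
  unfolding Ew_eq_Eb_Et by (rule B.avg_cong) (subst Et_type, simp add: Et_const)

end

section \<open>Words as prefixes of Bernoulli sequences\<close>

definition prefix_word :: "nat \<Rightarrow> (nat \<Rightarrow> 'a) \<Rightarrow> 'a list" where "prefix_word n \<omega> = map \<omega> [0..<n]"
definition shift :: "nat \<Rightarrow> (nat \<Rightarrow> 'a) \<Rightarrow> nat \<Rightarrow> 'a" where "shift n \<omega> = (\<lambda>j. \<omega> (n + j))"

lemma prefix_word_0 [simp]: "prefix_word 0 \<omega> = []" by (simp add: prefix_word_def)
lemma length_prefix_word [simp]: "length (prefix_word n \<omega>) = n" by (simp add: prefix_word_def)
lemma prefix_word_Suc: "prefix_word (Suc n) \<omega> = prefix_word n \<omega> @ [\<omega> n]" by (simp add: prefix_word_def)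
lemma prefix_word_Cons: "prefix_word (Suc n) \<omega> = \<omega> 0 # prefix_word n (shift 1 \<omega>)"
  by (simp add: prefix_word_def shift_def upt_conv_Cons map_Suc_upt[symmetric] del: upt_Suc)
lemma prefix_word_add: "prefix_word (m + n) \<omega> = prefix_word m \<omega> @ prefix_word n (shift m \<omega>)"
  by (induction n) (auto simp: prefix_word_Suc shift_def)
lemma take_prefix_word: "m \<le> n \<Longrightarrow> take m (prefix_word n \<omega>) = prefix_word m \<omega>"
  by (simp add: prefix_word_def take_map)
lemma shift_shift: "shift m (shift n \<omega>) = shift (n + m) \<omega>"
  by (simp add: shift_def add.assoc)
lemma shift_0 [simp]: "shift 0 \<omega> = \<omega>" by (simp add: shift_def)

context random_maps begin

sublocale sym: prob_space "symbol_measure M p0"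
  using M2 p0_pos p0_lt1 by (intro prob_space_symbol_measure) auto

sublocale bp: prob_space \<nu>
  using M2 p0_pos p0_lt1 by (intro prob_space_bernoulli_measure) auto

sublocale seqs: sequence_space "symbol_measure M p0"
  by unfold_locales

lemma coord_measurable [measurable]: "(\<lambda>\<omega>. \<omega> i) \<in> measurable \<nu> (count_space UNIV)"
proof -
  have "(\<lambda>\<omega>. \<omega> i) \<in> measurable \<nu> (symbol_measure M p0)"
    unfolding bernoulli_measure_def by simp
  moreover have "id \<in> measurable (symbol_measure M p0) (count_space UNIV)"
    by (auto simp: measurable_def symbol_measure_def space_point_measure sets_point_measure)
  ultimately show ?thesis using measurable_compose[of "\<lambda>\<omega>. \<omega> i" \<nu> "symbol_measure M p0" id "count_space UNIV"]
    by (simp only: id_apply)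
qed

lemma prefix_word_measurable [measurable]: "prefix_word n \<in> measurable \<nu> (count_space UNIV)"
proof (induction n)
  case 0
  show ?case by (simp add: prefix_word_def)
next
  case (Suc n)
  note Suc[measurable]
  have "(\<lambda>\<omega>. (\<lambda>u \<omega>. (\<lambda>i \<omega>. u @ [i]) (\<omega> n) \<omega>) (prefix_word n \<omega>) \<omega>) \<in> measurable \<nu> (count_space UNIV)"
    by (rule measurable_compose_countable[OF measurable_compose_countable]) auto
  then show ?case by (simp add: prefix_word_Suc[abs_def])
qed

lemma shift_measurable [measurable]: "shift n \<in> measurable \<nu> \<nu>"
  unfolding bernoulli_measure_def shift_def
  by (rule measurable_PiM_single') (simp_all add: measurable_component_singleton, simp add: space_PiM PiE_iff Pi_iff)

lemma space_\<nu>: "\<omega> \<in> space \<nu> \<longleftrightarrow> (\<forall>n. \<omega> n \<le> M)"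
  by (simp add: space_bernoulli_measure)

lemma set_prefix_word: "\<omega> \<in> space \<nu> \<Longrightarrow> set (prefix_word n \<omega>) \<subseteq> {0..M}"
  by (auto simp: space_\<nu> prefix_word_def)

lemma shift_space: "\<omega> \<in> space \<nu> \<Longrightarrow> shift n \<omega> \<in> space \<nu>"
  by (simp add: space_\<nu> shift_def)

lemma case_nat_measurable: "a \<le> M \<Longrightarrow> case_nat a \<in> measurable \<nu> \<nu>"
  unfolding bernoulli_measure_def
proof (rule measurable_PiM_single')
  fix i assume "a \<le> M"
  then show "(\<lambda>\<omega>. case_nat a \<omega> i) \<in> measurable (Pi\<^sub>M UNIV (\<lambda>n. symbol_measure M p0)) (symbol_measure M p0)"
  proof (cases i)
    case 0
    have "a \<in> space (symbol_measure M p0)"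
      using \<open>a \<le> M\<close> by (simp add: symbol_measure_def space_point_measure)
    with 0 show ?thesis by simp
  next
    case (Suc j)
    then show ?thesis by (simp add: measurable_component_singleton)
  qed
next
  assume a: "a \<le> M"
  have sp: "space (symbol_measure M p0) = {0..M}" by (simp add: symbol_measure_def space_point_measure)
  show "case_nat a \<in> space (Pi\<^sub>M UNIV (\<lambda>n. symbol_measure M p0)) \<rightarrow> (UNIV \<rightarrow>\<^sub>E space (symbol_measure M p0))"
    unfolding space_PiM sp using a by (auto simp: PiE_iff Pi_iff split: nat.split)
qed

lemma integral_first_symbol:
  fixes \<Psi> :: "(nat \<Rightarrow> nat) \<Rightarrow> real"
  assumes [measurable]: "\<Psi> \<in> borel_measurable \<nu>" and bd: "\<And>\<omega>. \<bar>\<Psi> \<omega>\<bar> \<le> C"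
  shows "(\<integral>\<omega>. \<Psi> \<omega> \<partial>\<nu>) = (\<Sum>a\<in>{0..M}. prob_vec M p0 a * (\<integral>\<omega>. \<Psi> (case_nat a \<omega>) \<partial>\<nu>))"
proof -
  let ?S = "symbol_measure M p0"
  interpret pr: pair_prob_space ?S \<nu> ..
  have m [measurable]: "(\<lambda>(s, \<omega>). case_nat s \<omega>) \<in> measurable (?S \<Otimes>\<^sub>M \<nu>) \<nu>"
    unfolding bernoulli_measure_def by measurable
  have "(\<integral>\<omega>. \<Psi> \<omega> \<partial>\<nu>) = (\<integral>\<omega>. \<Psi> \<omega> \<partial>distr (?S \<Otimes>\<^sub>M \<nu>) \<nu> (\<lambda>(s, \<omega>). case_nat s \<omega>))"
    using seqs.PiM_iter by (simp add: bernoulli_measure_def)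
  also have "\<dots> = (\<integral>x. \<Psi> (case x of (s, \<omega>) \<Rightarrow> case_nat s \<omega>) \<partial>(?S \<Otimes>\<^sub>M \<nu>))"
    by (rule integral_distr) measurable
  also have "\<dots> = (\<integral>s. (\<integral>\<omega>. \<Psi> (case_nat s \<omega>) \<partial>\<nu>) \<partial>?S)"
  proof -
    have "integrable (?S \<Otimes>\<^sub>M \<nu>) (\<lambda>x. \<Psi> (case x of (s, \<omega>) \<Rightarrow> case_nat s \<omega>))"
      by (rule pr.P.integrable_const_bound[where B=C]) (auto simp: bd)
    from pr.integral_fst'[OF this] show ?thesis by simp
  qed
  also have "\<dots> = (\<Sum>a\<in>{0..M}. prob_vec M p0 a * (\<integral>\<omega>. \<Psi> (case_nat a \<omega>) \<partial>\<nu>))"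
    unfolding symbol_measure_def
    by (subst lebesgue_integral_point_measure_finite) (auto simp: W.weight_nonneg)
  finally show ?thesis .
qed

text \<open>
  Under the Bernoulli measure the first \<open>n\<close> symbols are independent of the shifted sequence, which again has the
  Bernoulli law. All probabilities below are reduced to averages over finite words through this identity.
\<close>

theorem integral_prefix_shift:
  fixes \<Phi> :: "nat list \<Rightarrow> (nat \<Rightarrow> nat) \<Rightarrow> real"
  assumes "\<And>u. \<Phi> u \<in> borel_measurable \<nu>" "\<And>u \<omega>. \<bar>\<Phi> u \<omega>\<bar> \<le> C"
  shows "(\<integral>\<omega>. \<Phi> (prefix_word n \<omega>) (shift n \<omega>) \<partial>\<nu>) = Ew n (\<lambda>u. \<integral>\<omega>. \<Phi> u \<omega> \<partial>\<nu>)"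
  using assms
proof (induction n arbitrary: \<Phi>)
  case (Suc n)
  have [measurable]: "(\<lambda>\<omega>. \<Phi> (prefix_word (Suc n) \<omega>) (shift (Suc n) \<omega>)) \<in> borel_measurable \<nu>"
    by (rule measurable_compose_countable[where f="\<lambda>u \<omega>. \<Phi> u (shift (Suc n) \<omega>)"])
       (rule measurable_compose[OF shift_measurable Suc.prems(1)], rule prefix_word_measurable)
  have "(\<integral>\<omega>. \<Phi> (prefix_word (Suc n) \<omega>) (shift (Suc n) \<omega>) \<partial>\<nu>)
      = (\<Sum>a\<in>{0..M}. prob_vec M p0 a * (\<integral>\<omega>. \<Phi> (prefix_word (Suc n) (case_nat a \<omega>)) (shift (Suc n) (case_nat a \<omega>)) \<partial>\<nu>))"
    by (rule integral_first_symbol[where C=C]) (auto simp: Suc.prems)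
  also have "\<dots> = (\<Sum>a\<in>{0..M}. prob_vec M p0 a * (\<integral>\<omega>. \<Phi> (a # prefix_word n \<omega>) (shift n \<omega>) \<partial>\<nu>))"
    by (simp add: prefix_word_Cons shift_def)
  also have "\<dots> = Ew (Suc n) (\<lambda>u. \<integral>\<omega>. \<Phi> u \<omega> \<partial>\<nu>)"
    by (simp add: word_avg.simps(2) Suc.IH[of "\<lambda>u. \<Phi> (_ # u)"] Suc.prems)
  finally show ?case .
qed auto

lemma integral_prefix: 
  fixes F :: "nat list \<Rightarrow> real"
  shows "(\<integral>\<omega>. F (prefix_word n \<omega>) \<partial>\<nu>) = Ew n F"
proof -
  let ?W = "{w. set w \<subseteq> {0..M} \<and> length w = n}"
  have fin: "finite ?W" by (rule finite_lists_length_eq) simp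
  define C where "C = (\<Sum>w\<in>?W. \<bar>F w\<bar>)"
  define G where "G w = (if w \<in> ?W then F w else 0)" for w
  have "\<bar>G w\<bar> \<le> C" for w
  proof (cases "w \<in> ?W")
    case True
    then show ?thesis
      unfolding G_def C_def using member_le_sum[OF True _ fin, of "\<lambda>w. \<bar>F w\<bar>"] by simp
  next
    case False
    then show ?thesis unfolding G_def C_def by (auto intro!: sum_nonneg)
  qed
  then have "(\<integral>\<omega>. (\<lambda>u _. G u) (prefix_word n \<omega>) (shift n \<omega>) \<partial>\<nu>) = Ew n (\<lambda>u. \<integral>\<omega>. G u \<partial>\<nu>)"
    by (intro integral_prefix_shift[where C=C and \<Phi>="\<lambda>u _. G u"]) simp_all
  moreover have "(\<integral>\<omega>. G (prefix_word n \<omega>) \<partial>\<nu>) = (\<integral>\<omega>. F (prefix_word n \<omega>) \<partial>\<nu>)"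
    by (intro Bochner_Integration.integral_cong refl) (simp add: G_def set_prefix_word)
  moreover have "Ew n G = Ew n F"
    by (rule W.avg_cong) (auto simp: G_def)
  ultimately show ?thesis by (simp add: bp.prob_space)
qed

lemma prob_prefix_shift:
  assumes [measurable]: "D \<in> sets \<nu>"
  shows "measure \<nu> {\<omega> \<in> space \<nu>. Q (prefix_word n \<omega>) \<and> shift n \<omega> \<in> D}
       = Ew n (\<lambda>w. of_bool (Q w)) * measure \<nu> D"
proof -
  have "measure \<nu> {\<omega> \<in> space \<nu>. Q (prefix_word n \<omega>) \<and> shift n \<omega> \<in> D}
      = (\<integral>\<omega>. indicator {\<omega> \<in> space \<nu>. Q (prefix_word n \<omega>) \<and> shift n \<omega> \<in> D} \<omega> \<partial>\<nu>)"
    by simp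
  also have "\<dots> = (\<integral>\<omega>. (\<lambda>u \<omega>. of_bool (Q u) * indicator D \<omega>) (prefix_word n \<omega>) (shift n \<omega>) \<partial>\<nu>)"
    by (intro Bochner_Integration.integral_cong refl) (auto simp: indicator_def)
  also have "\<dots> = Ew n (\<lambda>u. \<integral>\<omega>. of_bool (Q u) * indicator D \<omega> \<partial>\<nu>)"
    by (rule integral_prefix_shift[where C=1 and \<Phi>="\<lambda>u \<omega>. of_bool (Q u) * indicator D \<omega>"]) (auto simp: indicator_def)
  also have "\<dots> = Ew n (\<lambda>u. measure \<nu> D * of_bool (Q u))"
    by (rule W.avg_cong) simp
  finally show ?thesis unfolding W.avg_cmult by (simp add: mult.commute)
qed

lemma prob_prefix:
  "measure \<nu> {\<omega> \<in> space \<nu>. Q (prefix_word n \<omega>)} = Ew n (\<lambda>w. of_bool (Q w))"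
proof -
  have "{\<omega> \<in> space \<nu>. Q (prefix_word n \<omega>) \<and> shift n \<omega> \<in> space \<nu>} = {\<omega> \<in> space \<nu>. Q (prefix_word n \<omega>)}"
    by (auto simp: space_\<nu> shift_def)
  then show ?thesis using prob_prefix_shift[of "space \<nu>" Q n] by (simp add: bp.prob_space)
qed

end

section \<open>Lebesgue measure on the unit interval\<close>

text \<open>
  As a density with respect to \<open>lborel\<close>, rather than as a restriction, the measure has all Borel sets of the
  line as its measurable sets, so that measurability of functions on the line carries over unchanged.
\<close>

definition unit_lebesgue :: "real measure" where
  "unit_lebesgue = density lborel (\<lambda>x. ennreal (indicator {0..<1} x))"

abbreviation "lam \<equiv> unit_lebesgue"

lemma sets_lam [measurable_cong, simp]: "sets lam = sets borel"
  by (simp add: unit_lebesgue_def)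

lemma space_lam [simp]: "space lam = UNIV"
  by (simp add: unit_lebesgue_def)

interpretation lam: prob_space lam
proof
  show "emeasure lam (space lam) = 1"
    by (simp add: unit_lebesgue_def emeasure_density ennreal_indicator)
qed

lemma lam_UNIV [simp]: "measure lam UNIV = 1"
  using lam.prob_space by simp

lemma AE_lam: "AE x in lam. 0 \<le> x \<and> x < 1"
  unfolding unit_lebesgue_def by (subst AE_density) (auto simp: indicator_def)

lemma integral_lam:
  fixes f :: "real \<Rightarrow> real"
  assumes [measurable]: "f \<in> borel_measurable borel"
  shows "(\<integral>x. f x \<partial>lam) = (\<integral>x. indicator {0..<1} x * f x \<partial>lborel)"
  unfolding unit_lebesgue_def by (subst integral_density) auto

lemma integrable_lam_bounded:
  fixes f :: "real \<Rightarrow> real"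
  assumes "f \<in> borel_measurable borel" "\<And>x. \<bar>f x\<bar> \<le> C"
  shows "integrable lam f"
  using assms by (intro lam.integrable_const_bound[where B=C]) (auto simp: measurable_cong_sets[OF sets_lam refl])

lemma integral_lam_cong:
  fixes f g :: "real \<Rightarrow> real"
  assumes [measurable]: "f \<in> borel_measurable borel" "g \<in> borel_measurable borel"
    and "\<And>x. 0 \<le> x \<Longrightarrow> x < 1 \<Longrightarrow> f x = g x"
  shows "(\<integral>x. f x \<partial>lam) = (\<integral>x. g x \<partial>lam)"
  using AE_lam assms(3) by (intro integral_cong_AE) auto

lemma integral_lam_mono:
  fixes f g :: "real \<Rightarrow> real"
  assumes "integrable lam f" "integrable lam g"
    and "\<And>x. 0 \<le> x \<Longrightarrow> x < 1 \<Longrightarrow> f x \<le> g x"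
  shows "(\<integral>x. f x \<partial>lam) \<le> (\<integral>x. g x \<partial>lam)"
  using AE_lam assms by (intro integral_mono_AE) auto

text \<open>
  The \<open>K\<close> inverse branches \<open>s \<mapsto> (s + k) / K\<close> tile the unit interval. With \<open>K = N\<close> this gives the invariance of
  Lebesgue measure under the expanding map, with \<open>K = M\<close> its invariance under a random contraction.
\<close>

lemma integral_lam_branches:
  fixes F :: "real \<Rightarrow> real" and K :: nat
  assumes K: "0 < K" and m [measurable]: "F \<in> borel_measurable borel" and bd: "\<And>x. \<bar>F x\<bar> \<le> C"
  shows "(\<integral>x. F x \<partial>lam) = (\<Sum>k<K. \<integral>s. F ((s + real k) / real K) \<partial>lam) / real K"
proof -
  define I where "I k x = indicator {0..<1::real} (- real k + real K * x) * F x" for k :: nat and x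
  have K': "real K \<noteq> 0" using K by simp
  have eq: "- real k + real K * x + real k = real K * x" for k x by simp
  have int: "integrable lborel (\<lambda>s. indicator {0..<1} s * F ((s + real k) / real K))" for k :: nat
  proof -
    have "integrable lam (\<lambda>s. F ((s + real k) / real K))"
      using bd by (intro integrable_lam_bounded[where C=C]) auto
    then show ?thesis
      unfolding unit_lebesgue_def by (subst (asm) integrable_density) auto
  qed
  have intI: "integrable lborel (I k)" for k
    using lborel_integrable_real_affine[OF int[of k] K', of "- real k"] K' unfolding I_def by (simp add: eq)
  have "(\<integral>s. F ((s + real k) / real K) \<partial>lam) = real K * (\<integral>x. I k x \<partial>lborel)" for k :: nat
    unfolding I_def
    by (subst integral_lam, simp, subst lborel_integral_real_affine[OF K', of _ "- real k"])
       (use K in \<open>simp_all add: eq\<close>)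
  then have "(\<Sum>k<K. \<integral>s. F ((s + real k) / real K) \<partial>lam) / real K = (\<Sum>k<K. \<integral>x. I k x \<partial>lborel)"
    using K' by (simp flip: sum_distrib_left)
  also have "\<dots> = (\<integral>x. (\<Sum>k<K. I k x) \<partial>lborel)"
    using intI by (simp add: Bochner_Integration.integral_sum)
  also have "\<dots> = (\<integral>x. indicator {0..<1} x * F x \<partial>lborel)"
  proof (intro Bochner_Integration.integral_cong refl)
    fix x :: real
    have "(\<Sum>k<K. indicator {0..<1} (- real k + real K * x)) = (indicator {0..<1} x :: real)"
    proof (cases "0 \<le> x \<and> x < 1")
      case True
      define j where "j = nat \<lfloor>real K * x\<rfloor>"
      have nn: "0 \<le> real K * x" using True by simp
      have Kx: "real K * x < real K" using True K by simp
      have j1: "real j \<le> real K * x" "real K * x < real j + 1"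
        using nn unfolding j_def by linarith+
      have "j < K" using j1 Kx by linarith
      have "(\<Sum>k<K. indicator {0..<1} (- real k + real K * x)) = (\<Sum>k<K. if k = j then 1 else 0 :: real)"
      proof (rule sum.cong[OF refl])
        fix k
        have "0 \<le> - real k + real K * x \<and> - real k + real K * x < 1 \<longleftrightarrow> k = j"
          using j1 by linarith
        then show "indicator {0..<1} (- real k + real K * x) = (if k = j then 1 else 0 :: real)"
          by (auto simp: indicator_def)
      qed
      then show ?thesis using True \<open>j < K\<close> by simp
    next
      case False
      have "indicator {0..<1} (- real k + real K * x) = (0::real)" if "k < K" for k
      proof (cases "x < 0")
        case True
        then have "real K * x < 0" using K by (simp add: mult_less_0_iff)
        then show ?thesis by (auto simp: indicator_def)
      next
        case f: False
        then have "1 \<le> x" using False by simp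
        then have "real K \<le> real K * x" using K by simp
        moreover have "real k + 1 \<le> real K" using that by linarith
        ultimately have "1 \<le> - real k + real K * x" by linarith
        then show ?thesis unfolding indicator_def by simp
      qed
      then have "(\<Sum>k<K. indicator {0..<1} (- real k + real K * x)) = (0::real)"
        by (intro sum.neutral) auto
      moreover have "indicator {0..<1} x = (0::real)" using False by (auto simp: indicator_def)
      ultimately show ?thesis by simp
    qed
    then show "(\<Sum>k<K. I k x) = indicator {0..<1} x * F x"
      by (simp add: I_def flip: sum_distrib_right)
  qed
  also have "\<dots> = (\<integral>x. F x \<partial>lam)" by (simp add: integral_lam)
  finally show ?thesis by simp
qed

lemma lam_Iio: "0 \<le> r \<Longrightarrow> measure lam {..<r} \<le> r"
proof -
  assume r: "0 \<le> r"
  have "emeasure lam {..<r} = (\<integral>\<^sup>+x. indicator ({0..<1} \<inter> {..<r}) x \<partial>lborel)"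
    by (simp add: unit_lebesgue_def emeasure_density ennreal_indicator indicator_inter_arith)
  also have "\<dots> \<le> (\<integral>\<^sup>+x. indicator {0..<r} x \<partial>lborel)"
    by (intro nn_integral_mono) (auto simp: indicator_def)
  also have "\<dots> = ennreal r" using r by simp
  finally show ?thesis unfolding measure_def using r by (simp add: enn2real_leI)
qed

lemma measure_lam_interval: 
  assumes "a \<le> b" shows "measure lam {a..b} \<le> b - a"
proof -
  have "emeasure lam {a..b} = (\<integral>\<^sup>+x. indicator ({0..<1} \<inter> {a..b}) x \<partial>lborel)"
    by (simp add: unit_lebesgue_def emeasure_density ennreal_indicator indicator_inter_arith)
  also have "\<dots> \<le> (\<integral>\<^sup>+x. indicator {a..b} x \<partial>lborel)"
    by (intro nn_integral_mono) (auto simp: indicator_def)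
  also have "\<dots> = ennreal (b - a)" using assms by simp
  finally show ?thesis unfolding measure_def using assms by (simp add: enn2real_leI)
qed

lemma borel_measurable_frac [measurable]: "frac \<in> borel_measurable (borel :: real measure)"
  by (simp add: frac_def[abs_def])

context random_maps begin

lemma gen_map_measurable [measurable]: "gen_map M N i \<in> borel_measurable borel"
  unfolding gen_map_def by (cases "i = 0") (auto simp: frac_def)

section \<open>Affine words and the probability of a cut\<close>

definition act :: "nat list \<Rightarrow> real \<Rightarrow> real" where "act = fold (gen_map M N)"

lemma act_simps [simp]: "act [] x = x" "act (a # w) x = act w (gen_map M N a x)"
  "act (u @ w) x = act w (act u x)"
  by (auto simp: act_def)

lemma act_measurable [measurable]: "act w \<in> borel_measurable borel"
proof (induction w)
  case (Cons a w)
  note Cons[measurable]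
  have "act (a # w) = (\<lambda>x. act w (gen_map M N a x))" by auto
  then show ?case by simp
qed (auto simp: act_def)

lemma act_unit: "set w \<subseteq> {0..M} \<Longrightarrow> 0 \<le> x \<and> x < 1 \<Longrightarrow> 0 \<le> act w x \<and> act w x < 1"
proof (induction w arbitrary: x)
  case (Cons a w)
  have "gen_map M N a x \<in> {0..<1}" using Cons.prems by (intro gen_map_in_unit) auto
  then show ?case using Cons by auto
qed auto

lemma compos_eq_act: "compos M N \<omega> n x = act (prefix_word n \<omega>) x"
  by (induction n) (auto simp: prefix_word_Suc)

lemma integral_gen_map_0:
  fixes g :: "real \<Rightarrow> real"
  assumes [measurable]: "g \<in> borel_measurable borel" and bd: "\<And>x. \<bar>g x\<bar> \<le> C"
  shows "(\<integral>z. g (gen_map M N 0 z) \<partial>lam) = (\<integral>z. g z \<partial>lam)"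
proof -
  have br: "(\<integral>s. g (gen_map M N 0 ((s + real k) / real N)) \<partial>lam) = (\<integral>s. g s \<partial>lam)" for k :: nat
  proof (rule integral_lam_cong)
    fix s :: real assume "0 \<le> s" "s < 1"
    then have "frac (s + real k) = s"
      by (simp add: frac_unique_iff)
    then show "g (gen_map M N 0 ((s + real k) / real N)) = g s"
      using N_pos by (simp add: gen_map_def)
  qed measurable
  have "(\<integral>z. g (gen_map M N 0 z) \<partial>lam) = (\<Sum>k<N. \<integral>s. g (gen_map M N 0 ((s + real k) / real N)) \<partial>lam) / real N"
    using N_pos bd by (intro integral_lam_branches[where C=C]) auto
  also have "\<dots> = (\<Sum>k<N. \<integral>s. g s \<partial>lam) / real N" unfolding br ..
  finally show ?thesis using N_pos by simp
qed

lemma integral_gen_map_avg: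
  fixes g :: "real \<Rightarrow> real"
  assumes [measurable]: "g \<in> borel_measurable borel" and bd: "\<And>x. \<bar>g x\<bar> \<le> C"
  shows "(\<Sum>i\<in>{1..M}. \<integral>z. g (gen_map M N i z) \<partial>lam) / real M = (\<integral>z. g z \<partial>lam)"
proof -
  have "(\<Sum>i\<in>{1..M}. \<integral>z. g (gen_map M N i z) \<partial>lam) = (\<Sum>k<M. \<integral>z. g (gen_map M N (Suc k) z) \<partial>lam)"
    by (rule sum.reindex_bij_witness[of _ Suc "\<lambda>i. i - 1"]) auto
  also have "\<dots> = (\<Sum>k<M. \<integral>z. g ((z + real k) / real M) \<partial>lam)"
    by (simp add: gen_map_def)
  finally show ?thesis
    using integral_lam_branches[OF M_pos assms] by simp
qed

text \<open>
  A point that starts uniformly distributed stays uniformly distributed at each time, even when the word of types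
  is given: the expanding map preserves Lebesgue measure, and so does the average of the \<open>M\<close> contractions.
\<close>

lemma Et_integral_act:
  fixes g :: "real \<Rightarrow> real"
  assumes "g \<in> borel_measurable borel" "\<And>x. \<bar>g x\<bar> \<le> C"
  shows "Et t (\<lambda>w. \<integral>z. g (act w z) \<partial>lam) = (\<integral>z. g z \<partial>lam)"
  using assms
proof (induction t arbitrary: g rule: rev_induct)
  case (snoc z t)
  note snoc.prems(1)[measurable]
  show ?case
  proof (cases z)
    case True
    have "Et (t @ [z]) (\<lambda>w. \<integral>z. g (act w z) \<partial>lam) = Et t (\<lambda>w. \<integral>z. g (gen_map M N 0 (act w z)) \<partial>lam)"
      using True by (simp add: Et_snoc)
    also have "\<dots> = (\<integral>z. g (gen_map M N 0 z) \<partial>lam)"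
      using snoc.prems(2) by (intro snoc.IH) auto
    also have "\<dots> = (\<integral>z. g z \<partial>lam)" using snoc.prems by (rule integral_gen_map_0)
    finally show ?thesis .
  next
    case False
    have "Et (t @ [z]) (\<lambda>w. \<integral>z. g (act w z) \<partial>lam)
        = Et t (\<lambda>w. (\<Sum>i\<in>{1..M}. \<integral>z. g (gen_map M N i (act w z)) \<partial>lam) / real M)"
      using False by (simp add: Et_snoc)
    also have "\<dots> = (\<Sum>i\<in>{1..M}. Et t (\<lambda>w. \<integral>z. g (gen_map M N i (act w z)) \<partial>lam)) / real M"
      by (simp add: Et_divide Et_sum)
    also have "\<dots> = (\<Sum>i\<in>{1..M}. \<integral>z. g (gen_map M N i z) \<partial>lam) / real M"
      using snoc.prems(2) by (intro arg_cong2[where f="(/)"] sum.cong refl snoc.IH) auto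
    also have "\<dots> = (\<integral>z. g z \<partial>lam)" using snoc.prems by (rule integral_gen_map_avg)
    finally show ?thesis .
  qed
qed (simp add: act_def)

definition step_log :: "bool \<Rightarrow> real" where "step_log z = (if z then ln (real N) else - ln (real M))"
definition lslope :: "bool list \<Rightarrow> real" where "lslope t = (\<Sum>z\<leftarrow>t. step_log z)"

lemma lslope_simps [simp]: "lslope [] = 0" "lslope (z # t) = step_log z + lslope t"
  "lslope (s @ t) = lslope s + lslope t"
  by (auto simp: lslope_def)

lemma exp_step_log: "exp (step_log z) = (if z then real N else 1 / real M)"
  using M_pos N_pos by (simp add: step_log_def exp_minus field_simps)

text \<open>
  A word is affine if its composition does not meet a discontinuity of the expanding map when it is applied to the
  whole unit interval. The distance of any two points is then multiplied by exactly the slope of the word.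
\<close>

definition affine_word :: "nat list \<Rightarrow> bool" where
  "affine_word w \<longleftrightarrow> (\<forall>x. 0 \<le> x \<and> x < 1 \<longrightarrow> act w x = act w 0 + exp (lslope (types w)) * x)"

lemma affine_wordD: "affine_word w \<Longrightarrow> 0 \<le> x \<Longrightarrow> x < 1 \<Longrightarrow> act w x = act w 0 + exp (lslope (types w)) * x"
  unfolding affine_word_def by blast

lemma affine_word_Nil [simp]: "affine_word []"
  by (simp add: affine_word_def)

lemma affine_word_contract: "affine_word w \<Longrightarrow> i \<noteq> 0 \<Longrightarrow> affine_word (w @ [i])"
  unfolding affine_word_def
proof (intro allI impI)
  fix x :: real assume i: "i \<noteq> 0" and x: "0 \<le> x \<and> x < 1"
    and *: "\<forall>x. 0 \<le> x \<and> x < 1 \<longrightarrow> act w x = act w 0 + exp (lslope (types w)) * x"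
  have e: "act w x = act w 0 + exp (lslope (types w)) * x" using * x by blast
  show "act (w @ [i]) x = act (w @ [i]) 0 + exp (lslope (types (w @ [i]))) * x"
    using i by (simp add: e gen_map_def exp_add exp_step_log add_divide_distrib diff_divide_distrib)
qed

lemma affine_word_dist:
  assumes "affine_word w" "0 \<le> x" "x < 1" "0 \<le> y" "y < 1"
  shows "\<bar>act w x - act w y\<bar> = exp (lslope (types w)) * \<bar>x - y\<bar>"
proof -
  have "act w x - act w y = exp (lslope (types w)) * (x - y)"
    using affine_wordD[OF assms(1-3)] affine_wordD[OF assms(1,4,5)] by (simp add: algebra_simps)
  then show ?thesis by (simp add: abs_mult)
qed

text \<open>
  The image of the unit interval under an affine word is an interval whose length is the slope. If a
  discontinuity of the expanding map lies in its interior, then all its points are close to that discontinuity.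
\<close>

lemma cut_near_discontinuity:
  assumes aff: "affine_word w" and cut: "\<not> affine_word (w @ [0])" and z: "0 \<le> z" "z < 1"
    and r: "r = real N * exp (lslope (types w))"
  shows "frac (real N * act w z) < r \<or> 1 - r < frac (real N * act w z)"
proof (cases "r < 1")
  case False
  then show ?thesis using frac_lt_1[of "real N * act w z"] by linarith
next
  case r1: True
  define b where "b = frac (real N * act w 0)"
  have r0: "0 < r" using r N_pos by simp
  have im: "real N * act w x = real_of_int \<lfloor>real N * act w 0\<rfloor> + (b + r * x)" if "0 \<le> x" "x < 1" for x
    unfolding affine_wordD[OF aff that] b_def frac_def r by (simp add: algebra_simps)
  have fr: "frac (real N * act w x) = frac (b + r * x)" if "0 \<le> x" "x < 1" for x
    unfolding im[OF that] by (simp add: frac_def)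
  have b: "0 \<le> b" "b < 1" by (auto simp: b_def frac_lt_1)
  have "1 < b + r"
  proof (rule ccontr)
    assume *: "\<not> 1 < b + r"
    have "frac (b + r * x) = b + r * x" if "0 \<le> x" "x < 1" for x
    proof -
      have "r * x < r * 1" using that r0 by (intro mult_strict_left_mono) auto
      moreover have "0 \<le> r * x" using that r0 by simp
      ultimately have "0 \<le> b + r * x \<and> b + r * x < 1" using * b by linarith
      then show ?thesis by (simp only: frac_eq)
    qed
    then have lin: "frac (real N * act w x) = b + r * x" if "0 \<le> x" "x < 1" for x
      using that fr by simp
    have sl: "exp (lslope (types (w @ [0]))) = r" by (simp add: exp_add exp_step_log r)
    have "affine_word (w @ [0])"
      unfolding affine_word_def sl by (simp add: gen_map_def lin)
    with cut show False by simp
  qed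
  have rz: "0 \<le> r * z" "r * z < r" using z r0 by auto
  show ?thesis
  proof (cases "b + r * z < 1")
    case True
    then have "frac (b + r * z) = b + r * z" using b rz by (simp add: frac_eq)
    then show ?thesis using \<open>1 < b + r\<close> rz fr[OF z] by linarith
  next
    case False
    then have "frac (b + r * z) = b + r * z - 1"
      using b rz r1 by (subst frac_unique_iff) auto
    then show ?thesis using b rz fr[OF z] by linarith
  qed
qed

lemma lam_near_discontinuity:
  assumes "0 \<le> r"
  shows "(\<integral>z. of_bool (frac (real N * z) < r \<or> 1 - r < frac (real N * z)) \<partial>lam) \<le> min 1 (2 * r)"
proof -
  let ?g = "\<lambda>z::real. of_bool (z < r \<or> 1 - r < z) :: real"
  have [measurable]: "?g \<in> borel_measurable borel" by measurable
  have "(\<integral>z. of_bool (frac (real N * z) < r \<or> 1 - r < frac (real N * z)) \<partial>lam) = (\<integral>z. ?g (gen_map M N 0 z) \<partial>lam)"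
    by (simp add: gen_map_def)
  also have "\<dots> = (\<integral>z. ?g z \<partial>lam)" by (rule integral_gen_map_0[where C=1]) auto
  also have "\<dots> \<le> (\<integral>z. indicator {..<r} z + indicator {1 - r..1} z \<partial>lam)"
    by (intro integral_lam_mono) (auto simp: indicator_def intro!: integrable_lam_bounded[where C=2])
  also have "\<dots> = measure lam {..<r} + measure lam {1 - r..1}"
    by (subst Bochner_Integration.integral_add) (auto intro!: integrable_lam_bounded[where C=1])
  also have "\<dots> \<le> 2 * r" using lam_Iio[of r] measure_lam_interval[of "1 - r" 1] assms by simp
  finally have "(\<integral>z. of_bool (frac (real N * z) < r \<or> 1 - r < frac (real N * z)) \<partial>lam) \<le> 2 * r" .
  moreover have "(\<integral>z. of_bool (frac (real N * z) < r \<or> 1 - r < frac (real N * z)) \<partial>lam) \<le> (\<integral>z. (1::real) \<partial>lam)"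
  proof (rule integral_lam_mono)
    show "integrable lam (\<lambda>z. of_bool (frac (real N * z) < r \<or> 1 - r < frac (real N * z)) :: real)"
      by (rule integrable_lam_bounded[where C=1]) auto
  qed auto
  ultimately show ?thesis by (simp add: lam.prob_space)
qed

text \<open>
  A uniformly chosen point of the unit interval witnesses a cut by lying close to a discontinuity, and by
  \<open>Et_integral_act\<close> its position is uniform whatever the types are. Hence the conditional probability of a cut, given the types,
  is at most twice \<open>N\<close> times the current slope, although the symbols alone determine whether a cut happens.
\<close>

lemma cut_probability:
  assumes g: "\<And>t. 0 \<le> g t"
  shows "Ew n (\<lambda>w. g (types w) * of_bool (affine_word w \<and> \<not> affine_word (w @ [0])))
       \<le> Eb n (\<lambda>t. g t * min 1 (2 * (real N * exp (lslope t))))"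
proof -
  define r where "r t = real N * exp (lslope t)" for t
  define G where "G t z = (of_bool (frac (real N * z) < r t \<or> 1 - r t < frac (real N * z)) :: real)" for t z
  have [measurable]: "G t \<in> borel_measurable borel" for t
    unfolding G_def by measurable
  have "Ew n (\<lambda>w. g (types w) * of_bool (affine_word w \<and> \<not> affine_word (w @ [0])))
     \<le> Ew n (\<lambda>w. g (types w) * (\<integral>z. G (types w) (act w z) \<partial>lam))"
  proof (rule W.avg_mono)
    fix w
    have "of_bool (affine_word w \<and> \<not> affine_word (w @ [0])) \<le> (\<integral>z. G (types w) (act w z) \<partial>lam)"
    proof (cases "affine_word w \<and> \<not> affine_word (w @ [0])")
      case True
      then have "(\<integral>z. G (types w) (act w z) \<partial>lam) = (\<integral>z. 1 \<partial>lam)"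
        by (intro integral_lam_cong)
           (measurable, simp add: G_def r_def cut_near_discontinuity[OF _ _ _ _ refl])
      then show ?thesis by (simp add: lam.prob_space)
    qed (auto simp: G_def)
    then show "g (types w) * of_bool (affine_word w \<and> \<not> affine_word (w @ [0])) \<le> g (types w) * (\<integral>z. G (types w) (act w z) \<partial>lam)"
      by (intro mult_left_mono g)
  qed
  also have "\<dots> = Eb n (\<lambda>t. Et t (\<lambda>w. g t * (\<integral>z. G t (act w z) \<partial>lam)))"
    unfolding Ew_eq_Eb_Et by (intro B.avg_cong Et_cong) auto
  also have "\<dots> = Eb n (\<lambda>t. g t * (\<integral>z. G t z \<partial>lam))"
    unfolding Et_cmult by (subst Et_integral_act[where C=1]) (auto simp: G_def)
  also have "\<dots> \<le> Eb n (\<lambda>t. g t * min 1 (2 * r t))"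
    unfolding G_def by (intro B.avg_mono mult_left_mono g lam_near_discontinuity) (auto simp: r_def)
  finally show ?thesis by (simp add: r_def)
qed

end

section \<open>Negative Lyapunov exponent: synchronization\<close>

text \<open>
  The derivative at \<open>t = 0\<close> is the mean of the two increments. A negative mean therefore makes a
  small exponential moment less than one.
\<close>

lemma perturb_exp_moment:
  fixes a b p :: real
  assumes "p * a + (1 - p) * b < 0"
  obtains t where "0 < t" "t \<le> 1" "p * exp (t * a) + (1 - p) * exp (t * b) < 1"
proof -
  let ?f = "\<lambda>t. p * exp (t * a) + (1 - p) * exp (t * b)"
  have "(?f has_real_derivative p * (exp (0 * a) * a) + (1 - p) * (exp (0 * b) * b)) (at 0)"
    by (auto intro!: derivative_eq_intros)
  from DERIV_neg_dec_right[OF this] assms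
  obtain d where d: "0 < d" "\<And>h. 0 < h \<Longrightarrow> h < d \<Longrightarrow> ?f (0 + h) < ?f 0" by auto
  define t where "t = min 1 (d / 2)"
  have "0 < t" "t < d" "t \<le> 1" using d(1) by (auto simp: t_def)
  with d(2)[of t] show thesis by (intro that[of t]) auto
qed

context random_maps begin

lemma lyapunov_step: "lyapunov_exponent M N p0 = p0 * step_log True + (1 - p0) * step_log False"
  by (simp add: lyapunov_exponent_def step_log_def)

lemma ln_M_pos: "0 < ln (real M)" and ln_N_pos: "0 < ln (real N)"
  using M2 N2 by auto

definition contracting_start :: "nat \<Rightarrow> bool list \<Rightarrow> bool" where
  "contracting_start k t \<longleftrightarrow> True \<notin> set (take k t)"

text \<open>
  All prefixes are required to be affine, so that a violation has a first time.
\<close>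

definition uncut :: "nat list \<Rightarrow> bool" where
  "uncut w \<longleftrightarrow> (\<forall>j\<le>length w. affine_word (take j w))"

lemma uncut_snoc: "uncut (w @ [a]) \<longleftrightarrow> uncut w \<and> affine_word (w @ [a])"
proof -
  have "uncut (w @ [a]) \<longleftrightarrow> (\<forall>j\<le>length w. affine_word (take j (w @ [a]))) \<and> affine_word (w @ [a])"
    unfolding uncut_def by (auto simp: le_Suc_eq)
  then show ?thesis unfolding uncut_def by simp
qed

lemma uncut_Nil [simp]: "uncut []" by (simp add: uncut_def)

lemma uncut_affine: "uncut w \<Longrightarrow> affine_word w"
  unfolding uncut_def by (metis order_refl take_all)

lemma uncut_contracting: "True \<notin> set (types w) \<Longrightarrow> uncut w"
proof (induction w rule: rev_induct)
  case (snoc a w)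
  then have "a \<noteq> 0" "uncut w" by auto
  then show ?case by (simp add: uncut_snoc affine_word_contract uncut_affine)
qed simp

lemma Eb_contracting_start:
  "Eb k (\<lambda>t. of_bool (True \<notin> set t) * F (lslope t)) = (1 - p0) ^ k * F (real k * step_log False)"
proof (induction k arbitrary: F)
  case (Suc k)
  have "Eb (Suc k) (\<lambda>t. of_bool (True \<notin> set t) * F (lslope t))
      = (1 - p0) * Eb k (\<lambda>t. of_bool (True \<notin> set t) * F (step_log False + lslope t))"
    by (simp add: Eb_Suc B.avg_const[of k 0])
  then show ?case unfolding Suc.IH[of "\<lambda>x. F (step_log False + x)"] by (simp add: algebra_simps)
qed simp

lemma Eb_exp_lslope:
  "Eb n (\<lambda>t. exp (s * lslope t)) = (p0 * exp (s * step_log True) + (1 - p0) * exp (s * step_log False)) ^ n"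
proof (induction n)
  case (Suc n)
  have "Eb (Suc n) (\<lambda>t. exp (s * lslope t))
     = p0 * (exp (s * step_log True) * Eb n (\<lambda>t. exp (s * lslope t)))
       + (1 - p0) * (exp (s * step_log False) * Eb n (\<lambda>t. exp (s * lslope t)))"
    unfolding Eb_Suc B.avg_cmult[symmetric] by (simp add: ring_distribs exp_add)
  then show ?case by (simp add: Suc.IH algebra_simps)
qed simp

lemma Eb_contracting_exp:
  "Eb (k + m) (\<lambda>t. of_bool (contracting_start k t) * exp (s * lslope t))
   = (1 - p0) ^ k * exp (s * (real k * step_log False))
     * (p0 * exp (s * step_log True) + (1 - p0) * exp (s * step_log False)) ^ m"
    (is "_ = _ * _ * ?q ^ m")
proof -
  have "Eb (k + m) (\<lambda>t. of_bool (contracting_start k t) * exp (s * lslope t))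
      = Eb k (\<lambda>u. Eb m (\<lambda>t. (of_bool (True \<notin> set u) * exp (s * lslope u)) * exp (s * lslope t)))"
    unfolding B.avg_append
    by (intro B.avg_cong) (simp add: contracting_start_def ring_distribs exp_add mult_ac)
  also have "\<dots> = Eb k (\<lambda>u. of_bool (True \<notin> set u) * (exp (s * lslope u) * ?q ^ m))"
    by (simp add: B.avg_cmult Eb_exp_lslope mult_ac)
  also have "\<dots> = (1 - p0) ^ k * (exp (s * (real k * step_log False)) * ?q ^ m)"
    by (rule Eb_contracting_start)
  finally show ?thesis by (simp add: mult_ac)
qed

lemma min_1_powr: "0 < t \<Longrightarrow> t \<le> 1 \<Longrightarrow> 0 \<le> x \<Longrightarrow> min 1 x \<le> x powr (t::real)"
proof (cases "x \<le> 1")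
  case True
  assume "0 < t" "t \<le> 1" "0 \<le> x"
  then have "x powr 1 \<le> x powr t" using True powr_mono'[of t 1 x] by (cases "x = 0") auto
  then show ?thesis using \<open>0 \<le> x\<close> by simp
next
  case False
  assume "0 < t" then show ?thesis using False ge_one_powr_ge_zero[of x t] by simp
qed

text \<open>
  Contractions never cut, so the probability that is lost in one step comes from the expanding map alone.
\<close>

lemma contracting_uncut_loss:
  assumes "k \<le> n"
  shows "Ew n (\<lambda>w. of_bool (contracting_start k (types w) \<and> uncut w))
    - Ew (Suc n) (\<lambda>w. of_bool (contracting_start k (types w) \<and> uncut w))
    \<le> Eb n (\<lambda>t. of_bool (contracting_start k t) * min 1 (2 * (real N * exp (lslope t))))"
proof -
  let ?a = "\<lambda>w. of_bool (contracting_start k (types w) \<and> uncut w) :: real"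
  have "Ew n ?a - Ew (Suc n) ?a
      = Ew n (\<lambda>w. ?a w - (p0 * ?a (w @ [0]) + (1 - p0) * ((\<Sum>i\<in>{1..M}. ?a (w @ [i])) / real M)))"
    by (simp add: Ew_snoc W.avg_diff)
  also have "\<dots> \<le> Ew n (\<lambda>w. of_bool (contracting_start k (types w)) * of_bool (affine_word w \<and> \<not> affine_word (w @ [0])))"
  proof (rule W.avg_mono)
    fix w :: "nat list" assume len: "length w = n"
    have cs: "contracting_start k (types w @ [z]) = contracting_start k (types w)" for z
      using len assms by (simp add: contracting_start_def)
    have i: "?a (w @ [i]) = ?a w" if "i \<in> {1..M}" for i
      using that uncut_affine[of w] affine_word_contract[of w i] by (auto simp: cs uncut_snoc)
    have "(\<Sum>i\<in>{1..M}. ?a (w @ [i])) = (\<Sum>i\<in>{1..M}. ?a w)" by (rule sum.cong[OF refl i])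
    then have "(\<Sum>i\<in>{1..M}. ?a (w @ [i])) / real M = ?a w" using M_pos by simp
    moreover have "p0 * (?a w - ?a (w @ [0])) \<le> of_bool (contracting_start k (types w)) * of_bool (affine_word w \<and> \<not> affine_word (w @ [0]))"
      using p0_pos p0_lt1 uncut_affine[of w]
      by (cases "affine_word (w @ [0])"; cases "contracting_start k (types w)"; cases "uncut w") (simp_all add: cs uncut_snoc)
    ultimately show "?a w - (p0 * ?a (w @ [0]) + (1 - p0) * ((\<Sum>i\<in>{1..M}. ?a (w @ [i])) / real M))
        \<le> of_bool (contracting_start k (types w)) * of_bool (affine_word w \<and> \<not> affine_word (w @ [0]))"
      by (simp only: ring_distribs)
  qed
  also have "\<dots> \<le> Eb n (\<lambda>t. of_bool (contracting_start k t) * min 1 (2 * (real N * exp (lslope t))))"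
    by (rule cut_probability) simp
  finally show ?thesis .
qed

text \<open>
  After \<open>k\<close> contractions the interval has length \<open>M\<close> to the power \<open>-k\<close>, and the cut probabilities at the later times
  are bounded by a geometric series, because a small moment of the slope decays exponentially. For large \<open>k\<close> the
  sum of this series is at most one half.
\<close>

lemma uncut_probability:
  assumes "lyapunov_exponent M N p0 < 0"
  obtains \<delta> where "0 < \<delta>" "\<And>n. \<delta> \<le> Ew n (\<lambda>w. of_bool (uncut w))"
proof -
  obtain s where s: "0 < s" "s \<le> 1" "p0 * exp (s * step_log True) + (1 - p0) * exp (s * step_log False) < 1"
    using perturb_exp_moment[of p0 "step_log True" "step_log False"] assms
    unfolding lyapunov_step by metis
  define q where "q = p0 * exp (s * step_log True) + (1 - p0) * exp (s * step_log False)"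
  have q: "0 < q" "q < 1" using s p0_pos p0_lt1 by (auto simp: q_def intro!: add_pos_pos)
  define D where "D = (2 * real N) powr s / (1 - q)"
  have D0: "0 < D" using q N_pos by (auto simp: D_def)
  have "(\<lambda>k. D * exp (s * step_log False) ^ k) \<longlonglongrightarrow> D * 0"
    by (intro tendsto_mult tendsto_const LIMSEQ_realpow_zero)
       (use s ln_M_pos in \<open>auto simp: step_log_def\<close>)
  then have "eventually (\<lambda>k. D * exp (s * step_log False) ^ k < 1/2) sequentially"
    by (rule order_tendstoD) simp
  then obtain k where "D * exp (s * step_log False) ^ k < 1/2"
    by (auto simp: eventually_sequentially)
  then have k: "D * exp (s * (real k * step_log False)) < 1/2"
    by (simp add: exp_of_nat_mult[symmetric] mult_ac)
  let ?a = "\<lambda>n. Ew n (\<lambda>w. of_bool (contracting_start k (types w) \<and> uncut w))"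
  have a0: "?a k = (1 - p0) ^ k"
  proof -
    have "?a k = Ew k (\<lambda>w. (\<lambda>t. of_bool (True \<notin> set t) * (\<lambda>_. 1) (lslope t)) (types w))"
      by (rule W.avg_cong) (auto simp: contracting_start_def uncut_contracting)
    also have "\<dots> = (1 - p0) ^ k"
      by (subst Ew_type, subst Eb_contracting_start) simp
    finally show ?thesis .
  qed
  have loss: "?a (k + m) - ?a (Suc (k + m)) \<le> (1 - p0) ^ k * exp (s * (real k * step_log False)) * (2 * real N) powr s * q ^ m" for m
  proof -
    have "?a (k + m) - ?a (Suc (k + m))
       \<le> Eb (k + m) (\<lambda>t. of_bool (contracting_start k t) * min 1 (2 * (real N * exp (lslope t))))"
      by (rule contracting_uncut_loss) simp
    also have "\<dots> \<le> Eb (k + m) (\<lambda>t. (2 * real N) powr s * (of_bool (contracting_start k t) * exp (s * lslope t)))"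
    proof (rule B.avg_mono)
      fix t :: "bool list"
      have "min 1 (2 * (real N * exp (lslope t))) \<le> (2 * (real N * exp (lslope t))) powr s"
        using s by (intro min_1_powr) auto
      also have "\<dots> = (2 * real N) powr s * exp (s * lslope t)"
        by (simp add: powr_mult exp_powr_real mult.commute[of "lslope t"])
      finally show "of_bool (contracting_start k t) * min 1 (2 * (real N * exp (lslope t)))
        \<le> (2 * real N) powr s * (of_bool (contracting_start k t) * exp (s * lslope t))" by auto
    qed
    also have "\<dots> = (1 - p0) ^ k * exp (s * (real k * step_log False)) * (2 * real N) powr s * q ^ m"
      unfolding B.avg_cmult Eb_contracting_exp q_def by (simp add: mult_ac)
    finally show ?thesis .
  qed
  let ?c = "(1 - p0) ^ k * exp (s * (real k * step_log False)) * (2 * real N) powr s"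
  have "?a k - ?a (k + m) \<le> ?c * (\<Sum>j<m. q ^ j)" for m
  proof (induction m)
    case (Suc m)
    then show ?case using loss[of m] by (simp add: algebra_simps)
  qed simp
  moreover have "?c * (\<Sum>j<m. q ^ j) \<le> ?c * (1 / (1 - q))" for m
  proof -
    have "(\<Sum>j<m. q ^ j) \<le> (\<Sum>j. q ^ j)"
      using q by (intro sum_le_suminf summable_geometric) auto
    also have "\<dots> = 1 / (1 - q)" using q by (intro suminf_geometric) auto
    finally show ?thesis using p0_lt1 by (intro mult_left_mono) auto
  qed
  ultimately have l1: "?a k - ?a (k + m) \<le> ?c * (1 / (1 - q))" for m by (meson order_trans)
  have l2: "?c * (1 / (1 - q)) \<le> (1 - p0) ^ k * (1/2)"
  proof -
    have "?c * (1 / (1 - q)) = (1 - p0) ^ k * (D * exp (s * (real k * step_log False)))"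
      by (simp add: D_def)
    also have "\<dots> \<le> (1 - p0) ^ k * (1/2)" using k p0_lt1 by (intro mult_left_mono) auto
    finally show ?thesis .
  qed
  have am: "(1 - p0) ^ k / 2 \<le> ?a (k + m)" for m
    using order_trans[OF l1[of m] l2] a0 by linarith
  show thesis
  proof (rule that)
    show "0 < (1 - p0) ^ k / 2" using p0_lt1 by simp
    fix n
    have "(1 - p0) ^ k / 2 \<le> ?a (k + n)" by (rule am)
    also have "\<dots> \<le> Ew (k + n) (\<lambda>w. of_bool (uncut (take n w)))"
      by (intro W.avg_mono) (auto simp: uncut_def)
    also have "\<dots> = Ew n (\<lambda>w. of_bool (uncut w))" by (rule W.avg_take) simp
    finally show "(1 - p0) ^ k / 2 \<le> Ew n (\<lambda>w. of_bool (uncut w))" .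
  qed
qed

lemma uncut_prefix: "uncut (prefix_word n \<omega>) \<longleftrightarrow> (\<forall>j\<le>n. affine_word (prefix_word j \<omega>))"
  by (auto simp: uncut_def take_prefix_word)

lemma pred_prefix [measurable]: "Measurable.pred \<nu> (\<lambda>\<omega>. Q (prefix_word n \<omega>))"
  by measurable

lemma pred_prefix_shift [measurable]: "Measurable.pred \<nu> (\<lambda>\<omega>. Q (prefix_word n (shift m \<omega>)))"
  by measurable

text \<open>
  Let \<open>E\<close> be the event that every starting time is followed by a cut. If the first cut after time \<open>0\<close> happens at time \<open>n\<close>,
  then \<open>E\<close> also holds for the sequence shifted by \<open>n\<close>, which is independent of the first \<open>n\<close> symbols. Hence the
  probability of \<open>E\<close> is at most its product with the probability of a cut, which is less than one.
\<close>

lemma AE_eventually_uncut: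
  assumes \<delta>: "0 < \<delta>" "\<And>n. \<delta> \<le> Ew n (\<lambda>w. of_bool (uncut w))"
  shows "AE \<omega> in \<nu>. \<exists>m. \<forall>n. uncut (prefix_word n (shift m \<omega>))"
proof -
  define E where "E = {\<omega> \<in> space \<nu>. \<forall>m. \<exists>n. \<not> uncut (prefix_word n (shift m \<omega>))}"
  have E [measurable]: "E \<in> sets \<nu>" unfolding E_def by measurable
  define A where "A n = {\<omega> \<in> space \<nu>. \<not> uncut (prefix_word n \<omega>)}" for n
  have A [measurable]: "A n \<in> sets \<nu>" for n unfolding A_def by measurable
  have sE: "shift n \<omega> \<in> E" if "\<omega> \<in> E" for n \<omega>
    using that by (simp add: E_def shift_shift shift_space)
  let ?u = "\<lambda>n. Ew n (\<lambda>w. of_bool (uncut w))"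
  have step: "measure \<nu> (E \<inter> A n) \<le> (1 - ?u n) * measure \<nu> E" for n
  proof (induction n)
    case 0
    then show ?case by (simp add: A_def)
  next
    case (Suc n)
    let ?Q = "\<lambda>w. uncut (take n w) \<and> \<not> uncut w"
    have "E \<inter> A (Suc n) \<subseteq> (E \<inter> A n) \<union> {\<omega> \<in> space \<nu>. ?Q (prefix_word (Suc n) \<omega>) \<and> shift (Suc n) \<omega> \<in> E}"
      using sE by (auto simp: A_def take_prefix_word)
    then have "measure \<nu> (E \<inter> A (Suc n)) \<le> measure \<nu> ((E \<inter> A n) \<union> {\<omega> \<in> space \<nu>. ?Q (prefix_word (Suc n) \<omega>) \<and> shift (Suc n) \<omega> \<in> E})"
      by (intro bp.finite_measure_mono) measurable
    also have "\<dots> \<le> measure \<nu> (E \<inter> A n) + measure \<nu> {\<omega> \<in> space \<nu>. ?Q (prefix_word (Suc n) \<omega>) \<and> shift (Suc n) \<omega> \<in> E}"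
      by (intro measure_Un_le) measurable
    also have "measure \<nu> {\<omega> \<in> space \<nu>. ?Q (prefix_word (Suc n) \<omega>) \<and> shift (Suc n) \<omega> \<in> E} = Ew (Suc n) (\<lambda>w. of_bool (?Q w)) * measure \<nu> E"
      by (rule prob_prefix_shift) measurable
    also have "Ew (Suc n) (\<lambda>w. of_bool (?Q w)) = Ew (Suc n) (\<lambda>w. of_bool (uncut (take n w)) - of_bool (uncut w))"
      by (rule W.avg_cong) (auto simp: uncut_def)
    also have "\<dots> = ?u n - ?u (Suc n)"
      unfolding W.avg_diff using W.avg_take[of n "Suc n" "\<lambda>w. of_bool (uncut w)"] by simp
    finally show ?case using Suc.IH by (simp add: algebra_simps)
  qed
  have "measure \<nu> (E \<inter> A n) \<le> (1 - \<delta>) * measure \<nu> E" for n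
    using step[of n] \<delta>(2)[of n] by (meson diff_left_mono measure_nonneg mult_right_mono order_trans)
  moreover have "(\<lambda>n. measure \<nu> (E \<inter> A n)) \<longlonglongrightarrow> measure \<nu> (\<Union>n. E \<inter> A n)"
    by (intro bp.finite_Lim_measure_incseq) (auto simp: incseq_def A_def uncut_prefix intro: order_trans)
  ultimately have "measure \<nu> (\<Union>n. E \<inter> A n) \<le> (1 - \<delta>) * measure \<nu> E"
    by (intro LIMSEQ_le_const2) auto
  moreover have "(\<Union>n. E \<inter> A n) = E" unfolding E_def A_def by auto (metis shift_0)
  ultimately have "\<delta> * measure \<nu> E \<le> 0" by (simp add: algebra_simps)
  then have "measure \<nu> E = 0" using \<delta>(1) by (simp add: mult_le_0_iff measure_le_0_iff)
  then have "emeasure \<nu> E = 0" by (simp add: bp.emeasure_eq_measure)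
  then have "AE \<omega> in \<nu>. \<omega> \<notin> E" by (intro AE_not_in) (auto simp: null_sets_def)
  then show ?thesis by (rule AE_mp) (auto simp: E_def)
qed

lemma AE_lslope_at_bot:
  assumes "lyapunov_exponent M N p0 < 0"
  shows "AE \<omega> in \<nu>. (\<lambda>n. exp (lslope (types (prefix_word n \<omega>)))) \<longlonglongrightarrow> 0"
proof -
  obtain s where s: "0 < s" "s \<le> 1" "p0 * exp (s * step_log True) + (1 - p0) * exp (s * step_log False) < 1"
    using perturb_exp_moment[of p0 "step_log True" "step_log False"] assms
    unfolding lyapunov_step by metis
  define q where "q = p0 * exp (s * step_log True) + (1 - p0) * exp (s * step_log False)"
  have q: "0 < q" "q < 1" using s p0_pos p0_lt1 by (auto simp: q_def intro!: add_pos_pos)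
  define r where "r = sqrt q"
  have r: "0 < r" "r < 1" "r * r = q" using q by (auto simp: r_def)
  define A where "A n = {\<omega> \<in> space \<nu>. r ^ n \<le> exp (s * lslope (types (prefix_word n \<omega>)))}" for n
  have "measure \<nu> (A n) \<le> r ^ n" for n
  proof -
    have "measure \<nu> (A n) = Ew n (\<lambda>w. of_bool (r ^ n \<le> exp (s * lslope (types w))))"
      unfolding A_def by (rule prob_prefix)
    also have "\<dots> \<le> Ew n (\<lambda>w. (\<lambda>t. (1 / r ^ n) * exp (s * lslope t)) (types w))"
      using r by (intro W.avg_mono) (auto simp: field_simps)
    also have "\<dots> = (1 / r ^ n) * q ^ n"
      by (subst Ew_type, subst B.avg_cmult) (simp add: Eb_exp_lslope q_def)
    also have "\<dots> = r ^ n" using r by (simp flip: r(3) add: power_mult_distrib)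
    finally show ?thesis .
  qed
  then have "summable (\<lambda>n. measure \<nu> (A n))"
    using r by (intro summable_comparison_test[OF _ summable_geometric[of r]]) auto
  then have "AE \<omega> in \<nu>. eventually (\<lambda>n. \<omega> \<in> space \<nu> - A n) sequentially"
    by (intro borel_cantelli_AE1) (auto simp: A_def bp.emeasure_eq_measure)
  then show ?thesis
  proof (rule AE_mp, intro AE_I2 impI)
    fix \<omega> assume "eventually (\<lambda>n. \<omega> \<in> space \<nu> - A n) sequentially"
    then have ev: "eventually (\<lambda>n. exp (lslope (types (prefix_word n \<omega>))) \<le> (r powr (1/s)) ^ n) sequentially"
    proof eventually_elim
      case (elim n)
      then have "exp (s * lslope (types (prefix_word n \<omega>))) < r ^ n" by (auto simp: A_def)
      then have "exp (s * lslope (types (prefix_word n \<omega>))) powr (1/s) \<le> (r ^ n) powr (1/s)"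
        using s by (intro powr_mono2) auto
      then show ?case using s r by (simp add: exp_powr_real powr_powr mult.commute flip: powr_realpow)
    qed
    have "(\<lambda>n. (r powr (1/s)) ^ n) \<longlonglongrightarrow> 0"
      using r s powr_less_mono2[of "1/s" r 1] by (intro LIMSEQ_realpow_zero) auto
    then show "(\<lambda>n. exp (lslope (types (prefix_word n \<omega>)))) \<longlonglongrightarrow> 0"
      by (intro tendsto_sandwich[OF _ ev tendsto_const]) auto
  qed
qed

lemma compos_unit: "\<omega> \<in> space \<nu> \<Longrightarrow> 0 \<le> x \<Longrightarrow> x < 1 \<Longrightarrow> 0 \<le> compos M N \<omega> n x \<and> compos M N \<omega> n x < 1"
  unfolding compos_eq_act by (intro act_unit set_prefix_word) auto

lemma orbit_dist_uncut:
  assumes "\<omega> \<in> space \<nu>" "uncut (prefix_word n (shift m \<omega>))" "x \<in> {0..<1}" "y \<in> {0..<1}"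
  shows "orbit_dist M N \<omega> x y (m + n) = exp (lslope (types (prefix_word n (shift m \<omega>)))) * orbit_dist M N \<omega> x y m"
  using assms compos_unit[OF assms(1), of x m] compos_unit[OF assms(1), of y m]
  unfolding orbit_dist_def compos_eq_act
  by (simp add: prefix_word_add affine_word_dist uncut_affine)

text \<open>
  From some time on the whole unit interval is contracted without a cut, and the slopes tend to zero.
\<close>

theorem synchronization:
  assumes L: "lyapunov_exponent M N p0 < 0"
  shows "AE \<omega> in \<nu>. \<forall>x\<in>{0..<1}. \<forall>y\<in>{0..<1}. (\<lambda>n. orbit_dist M N \<omega> x y n) \<longlonglongrightarrow> 0"
proof -
  obtain \<delta> where "0 < \<delta>" "\<And>n. \<delta> \<le> Ew n (\<lambda>w. of_bool (uncut w))"
    using uncut_probability[OF L] by blast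
  from AE_eventually_uncut[OF this] AE_lslope_at_bot[OF L] AE_space show ?thesis
  proof (eventually_elim, intro ballI)
    fix \<omega> x y
    assume m: "\<exists>m. \<forall>n. uncut (prefix_word n (shift m \<omega>))"
      and lim: "(\<lambda>n. exp (lslope (types (prefix_word n \<omega>)))) \<longlonglongrightarrow> 0"
      and sp: "\<omega> \<in> space \<nu>" and xy: "x \<in> {0..<1::real}" "y \<in> {0..<1::real}"
    show "(\<lambda>n. orbit_dist M N \<omega> x y n) \<longlonglongrightarrow> 0"
    proof -
      obtain m where m: "\<And>n. uncut (prefix_word n (shift m \<omega>))" using m by blast
      define c where "c = exp (- lslope (types (prefix_word m \<omega>))) * orbit_dist M N \<omega> x y m"
      have "orbit_dist M N \<omega> x y (n + m) = c * exp (lslope (types (prefix_word (n + m) \<omega>)))" for n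
        using orbit_dist_uncut[OF sp m xy, of n] prefix_word_add[of m n \<omega>]
        by (simp add: c_def add.commute[of n m] exp_add exp_minus)
      moreover have "(\<lambda>n. c * exp (lslope (types (prefix_word (n + m) \<omega>)))) \<longlonglongrightarrow> c * 0"
        using LIMSEQ_ignore_initial_segment[OF lim] by (intro tendsto_mult tendsto_const)
      ultimately show ?thesis
        by (intro LIMSEQ_offset[of "orbit_dist M N \<omega> x y" m]) simp
    qed
  qed
qed


section \<open>Zero Lyapunov exponent: the walk of logarithmic slopes\<close>

text \<open>
  The walk of logarithmic slopes makes \<open>k\<close> contracting steps and then stays at or below the level \<open>c\<close>.
\<close>

definition low_walk :: "nat \<Rightarrow> real \<Rightarrow> bool list \<Rightarrow> bool" where
  "low_walk k c t \<longleftrightarrow> contracting_start k t \<and> (\<forall>j. k \<le> j \<and> j \<le> length t \<longrightarrow> lslope (take j t) \<le> c)"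

lemma low_walk_snoc:
  assumes "k \<le> length t"
  shows "low_walk k c (t @ [z]) \<longleftrightarrow> low_walk k c t \<and> lslope t + step_log z \<le> c"
proof -
  have split: "(\<forall>j. k \<le> j \<and> j \<le> Suc (length t) \<longrightarrow> P j)
      \<longleftrightarrow> (\<forall>j. k \<le> j \<and> j \<le> length t \<longrightarrow> P j) \<and> P (Suc (length t))" for P
    using assms by (auto simp: le_Suc_eq)
  have "(\<forall>j. k \<le> j \<and> j \<le> length t \<longrightarrow> lslope (take j (t @ [z])) \<le> c)
      \<longleftrightarrow> (\<forall>j. k \<le> j \<and> j \<le> length t \<longrightarrow> lslope (take j t) \<le> c)"
    by simp
  then show ?thesis
    using assms by (simp only: low_walk_def contracting_start_def length_append_singleton split) auto
qed

lemma low_walkD: "low_walk k c t \<Longrightarrow> k \<le> length t \<Longrightarrow> lslope t \<le> c"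
  unfolding low_walk_def by (metis order_refl take_all)

lemma step_log_le: "step_log z \<le> ln (real N)" "- ln (real M) \<le> step_log z"
  using ln_M_pos ln_N_pos by (auto simp: step_log_def)

text \<open>
  The mean of the square root of the slope of one symbol.
\<close>

definition half_moment :: real where
  "half_moment = p0 * exp (step_log True / 2) + (1 - p0) * exp (step_log False / 2)"

text \<open>
  Strict convexity of the exponential function, applied to a nondegenerate increment of mean zero.
\<close>

lemma half_moment_gt_1:
  assumes "lyapunov_exponent M N p0 = 0" shows "1 < half_moment"
proof -
  have x: "0 < step_log True" using ln_N_pos by (simp add: step_log_def)
  have "1 + step_log True / 2 < exp (step_log True / 2)"
  proof -
    have "0 < (step_log True / 2)\<^sup>2" using x by simp
    then show ?thesis using exp_lower_Taylor_quadratic[of "step_log True / 2"] x by linarith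
  qed
  then have "p0 * (1 + step_log True / 2) < p0 * exp (step_log True / 2)"
    using p0_pos by simp
  moreover have "(1 - p0) * (1 + step_log False / 2) \<le> (1 - p0) * exp (step_log False / 2)"
    using p0_lt1 exp_ge_add_one_self[of "step_log False / 2"] by (intro mult_left_mono) auto
  moreover have "p0 * (1 + step_log True / 2) + (1 - p0) * (1 + step_log False / 2)
      = 1 + lyapunov_exponent M N p0 / 2"
    unfolding lyapunov_step by (simp add: field_simps)
  ultimately show ?thesis
    using assms unfolding half_moment_def by linarith
qed

text \<open>
  The square root of the slope is a strict submartingale, and at the time when the walk leaves the region below \<open>c\<close> it is
  at most \<open>exp ((c + ln N) / 2)\<close>. The expected total growth before this time is therefore bounded. This bounds the
  Green function of the walk killed at level \<open>c\<close>, weighted by the square root of the slope.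
\<close>

lemma low_walk_green:
  assumes L: "lyapunov_exponent M N p0 = 0"
  shows "(\<Sum>n<m. Eb (k + n) (\<lambda>t. of_bool (low_walk k c t) * exp (lslope t / 2)))
    \<le> exp ((c + ln (real N)) / 2) / (half_moment - 1) * Eb k (\<lambda>t. of_bool (low_walk k c t))"
proof -
  define e where "e n = Eb (k + n) (\<lambda>t. of_bool (low_walk k c t) * exp (lslope t / 2))" for n
  define q where "q n = Eb (k + n) (\<lambda>t. of_bool (low_walk k c t))" for n
  define E0 where "E0 = exp ((c + ln (real N)) / 2)"
  have step: "half_moment * e n \<le> e (Suc n) + E0 * (q n - q (Suc n))" for n
  proof -
    let ?e = "\<lambda>t. of_bool (low_walk k c t) * exp (lslope t / 2) :: real"
    let ?q = "\<lambda>t. of_bool (low_walk k c t) :: real"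
    have "half_moment * e n = Eb (k + n) (\<lambda>t. half_moment * ?e t)"
      unfolding e_def B.avg_cmult ..
    also have "\<dots> \<le> Eb (k + n) (\<lambda>t. (p0 * ?e (t @ [True]) + (1 - p0) * ?e (t @ [False]))
        + E0 * (?q t - (p0 * ?q (t @ [True]) + (1 - p0) * ?q (t @ [False]))))"
    proof (rule B.avg_mono)
      fix t :: "bool list" assume len: "length t = k + n"
      show "half_moment * ?e t \<le> (p0 * ?e (t @ [True]) + (1 - p0) * ?e (t @ [False]))
        + E0 * (?q t - (p0 * ?q (t @ [True]) + (1 - p0) * ?q (t @ [False])))"
      proof (cases "low_walk k c t")
        case False
        then show ?thesis using len by (simp add: low_walk_snoc)
      next
        case True
        then have lc: "lslope t \<le> c" using len by (simp add: low_walkD)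
        have z: "exp ((lslope t + step_log z) / 2) \<le> ?e (t @ [z]) + E0 * (1 - ?q (t @ [z]))" for z
        proof (cases "lslope t + step_log z \<le> c")
          case a: True
          then show ?thesis using True len by (simp add: low_walk_snoc)
        next
          case a: False
          have "exp ((lslope t + step_log z) / 2) \<le> E0"
            unfolding E0_def using lc step_log_le(1)[of z] by simp
          then show ?thesis using a True len by (simp add: low_walk_snoc)
        qed
        have "half_moment * ?e t = p0 * exp ((lslope t + step_log True) / 2) + (1 - p0) * exp ((lslope t + step_log False) / 2)"
          using True by (simp add: half_moment_def add_divide_distrib exp_add algebra_simps)
        also have "\<dots> \<le> p0 * (?e (t @ [True]) + E0 * (1 - ?q (t @ [True]))) + (1 - p0) * (?e (t @ [False]) + E0 * (1 - ?q (t @ [False])))"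
          using p0_pos p0_lt1 by (intro add_mono mult_left_mono z) auto
        also have "\<dots> = (p0 * ?e (t @ [True]) + (1 - p0) * ?e (t @ [False]))
          + E0 * (?q t - (p0 * ?q (t @ [True]) + (1 - p0) * ?q (t @ [False])))"
          using True by (simp add: algebra_simps)
        finally show ?thesis .
      qed
    qed
    also have "\<dots> = e (Suc n) + E0 * (q n - q (Suc n))"
      unfolding e_def q_def add_Suc_right Eb_snoc B.avg_add B.avg_diff B.avg_cmult ..
    finally show ?thesis .
  qed
  have "(half_moment - 1) * (\<Sum>n<m. e n) \<le> e m - e 0 + E0 * (q 0 - q m)"
  proof (induction m)
    case (Suc m)
    then show ?case using step[of m] by (simp add: algebra_simps)
  qed simp
  moreover have "e m \<le> E0 * q m"
    unfolding e_def q_def B.avg_cmult[symmetric]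
  proof (rule B.avg_mono)
    fix t :: "bool list" assume "length t = k + m"
    then show "of_bool (low_walk k c t) * exp (lslope t / 2) \<le> E0 * of_bool (low_walk k c t)"
      using ln_N_pos low_walkD[of k c t] by (auto simp: E0_def)
  qed
  moreover have "0 \<le> e 0" unfolding e_def by (intro B.avg_nonneg) auto
  ultimately have "(half_moment - 1) * (\<Sum>n<m. e n) \<le> E0 * q 0" by (simp add: algebra_simps)
  then have "(\<Sum>n<m. e n) \<le> E0 * q 0 / (half_moment - 1)"
    using half_moment_gt_1[OF L] by (simp add: field_simps)
  then show ?thesis by (simp add: e_def q_def E0_def)
qed

text \<open>
  The logarithmic slope is a martingale. Stopped when it exceeds \<open>K\<close> it has mean zero and an overshoot of at most
  \<open>ln N\<close>, so its negative part has bounded mean and the walk is below \<open>- J\<close> only with probability of order \<open>1 / J\<close>. The time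
  spent between \<open>- J\<close> and \<open>K\<close> has finite mean by \<open>low_walk_green\<close>. Thus the probability of never exceeding \<open>K\<close> vanishes.
\<close>

lemma low_walk_decay:
  assumes L: "lyapunov_exponent M N p0 = 0" and K: "0 \<le> K" and \<eta>: "0 < \<eta>"
  shows "\<exists>n. Eb n (\<lambda>t. of_bool (low_walk 0 K t)) < \<eta>"
proof -
  define e where "e n = Eb n (\<lambda>t. of_bool (low_walk 0 K t) * exp (lslope t / 2))" for n
  define q where "q n = Eb n (\<lambda>t. of_bool (low_walk 0 K t))" for n
  define f where "f n = Eb n (\<lambda>t. of_bool (low_walk 0 K t) * lslope t)" for n
  define C where "C = K + ln (real N)"
  have C0: "0 < C" using K ln_N_pos by (simp add: C_def)
  have f_step: "f n - f (Suc n) \<le> C * (q n - q (Suc n))" for n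
  proof -
    let ?f = "\<lambda>t. of_bool (low_walk 0 K t) * lslope t :: real"
    let ?q = "\<lambda>t. of_bool (low_walk 0 K t) :: real"
    have "f n - f (Suc n) = Eb n (\<lambda>t. ?f t - (p0 * ?f (t @ [True]) + (1 - p0) * ?f (t @ [False])))"
      unfolding f_def Eb_snoc B.avg_diff ..
    also have "\<dots> \<le> Eb n (\<lambda>t. C * (?q t - (p0 * ?q (t @ [True]) + (1 - p0) * ?q (t @ [False]))))"
    proof (rule B.avg_mono)
      fix t :: "bool list"
      show "?f t - (p0 * ?f (t @ [True]) + (1 - p0) * ?f (t @ [False]))
        \<le> C * (?q t - (p0 * ?q (t @ [True]) + (1 - p0) * ?q (t @ [False])))"
      proof (cases "low_walk 0 K t")
        case False
        then show ?thesis by (simp add: low_walk_snoc)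
      next
        case True
        then have lc: "lslope t \<le> K" by (simp add: low_walkD)
        have z: "lslope t + step_log z \<le> ?f (t @ [z]) + C * (1 - ?q (t @ [z]))" for z
          using True lc step_log_le(1)[of z] by (auto simp: low_walk_snoc C_def)
        have "lslope t = p0 * (lslope t + step_log True) + (1 - p0) * (lslope t + step_log False)"
          using L unfolding lyapunov_step by (simp add: algebra_simps)
        also have "\<dots> \<le> p0 * (?f (t @ [True]) + C * (1 - ?q (t @ [True]))) + (1 - p0) * (?f (t @ [False]) + C * (1 - ?q (t @ [False])))"
          using p0_pos p0_lt1 by (intro add_mono mult_left_mono z) auto
        finally show ?thesis using True by (simp add: algebra_simps)
      qed
    qed
    also have "\<dots> = C * (q n - q (Suc n))"
      unfolding q_def Eb_snoc B.avg_cmult B.avg_diff ..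
    finally show ?thesis .
  qed
  have q01: "0 \<le> q n" "q n \<le> 1" for n
    unfolding q_def using B.avg_mono[of n "\<lambda>t. of_bool (low_walk 0 K t)" "\<lambda>_. 1"]
    by (auto intro!: B.avg_nonneg simp: B.avg_const)
  have f_low: "- f n \<le> C" for n
  proof -
    have "f 0 - f n \<le> C * (q 0 - q n)"
    proof (induction n)
      case (Suc n)
      then show ?case using f_step[of n] by (simp add: algebra_simps)
    qed simp
    moreover have "f 0 = 0" by (simp add: f_def)
    moreover have "C * (q 0 - q n) \<le> C * 1" using C0 q01[of 0] q01[of n] by (intro mult_left_mono) auto
    ultimately show ?thesis by simp
  qed
  have e0: "0 \<le> e n" for n unfolding e_def by (intro B.avg_nonneg) auto
  have "summable e"
  proof (rule summableI_nonneg_bounded)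
    show "(\<Sum>n<m. e n) \<le> exp ((K + ln (real N)) / 2) / (half_moment - 1) * Eb 0 (\<lambda>t. of_bool (low_walk 0 K t))" for m
      using low_walk_green[OF L, of 0 K m] unfolding e_def by simp
  qed (rule e0)
  then have e_lim: "e \<longlonglongrightarrow> 0" by (rule summable_LIMSEQ_zero)
  define J where "J = 2 * (K + C) / \<eta> + 1"
  have J: "0 < J" using K C0 \<eta> by (auto simp: J_def intro!: add_nonneg_pos divide_nonneg_pos)
  have "(K + C) / J < \<eta> / 2"
    using J \<eta> unfolding J_def by (simp add: field_simps)
  have q_le: "q n \<le> exp (J / 2) * e n + (K + C) / J" for n
  proof -
    have "q n \<le> Eb n (\<lambda>t. exp (J/2) * (of_bool (low_walk 0 K t) * exp (lslope t / 2))
        + (1 / J) * (K * of_bool (low_walk 0 K t) - of_bool (low_walk 0 K t) * lslope t))"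
      unfolding q_def
    proof (rule B.avg_mono)
      fix t :: "bool list"
      show "of_bool (low_walk 0 K t) \<le> exp (J/2) * (of_bool (low_walk 0 K t) * exp (lslope t / 2))
        + (1 / J) * (K * of_bool (low_walk 0 K t) - of_bool (low_walk 0 K t) * lslope t)"
      proof (cases "low_walk 0 K t")
        case True
        then have lc: "lslope t \<le> K" by (simp add: low_walkD)
        show ?thesis
        proof (cases "- J \<le> lslope t")
          case a: True
          then have "1 \<le> exp (J/2) * exp (lslope t / 2)" by (simp flip: exp_add)
          moreover have "0 \<le> (1 / J) * (K - lslope t)" using J lc by simp
          ultimately show ?thesis using True by simp
        next
          case a: False
          then have "1 \<le> (1 / J) * (K - lslope t)" using J K by (simp add: field_simps)
          moreover have "0 \<le> exp (J/2) * exp (lslope t / 2)" by simp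
          ultimately show ?thesis using True by (simp add: add_increasing)
        qed
      qed simp
    qed
    also have "\<dots> = exp (J/2) * e n + (1 / J) * (K * q n - f n)"
      unfolding e_def q_def f_def B.avg_add B.avg_diff B.avg_cmult ..
    also have "(1 / J) * (K * q n - f n) \<le> (1 / J) * (K + C)"
      using J f_low[of n] q01[of n] K mult_left_mono[of "q n" 1 K] by (intro mult_left_mono) auto
    finally show ?thesis by simp
  qed
  have "eventually (\<lambda>n. e n < \<eta> / 2 / exp (J/2)) sequentially"
    using e_lim \<eta> by (intro order_tendstoD) auto
  then obtain n where "e n < \<eta> / 2 / exp (J/2)" by (auto simp: eventually_sequentially)
  then have "exp (J/2) * e n < \<eta> / 2" by (simp add: field_simps)
  with q_le[of n] \<open>(K + C) / J < \<eta> / 2\<close> have "q n < \<eta>" by linarith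
  then show ?thesis unfolding q_def by blast
qed

lemma AE_lslope_unbounded:
  assumes L: "lyapunov_exponent M N p0 = 0"
  shows "AE \<omega> in \<nu>. \<forall>K. \<exists>n. K < lslope (types (prefix_word n \<omega>))"
proof -
  have "AE \<omega> in \<nu>. \<exists>n. real K < lslope (types (prefix_word n \<omega>))" for K :: nat
  proof -
    define A where "A = {\<omega> \<in> space \<nu>. \<forall>n. lslope (types (prefix_word n \<omega>)) \<le> real K}"
    have [measurable]: "A \<in> sets \<nu>" unfolding A_def by measurable
    have "measure \<nu> A \<le> \<eta>" if \<eta>: "0 < \<eta>" for \<eta>
    proof -
      obtain n where n: "Eb n (\<lambda>t. of_bool (low_walk 0 (real K) t)) < \<eta>"
        using low_walk_decay[OF L _ \<eta>, of "real K"] by auto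
      have "measure \<nu> A \<le> measure \<nu> {\<omega> \<in> space \<nu>. low_walk 0 (real K) (types (prefix_word n \<omega>))}"
        by (intro bp.finite_measure_mono)
           (auto simp: A_def low_walk_def contracting_start_def take_prefix_word simp flip: types_simps(5))
      also have "\<dots> = Ew n (\<lambda>w. of_bool (low_walk 0 (real K) (types w)))" by (rule prob_prefix)
      also have "\<dots> < \<eta>" using n Ew_type[of n "\<lambda>t. of_bool (low_walk 0 (real K) t)"] by simp
      finally show ?thesis by simp
    qed
    then have "measure \<nu> A \<le> 0" by (rule field_le_epsilon[of _ 0, simplified])
    then have "emeasure \<nu> A = 0" using measure_nonneg[of \<nu> A] by (simp add: bp.emeasure_eq_measure)
    then have "AE \<omega> in \<nu>. \<omega> \<notin> A" by (intro AE_not_in) (auto simp: null_sets_def)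
    with AE_space show ?thesis by eventually_elim (auto simp: A_def not_le)
  qed
  then have "AE \<omega> in \<nu>. \<forall>K::nat. \<exists>n. real K < lslope (types (prefix_word n \<omega>))"
    by (simp add: AE_all_countable)
  then show ?thesis
    by eventually_elim (meson less_trans reals_Archimedean2)
qed

text \<open>
  If two points straddle a discontinuity and their distance is less than \<open>1 / (N + 1)\<close>, then their images have a distance
  larger than \<open>1 / (N + 1)\<close>. So two points that remain close have not been separated by a cut.
\<close>

lemma gen_map_close:
  assumes x: "0 \<le> x" "x < 1" "0 \<le> y" "y < 1"
    and d: "\<bar>x - y\<bar> \<le> \<beta>" "\<bar>gen_map M N a x - gen_map M N a y\<bar> \<le> \<beta>" "\<beta> < 1 / (real N + 1)"
  shows "\<bar>gen_map M N a x - gen_map M N a y\<bar> = exp (step_log (a = 0)) * \<bar>x - y\<bar>"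
proof (cases "a = 0")
  case False
  then have "gen_map M N a x - gen_map M N a y = (x - y) / real M"
    by (simp add: gen_map_def diff_divide_distrib add_divide_distrib)
  then show ?thesis using False M_pos by (simp add: exp_step_log abs_divide)
next
  case True
  define k where "k = \<lfloor>real N * x\<rfloor> - \<lfloor>real N * y\<rfloor>"
  have e: "gen_map M N a x - gen_map M N a y = real N * (x - y) - real_of_int k"
    using True by (simp add: gen_map_def frac_def k_def algebra_simps)
  have "\<bar>real N * (x - y)\<bar> \<le> real N * \<beta>"
    unfolding abs_mult using d(1) by (simp add: mult_left_mono)
  moreover have "real N * \<beta> + \<beta> < 1" using d(3) N_pos by (simp add: field_simps)
  moreover have "\<bar>real N * (x - y) - real_of_int k\<bar> \<le> \<beta>" using d(2) e by simp
  ultimately have "\<bar>real_of_int k\<bar> < 1"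
    by linarith
  then have "k = 0" by linarith
  then show ?thesis using e True by (simp add: exp_step_log abs_mult)
qed

text \<open>
  If the distance stays at most \<open>\<beta>\<close> from time \<open>m\<close> on, then no cut separates the two orbits and their distance is multiplied by the
  slope. The slopes are unbounded, so a nonzero distance must exceed \<open>\<beta>\<close>.
\<close>

theorem recurrent_separation:
  assumes L: "lyapunov_exponent M N p0 = 0" and \<beta>: "0 < \<beta>" "\<beta> < 1 / (real N + 1)"
  shows "AE \<omega> in \<nu>. \<forall>x\<in>{0..<1}. \<forall>y\<in>{0..<1}.
    (\<exists>n. orbit_dist M N \<omega> x y n = 0) \<or> infinite {n. orbit_dist M N \<omega> x y n > \<beta>}"
  using AE_lslope_unbounded[OF L] AE_space
proof (eventually_elim, intro ballI)
  fix \<omega> x y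
  assume unb: "\<forall>K. \<exists>n. K < lslope (types (prefix_word n \<omega>))" and sp: "\<omega> \<in> space \<nu>"
    and x: "x \<in> {0..<1::real}" and y: "y \<in> {0..<1::real}"
  let ?d = "orbit_dist M N \<omega> x y" and ?l = "\<lambda>n. lslope (types (prefix_word n \<omega>))"
  show "(\<exists>n. ?d n = 0) \<or> infinite {n. ?d n > \<beta>}"
  proof (rule ccontr)
    assume "\<not> ((\<exists>n. ?d n = 0) \<or> infinite {n. ?d n > \<beta>})"
    then have nz: "\<And>n. ?d n \<noteq> 0" and fin: "finite {n. ?d n > \<beta>}" by auto
    obtain m where m: "\<And>n. m \<le> n \<Longrightarrow> ?d n \<le> \<beta>"
      using fin unfolding finite_nat_set_iff_bounded by (meson mem_Collect_eq not_le)
    have grow: "?d n = exp (?l n - ?l m) * ?d m" if "m \<le> n" for n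
      using that
    proof (induction n rule: dec_induct)
      case (step n)
      have "?d (Suc n) = exp (step_log (\<omega> n = 0)) * ?d n"
        using gen_map_close[of "compos M N \<omega> n x" "compos M N \<omega> n y" \<beta> "\<omega> n"]
          compos_unit[OF sp, of x n] compos_unit[OF sp, of y n] x y m[of n] m[of "Suc n"] step(1) \<beta>
        by (simp add: orbit_dist_def)
      then show ?case by (simp add: step prefix_word_Suc exp_add exp_diff)
    qed simp
    have dm: "0 < ?d m" using nz[of m] by (simp add: orbit_dist_def)
    define K where "K = Max (?l ` {..m}) + \<bar>ln (\<beta> / ?d m)\<bar> + \<bar>?l m\<bar> + 1"
    obtain n where n: "K + \<bar>?l m\<bar> < ?l n" using unb by blast
    have "\<not> n \<le> m"
    proof
      assume "n \<le> m"
      then have "?l n \<le> Max (?l ` {..m})" by (intro Max_ge) auto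
      with n show False by (simp add: K_def)
    qed
    then have "?d n = exp (?l n - ?l m) * ?d m" by (intro grow) simp
    moreover have "ln (\<beta> / ?d m) < ?l n - ?l m"
    proof -
      have "?l m \<le> Max (?l ` {..m})" by (intro Max_ge) auto
      then show ?thesis using n unfolding K_def by linarith
    qed
    then have "\<beta> / ?d m < exp (?l n - ?l m)"
      using \<beta> dm by (metis divide_pos_pos exp_less_mono exp_ln)
    ultimately have "\<beta> < ?d n" using dm by (simp add: field_simps)
    moreover have "?d n \<le> \<beta>" using \<open>\<not> n \<le> m\<close> by (intro m) simp
    ultimately show False by simp
  qed
qed


section \<open>Zero Lyapunov exponent: long excursions and intermittency\<close>

text \<open>
  While a word is alive and longer than \<open>k\<close>, the image of the whole unit interval is shorter than \<open>exp c\<close>.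
\<close>

definition alive :: "nat \<Rightarrow> real \<Rightarrow> nat list \<Rightarrow> bool" where
  "alive k c w \<longleftrightarrow> low_walk k c (types w) \<and> uncut w"

lemma lslope_lower: "- real (length t) * ln (real M) \<le> lslope t"
proof (induction t)
  case (Cons z t)
  then show ?case using step_log_le(2)[of z] by (simp add: algebra_simps)
qed simp

lemma abs_exp_le: "x \<le> 0 \<Longrightarrow> \<bar>x\<bar> * exp x \<le> exp (x / 2)" for x :: real
proof -
  assume x: "x \<le> 0"
  have "1 + (-x/2)/2 \<le> exp ((-x/2)/2)" by (rule exp_ge_add_one_self)
  then have "(1 + (-x/2)/2)\<^sup>2 \<le> (exp ((-x/2)/2))\<^sup>2" using x by (intro power_mono) auto
  also have "(exp ((-x/2)/2))\<^sup>2 = exp (- x / 2)" by (simp flip: exp_double)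
  finally have "(1 + (-x/2)/2)\<^sup>2 \<le> exp (-x/2)" .
  moreover have "-x \<le> (1 + (-x/2)/2)\<^sup>2"
  proof -
    have "0 \<le> (1 - (-x/2)/2)\<^sup>2" by simp
    then show ?thesis by (simp add: power2_eq_square algebra_simps)
  qed
  ultimately have "\<bar>x\<bar> \<le> exp (-x/2)" using x by simp
  then have "\<bar>x\<bar> * exp x \<le> exp (-x/2) * exp x" by (intro mult_right_mono) auto
  then show ?thesis by (simp flip: exp_add)
qed

text \<open>
  The weighted height \<open>lslope - c\<close> of the alive walk is nearly a martingale. Leaving through level \<open>c\<close> only decreases it
  to a value below zero, so the only gain comes from cuts; there a height \<open>l\<close> is forgotten, with conditional probability
  of order \<open>exp l\<close>, and \<open>\<bar>l\<bar> * exp l\<close> is at most \<open>exp (l / 2)\<close>.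
\<close>

lemma alive_loss:
  assumes L: "lyapunov_exponent M N p0 = 0" and c: "c \<le> 0" and n: "k \<le> n"
  shows "Ew (Suc n) (\<lambda>w. of_bool (alive k c w) * (lslope (types w) - c))
    \<le> Ew n (\<lambda>w. of_bool (alive k c w) * (lslope (types w) - c))
      + 2 * real N * Eb n (\<lambda>t. of_bool (low_walk k c t) * exp (lslope t / 2))"
proof -
  let ?H = "\<lambda>w. of_bool (alive k c w) * (lslope (types w) - c)"
  let ?g = "\<lambda>t. of_bool (low_walk k c t) * \<bar>lslope t\<bar>"
  let ?cut = "\<lambda>w. of_bool (affine_word w \<and> \<not> affine_word (w @ [0]))"
  have "Ew (Suc n) ?H \<le> Ew n (\<lambda>w. ?H w + ?g (types w) * ?cut w)"
    unfolding Ew_snoc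
  proof (rule W.avg_mono)
    fix w :: "nat list" assume len: "length w = n"
    have al: "alive k c (w @ [a]) \<longleftrightarrow> alive k c w \<and> lslope (types w) + step_log (a = 0) \<le> c \<and> affine_word (w @ [a])" for a
      using len n by (auto simp: alive_def low_walk_snoc uncut_snoc)
    show "p0 * ?H (w @ [0]) + (1 - p0) * ((\<Sum>i\<in>{1..M}. ?H (w @ [i])) / real M) \<le> ?H w + ?g (types w) * ?cut w"
    proof (cases "alive k c w")
      case False
      then show ?thesis by (simp add: al)
    next
      case True
      let ?l = "lslope (types w)"
      have lc: "?l \<le> c" using True len n low_walkD[of k c "types w"] by (simp add: alive_def)
      have aff: "affine_word w" and low: "low_walk k c (types w)"
        using True by (auto simp: alive_def uncut_affine)
      have "?H (w @ [i]) \<le> ?l + step_log False - c" if "i \<in> {1..M}" for i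
        using that True affine_word_contract[OF aff, of i] by (auto simp: al)
      then have "(\<Sum>i\<in>{1..M}. ?H (w @ [i])) \<le> (\<Sum>i\<in>{1..M}. ?l + step_log False - c)"
        by (intro sum_mono) auto
      then have "(\<Sum>i\<in>{1..M}. ?H (w @ [i])) / real M \<le> ?l + step_log False - c"
        using M_pos by (simp add: field_simps)
      moreover have "?H (w @ [0]) \<le> ?l + step_log True - c + ?g (types w) * ?cut w"
      proof (cases "affine_word (w @ [0])")
        case a: True
        then show ?thesis using True low aff by (auto simp: al)
      next
        case a: False
        have "0 \<le> step_log True" using ln_N_pos by (simp add: step_log_def)
        then show ?thesis using a True low aff c lc by (simp add: al)
      qed
      ultimately have "p0 * ?H (w @ [0]) + (1 - p0) * ((\<Sum>i\<in>{1..M}. ?H (w @ [i])) / real M)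
        \<le> p0 * (?l + step_log True - c + ?g (types w) * ?cut w) + (1 - p0) * (?l + step_log False - c)"
        using p0_pos p0_lt1 by (intro add_mono mult_left_mono) auto
      also have "\<dots> = (?l - c) + lyapunov_exponent M N p0 + p0 * (?g (types w) * ?cut w)"
        unfolding lyapunov_step by (simp add: algebra_simps)
      also have "p0 * (?g (types w) * ?cut w) \<le> ?g (types w) * ?cut w"
        using p0_lt1 by (intro mult_left_le_one_le) (use p0_pos in auto)
      finally show ?thesis using L True by simp
    qed
  qed
  also have "\<dots> = Ew n ?H + Ew n (\<lambda>w. ?g (types w) * ?cut w)" by (rule W.avg_add)
  also have "Ew n (\<lambda>w. ?g (types w) * ?cut w) \<le> Eb n (\<lambda>t. ?g t * min 1 (2 * (real N * exp (lslope t))))"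
    by (rule cut_probability) simp
  also have "\<dots> \<le> Eb n (\<lambda>t. (2 * real N) * (of_bool (low_walk k c t) * exp (lslope t / 2)))"
  proof (rule B.avg_mono)
    fix t :: "bool list" assume len: "length t = n"
    show "?g t * min 1 (2 * (real N * exp (lslope t))) \<le> (2 * real N) * (of_bool (low_walk k c t) * exp (lslope t / 2))"
    proof (cases "low_walk k c t")
      case True
      then have "lslope t \<le> 0" using low_walkD[of k c t] len n c by simp
      have "\<bar>lslope t\<bar> * min 1 (2 * (real N * exp (lslope t))) \<le> \<bar>lslope t\<bar> * (2 * (real N * exp (lslope t)))"
        by (intro mult_left_mono) auto
      also have "\<dots> = 2 * real N * (\<bar>lslope t\<bar> * exp (lslope t))" by simp
      also have "\<dots> \<le> 2 * real N * exp (lslope t / 2)"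
        using abs_exp_le[OF \<open>lslope t \<le> 0\<close>] by (intro mult_left_mono) auto
      finally show ?thesis using True by simp
    qed simp
  qed
  also have "\<dots> = 2 * real N * Eb n (\<lambda>t. of_bool (low_walk k c t) * exp (lslope t / 2))"
    by (rule B.avg_cmult)
  finally show ?thesis by simp
qed


text \<open>
  The total gain through cuts is bounded by \<open>low_walk_green\<close> independently of the starting height. A walk that starts deep
  enough must therefore keep a negative mean height on the words that are still alive at time \<open>n\<close>. As the height is at least
  \<open>- n * ln M\<close>, such words have a probability of order at least \<open>1 / n\<close>, whose sum over \<open>n\<close> diverges.
\<close>

lemma long_excursion:
  assumes L: "lyapunov_exponent M N p0 = 0" and c: "c \<le> 0"
  obtains k \<delta> where "0 < k" "0 < \<delta>"
    "\<And>n. k \<le> n \<Longrightarrow> \<delta> / real n \<le> Ew n (\<lambda>w. of_bool (alive k c w))"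
proof -
  define C where "C = 2 * real N * (exp ((c + ln (real N)) / 2) / (half_moment - 1))"
  obtain k0 :: nat where k0: "(C - c + 1) / ln (real M) < real k0"
    using reals_Archimedean2 by blast
  \<comment> \<open>\<open>k\<close> contractions bring the walk deeper than the level \<open>c\<close> by more than the constant \<open>C\<close>, which bounds
    the gain through cuts.\<close>
  define k where "k = Suc k0"
  have kM: "C - c + 1 \<le> real k * ln (real M)"
    using k0 ln_M_pos by (simp add: k_def field_simps)
  have C0: "0 \<le> C" using half_moment_gt_1[OF L] by (simp add: C_def)
  define h where "h n = Ew n (\<lambda>w. of_bool (alive k c w) * (lslope (types w) - c))" for n
  define q where "q n = Ew n (\<lambda>w. of_bool (alive k c w))" for n
  define P where "P = (1 - p0) ^ k"
  have P0: "0 < P" using p0_lt1 by (simp add: P_def)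
  have len_ls: "lslope t = - real (length t) * ln (real M)" if "True \<notin> set t" for t
    using that by (induction t) (auto simp: step_log_def algebra_simps)
  have al_k: "alive k c w \<longleftrightarrow> True \<notin> set (types w)" if "length w = k" for w
  proof -
    have "low_walk k c (types w) \<longleftrightarrow> True \<notin> set (types w)"
    proof
      assume "True \<notin> set (types w)"
      then have "lslope (types w) \<le> c" using len_ls[of "types w"] that kM C0 by simp
      then show "low_walk k c (types w)"
        using that \<open>True \<notin> set (types w)\<close> by (auto simp: low_walk_def contracting_start_def)
    qed (use that in \<open>auto simp: low_walk_def contracting_start_def\<close>)
    then show ?thesis using uncut_contracting[of w] by (auto simp: alive_def)
  qed
  have low_k: "Eb k (\<lambda>t. of_bool (low_walk k c t)) = P"
  proof -
    have "Eb k (\<lambda>t. of_bool (low_walk k c t)) = Eb k (\<lambda>t. of_bool (True \<notin> set t) * (\<lambda>_. 1) (lslope t))"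
    proof (rule B.avg_cong)
      fix t :: "bool list" assume t: "length t = k"
      show "of_bool (low_walk k c t) = of_bool (True \<notin> set t) * (\<lambda>_. 1::real) (lslope t)"
        using len_ls[of t] kM C0 t by (auto simp: low_walk_def contracting_start_def)
    qed
    then show ?thesis using Eb_contracting_start[of k "\<lambda>_. 1"] by (simp add: P_def)
  qed
  have hk: "h k = P * (- real k * ln (real M) - c)"
  proof -
    have "h k = Ew k (\<lambda>w. (\<lambda>t. of_bool (True \<notin> set t) * (\<lambda>x. x - c) (lslope t)) (types w))"
      unfolding h_def by (rule W.avg_cong) (simp add: al_k)
    also have "\<dots> = Eb k (\<lambda>t. of_bool (True \<notin> set t) * (lslope t - c))" by (subst Ew_type) (rule refl)
    also have "\<dots> = (1 - p0) ^ k * (real k * step_log False - c)"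
      using Eb_contracting_start[of k "\<lambda>x. x - c"] by simp
    finally show ?thesis by (simp add: P_def step_log_def)
  qed
  have hm: "h (k + m) \<le> h k + C * P" for m
  proof -
    have "h (k + m) \<le> h k + 2 * real N * (\<Sum>n<m. Eb (k + n) (\<lambda>t. of_bool (low_walk k c t) * exp (lslope t / 2)))"
    proof (induction m)
      case (Suc m)
      then show ?case using alive_loss[OF L c, of k "k + m"] by (simp add: h_def algebra_simps)
    qed simp
    also have "\<dots> \<le> h k + 2 * real N * (exp ((c + ln (real N)) / 2) / (half_moment - 1) * P)"
      using low_walk_green[OF L, of k c m] unfolding low_k by (intro add_left_mono mult_left_mono) auto
    finally show ?thesis by (simp add: C_def)
  qed
  show thesis
  proof (rule that[of k "P / ln (real M)"])
    show "0 < k" by (simp add: k_def)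
    show "0 < P / ln (real M)" using P0 ln_M_pos by simp
    fix n assume n: "k \<le> n"
    have "- (real n * ln (real M)) * q n \<le> h n"
      unfolding q_def h_def W.avg_cmult[symmetric]
    proof (rule W.avg_mono)
      fix w :: "nat list" assume "length w = n"
      then show "- (real n * ln (real M)) * of_bool (alive k c w) \<le> of_bool (alive k c w) * (lslope (types w) - c)"
        using lslope_lower[of "types w"] c by auto
    qed
    also have "h n \<le> h k + C * P" using hm[of "n - k"] n by simp
    also have "h k + C * P = P * (C - c - real k * ln (real M))" unfolding hk by (simp add: algebra_simps)
    also have "\<dots> \<le> P * (-1)" using kM P0 by (intro mult_left_mono) auto
    finally have "P \<le> real n * ln (real M) * q n" by simp
    moreover have "0 < real n" using n by (simp add: k_def)
    ultimately show "P / ln (real M) / real n \<le> Ew n (\<lambda>w. of_bool (alive k c w))"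
      using ln_M_pos by (simp add: q_def field_simps)
  qed
qed

text \<open>
  Time is divided into cycles. A cycle lasts until the word that starts with it is no longer alive, at least \<open>k\<close> and at most \<open>T\<close> steps. The
  truncation at \<open>T\<close> gives the cycle length bounded moments of all orders, and its mean is still large.
\<close>

definition dead :: "nat \<Rightarrow> real \<Rightarrow> nat \<Rightarrow> nat list \<Rightarrow> nat \<Rightarrow> bool" where
  "dead k c T w n \<longleftrightarrow> k \<le> n \<and> n < T \<and> n \<le> length w \<and> \<not> alive k c (take n w)"

definition cycle_length :: "nat \<Rightarrow> real \<Rightarrow> nat \<Rightarrow> nat list \<Rightarrow> nat" where
  "cycle_length k c T w = (if \<exists>n. dead k c T w n then LEAST n. dead k c T w n else T)"

lemma cycle_dead:
  assumes "dead k c T w n"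
  shows "dead k c T w (cycle_length k c T w)" "cycle_length k c T w \<le> n"
  using assms LeastI[of "dead k c T w" n] Least_le[of "dead k c T w" n] unfolding cycle_length_def by auto

lemma cycle_none: "\<forall>n. \<not> dead k c T w n \<Longrightarrow> cycle_length k c T w = T"
  unfolding cycle_length_def by auto

lemma dead_bounds: "dead k c T w n \<Longrightarrow> k \<le> n \<and> n < T"
  by (simp add: dead_def)

lemma cycle_bounds:
  assumes "k \<le> T" shows "k \<le> cycle_length k c T w" "cycle_length k c T w \<le> T"
proof -
  have "k \<le> cycle_length k c T w \<and> cycle_length k c T w \<le> T"
  proof (cases "\<exists>n. dead k c T w n")
    case True
    then obtain n where "dead k c T w n" by (elim exE)
    from dead_bounds[OF cycle_dead(1)[OF this]] show ?thesis by simp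
  next
    case False
    then have "cycle_length k c T w = T" by (intro cycle_none) simp
    then show ?thesis using assms by simp
  qed
  then show "k \<le> cycle_length k c T w" "cycle_length k c T w \<le> T" by auto
qed

lemma cycle_eq_T: "cycle_length k c T w = T \<longleftrightarrow> (\<forall>n. \<not> dead k c T w n)"
proof
  assume e: "cycle_length k c T w = T"
  show "\<forall>n. \<not> dead k c T w n"
  proof (intro allI notI)
    fix n assume "dead k c T w n"
    from dead_bounds[OF cycle_dead(1)[OF this]] e show False by simp
  qed
qed (rule cycle_none)

lemma cycle_eq_iff:
  assumes "v < T"
  shows "cycle_length k c T w = v \<longleftrightarrow> dead k c T w v \<and> (\<forall>n<v. \<not> dead k c T w n)"
proof
  assume v: "cycle_length k c T w = v"
  then have "\<not> (\<forall>n. \<not> dead k c T w n)" using assms cycle_none[of k c T w] by auto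
  then obtain n where n: "dead k c T w n" by auto
  have "\<not> dead k c T w j" if "j < v" for j
    using cycle_dead(2)[of k c T w j] v that by auto
  then show "dead k c T w v \<and> (\<forall>n<v. \<not> dead k c T w n)"
    using cycle_dead(1)[OF n] v by auto
next
  assume v: "dead k c T w v \<and> (\<forall>n<v. \<not> dead k c T w n)"
  then have d: "dead k c T w (cycle_length k c T w)" and "cycle_length k c T w \<le> v"
    using cycle_dead[of k c T w v] by auto
  have "\<not> cycle_length k c T w < v" using v d by blast
  then show "cycle_length k c T w = v" using \<open>cycle_length k c T w \<le> v\<close> by simp
qed

lemma dead_take: "v \<le> length w \<Longrightarrow> n \<le> v \<Longrightarrow> dead k c T (take v w) n \<longleftrightarrow> dead k c T w n"
  by (auto simp: dead_def)

lemma cycle_take: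
  assumes "v \<le> T" "v \<le> length w"
  shows "cycle_length k c T (take v w) = v \<longleftrightarrow> cycle_length k c T w = v"
proof (cases "v < T")
  case True
  then show ?thesis using assms by (simp add: cycle_eq_iff dead_take)
next
  case False
  then have v: "v = T" using assms by simp
  have "dead k c T (take T w) n \<longleftrightarrow> dead k c T w n" for n
    using dead_take[of T w n k c T] dead_bounds[of k c T _ n] assms v by (cases "n < T") auto
  then show ?thesis unfolding v cycle_eq_T by simp
qed

lemma cycle_alive: "k \<le> i \<Longrightarrow> i < cycle_length k c T w \<Longrightarrow> i \<le> length w \<Longrightarrow> alive k c (take i w)"
  using cycle_bounds(2)[of k T c w] cycle_dead(2)[of k c T w i] by (cases "k \<le> T") (auto simp: dead_def cycle_length_def split: if_splits)

text \<open>
  Each cycle contributes at most \<open>k\<close> times at which two orbits are far apart, namely its first \<open>k\<close> steps. This bound depends on the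
  symbols only and serves all pairs of starting points at once.
\<close>

function far_bound :: "nat \<Rightarrow> real \<Rightarrow> nat \<Rightarrow> nat list \<Rightarrow> nat" where
  "far_bound k c T w = (if 0 < k \<and> k \<le> T \<and> cycle_length k c T w < length w
     then k + far_bound k c T (drop (cycle_length k c T w) w) else k)"
  by pat_completeness auto
termination
proof (relation "Wellfounded.measure (\<lambda>(k, c, T, w). length w)", goal_cases)
  case (2 k c T w)
  then show ?case using cycle_bounds(1)[of k T c w] by auto
qed simp

declare far_bound.simps [simp del]

lemma far_count_le:
  assumes k: "0 < k" "k \<le> T" and c: "exp c \<le> \<epsilon>"
    and "set w \<subseteq> {0..M}" "0 \<le> x" "x < 1" "0 \<le> y" "y < 1"
  shows "card {i. i < length w \<and> \<epsilon> \<le> \<bar>act (take i w) x - act (take i w) y\<bar>} \<le> far_bound k c T w"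
  using assms(4-)
proof (induction "length w" arbitrary: w x y rule: less_induct)
  case less
  let ?S = "\<lambda>w x y. {i. i < length w \<and> \<epsilon> \<le> \<bar>act (take i w) x - act (take i w) y\<bar>}"
  define v where "v = cycle_length k c T w"
  have early: "i < k \<or> v \<le> i" if "i \<in> ?S w x y" for i
  proof (rule ccontr)
    assume "\<not> (i < k \<or> v \<le> i)"
    then have al: "alive k c (take i w)" using cycle_alive[of k i c T w] that by (auto simp: v_def)
    then have "lslope (types (take i w)) \<le> c"
      using low_walkD[of k c "types (take i w)"] that \<open>\<not> (i < k \<or> v \<le> i)\<close> by (simp add: alive_def)
    then have "exp (lslope (types (take i w))) * \<bar>x - y\<bar> < exp c * 1"
      using less.prems by (intro mult_le_less_imp_less) auto
    moreover have "\<bar>act (take i w) x - act (take i w) y\<bar> = exp (lslope (types (take i w))) * \<bar>x - y\<bar>"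
      using al less.prems by (intro affine_word_dist) (auto simp: alive_def uncut_affine)
    ultimately show False using that c by auto
  qed
  show ?case
  proof (cases "v < length w")
    case False
    have "?S w x y \<subseteq> {..<k}" using early False by fastforce
    then have "card (?S w x y) \<le> card {..<k}" by (intro card_mono) auto
    then show ?thesis using False by (subst far_bound.simps) (simp add: v_def)
  next
    case True
    have vk: "0 < v" using cycle_bounds(1)[OF k(2), of c w] k by (simp add: v_def)
    let ?x = "act (take v w) x" and ?y = "act (take v w) y" and ?w = "drop v w"
    have "?S w x y \<subseteq> {..<k} \<union> (\<lambda>i. v + i) ` ?S ?w ?x ?y"
    proof
      fix i assume i: "i \<in> ?S w x y"
      show "i \<in> {..<k} \<union> (\<lambda>i. v + i) ` ?S ?w ?x ?y"
      proof (cases "i < k")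
        case False
        then have "v \<le> i" using early[OF i] by simp
        then obtain j where j: "i = v + j" by (metis le_Suc_ex)
        have "take i w = take v w @ take j ?w" unfolding j by (rule take_add)
        then have "j \<in> ?S ?w ?x ?y" using i j by auto
        then show ?thesis using j by auto
      qed simp
    qed
    then have "card (?S w x y) \<le> card ({..<k} \<union> (\<lambda>i. v + i) ` ?S ?w ?x ?y)"
      by (intro card_mono) auto
    also have "\<dots> \<le> k + card (?S ?w ?x ?y)"
      by (intro order_trans[OF card_Un_le] add_mono card_image_le) auto
    also have "card (?S ?w ?x ?y) \<le> far_bound k c T ?w"
    proof (rule less.hyps)
      show "length ?w < length w" using True vk by simp
      show "set ?w \<subseteq> {0..M}" using less.prems set_drop_subset[of v w] by blast
      have "set (take v w) \<subseteq> {0..M}" using less.prems set_take_subset[of v w] by blast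
      then show "0 \<le> ?x" "?x < 1" "0 \<le> ?y" "?y < 1" using less.prems act_unit by auto
    qed
    finally show ?thesis using True k by (subst far_bound.simps) (simp add: v_def)
  qed
qed

end

lemma exp_neg_le_quadratic:
  fixes x :: real assumes "0 \<le> x" shows "exp (- x) \<le> 1 - x + x\<^sup>2 / 2"
proof -
  have p: "0 < 1 + x + x\<^sup>2 / 2" using assms by (intro add_pos_nonneg) auto
  have "exp (- x) = 1 / exp x" by (simp add: exp_minus divide_inverse)
  also have "\<dots> \<le> 1 / (1 + x + x\<^sup>2 / 2)"
    using exp_lower_Taylor_quadratic[OF assms] p by (intro divide_left_mono) auto
  also have "\<dots> \<le> 1 - x + x\<^sup>2 / 2"
  proof -
    have "(1 - x + x\<^sup>2 / 2) * (1 + x + x\<^sup>2 / 2) = 1 + x ^ 4 / 4"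
      by (simp add: algebra_simps power2_eq_square power4_eq_xxxx)
    then have "1 \<le> (1 - x + x\<^sup>2 / 2) * (1 + x + x\<^sup>2 / 2)" by simp
    then show ?thesis using p by (simp add: pos_divide_le_eq)
  qed
  finally show ?thesis .
qed

context random_maps begin

declare sum_of_bool_eq [simp del] sum_mult_of_bool_eq [simp del] sum_of_bool_mult_eq [simp del]

definition cycle_prob :: "nat \<Rightarrow> real \<Rightarrow> nat \<Rightarrow> nat \<Rightarrow> real" where
  "cycle_prob k c T v = Ew T (\<lambda>w. of_bool (cycle_length k c T w = v))"

lemma cycle_prob_eq:
  assumes "v \<le> T" "v \<le> n"
  shows "Ew n (\<lambda>w. of_bool (cycle_length k c T w = v)) = cycle_prob k c T v"
proof -
  have *: "Ew m (\<lambda>w. of_bool (cycle_length k c T w = v)) = Ew v (\<lambda>w. of_bool (cycle_length k c T w = v))" if "v \<le> m" for m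
  proof -
    have "Ew m (\<lambda>w. of_bool (cycle_length k c T w = v)) = Ew m (\<lambda>w. of_bool (cycle_length k c T (take v w) = v))"
      using that assms by (intro W.avg_cong) (simp add: cycle_take)
    also have "\<dots> = Ew v (\<lambda>w. of_bool (cycle_length k c T w = v))" using that by (rule W.avg_take)
    finally show ?thesis .
  qed
  show ?thesis unfolding cycle_prob_def using *[OF assms(1)] *[OF assms(2)] by simp
qed

lemma cycle_prob_nonneg: "0 \<le> cycle_prob k c T v"
  unfolding cycle_prob_def by (intro W.avg_nonneg) auto

lemma sum_cycle: 
  fixes f :: "nat \<Rightarrow> real"
  assumes "k \<le> T" shows "(\<Sum>v\<le>T. of_bool (cycle_length k c T w = v) * f v) = f (cycle_length k c T w)"
proof -
  have "(\<Sum>v\<le>T. of_bool (cycle_length k c T w = v) * f v) = (\<Sum>v\<le>T. if cycle_length k c T w = v then f v else 0)"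
    by (rule sum.cong) auto
  then show ?thesis using cycle_bounds(2)[OF assms] by (simp add: sum.delta')
qed

lemma cycle_mean:
  fixes f :: "nat \<Rightarrow> real"
  assumes "k \<le> T" shows "(\<Sum>v\<le>T. cycle_prob k c T v * f v) = Ew T (\<lambda>w. f (cycle_length k c T w))"
proof -
  have "Ew T (\<lambda>w. f (cycle_length k c T w)) = Ew T (\<lambda>w. \<Sum>v\<le>T. f v * of_bool (cycle_length k c T w = v))"
    by (rule W.avg_cong) (simp add: sum_cycle[OF assms, symmetric] mult.commute)
  also have "\<dots> = (\<Sum>v\<le>T. cycle_prob k c T v * f v)"
    by (simp add: W.avg_sum W.avg_cmult cycle_prob_def mult.commute)
  finally show ?thesis ..
qed

text \<open>
  The cycles are independent and identically distributed. If the exponential gain \<open>exp (l * k)\<close> of one cycle is compensated by the mean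
  discount \<open>exp (- s * length)\<close>, then induction over the first cycle bounds the exponential moment by \<open>exp (s * n)\<close>, up to a constant. The
  summand \<open>T\<close> pays for the last, incomplete cycle.
\<close>

lemma far_bound_exp_moment:
  assumes k: "0 < k" "k \<le> T" and ls: "0 \<le> l" "0 \<le> s"
    and Z: "exp (l * real k) * Ew T (\<lambda>w. exp (- s * real (cycle_length k c T w))) \<le> 1"
  shows "Ew n (\<lambda>w. exp (l * real (far_bound k c T w))) \<le> exp (l * real k) * exp (s * (real n + real T))"
proof (induction n rule: less_induct)
  case (less n)
  let ?P = "cycle_prob k c T" and ?c = "cycle_length k c T" and ?b = "\<lambda>w. exp (l * real (far_bound k c T w))"
  let ?A = "{..T} \<inter> {..<n}" and ?B = "{..T} - {..<n}"
  let ?X = "\<lambda>v. exp (l * real k) * (?P v * (exp (l * real k) * exp (s * (real n + real T - real v))))"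
  have pt: "?b w \<le> (\<Sum>v\<in>?A. of_bool (?c w = v) * ?b w) + exp (l * real k) * (1 - (\<Sum>v\<in>?A. of_bool (?c w = v)))"
    if len: "length w = n" for w
  proof (cases "?c w < n")
    case True
    then have "?c w \<in> ?A" using cycle_bounds(2)[OF k(2)] by simp
    then have "(\<Sum>v\<in>?A. of_bool (?c w = v) * ?b w) = ?b w" "(\<Sum>v\<in>?A. of_bool (?c w = v)) = (1::real)"
      by (simp_all add: sum.delta' of_bool_def if_distrib[of "\<lambda>x. x * _"] cong: if_cong)
    then show ?thesis by simp
  next
    case False
    then have "(\<Sum>v\<in>?A. of_bool (?c w = v) * ?b w) = 0" "(\<Sum>v\<in>?A. of_bool (?c w = v)) = (0::real)"
      by (auto intro!: sum.neutral)
    moreover have "far_bound k c T w = k" using False len by (subst far_bound.simps) simp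
    ultimately show ?thesis by simp
  qed
  have cyc: "Ew n (\<lambda>w. of_bool (?c w = v) * ?b w) \<le> ?X v" if v: "v \<in> ?A" for v
  proof (cases "k \<le> v")
    case False
    then have "of_bool (?c w = v) * ?b w = 0" for w using cycle_bounds(1)[OF k(2), of c w] by auto
    then show ?thesis by (simp add: W.avg_const cycle_prob_nonneg)
  next
    case True
    obtain m where m: "n = v + m" "m < n" using v True k by (metis Int_iff less_add_same_cancel2 less_imp_add_positive lessThan_iff less_le_trans)
    have "0 < m" using v m by simp
    have "Ew n (\<lambda>w. of_bool (?c w = v) * ?b w) = Ew v (\<lambda>u. Ew m (\<lambda>w. of_bool (?c (u @ w) = v) * ?b (u @ w)))"
      unfolding m(1) by (rule W.avg_append)
    also have "\<dots> = Ew v (\<lambda>u. Ew m (\<lambda>w. (of_bool (?c u = v) * exp (l * real k)) * ?b w))"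
    proof (intro W.avg_cong)
      fix u w :: "nat list" assume len: "length u = v" "length w = m"
      have "?c (u @ w) = v \<longleftrightarrow> ?c u = v"
        using cycle_take[of v T "u @ w" k c] len v by simp
      moreover have "far_bound k c T (u @ w) = k + far_bound k c T w" if "?c (u @ w) = v"
        using that len k \<open>0 < m\<close> by (subst far_bound.simps) simp
      ultimately show "of_bool (?c (u @ w) = v) * ?b (u @ w) = (of_bool (?c u = v) * exp (l * real k)) * ?b w"
        by (cases "?c u = v") (simp_all add: ring_distribs exp_add)
    qed
    also have "\<dots> = Ew v (\<lambda>u. (exp (l * real k) * Ew m ?b) * of_bool (?c u = v))"
      by (rule W.avg_cong, subst W.avg_cmult) (simp only: mult_ac)
    also have "\<dots> = (exp (l * real k) * Ew m ?b) * Ew v (\<lambda>u. of_bool (?c u = v))"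
      by (rule W.avg_cmult)
    also have "Ew v (\<lambda>u. of_bool (?c u = v)) = ?P v" using v by (intro cycle_prob_eq) auto
    also have "(exp (l * real k) * Ew m ?b) * ?P v \<le> (exp (l * real k) * (exp (l * real k) * exp (s * (real m + real T)))) * ?P v"
      using mult_left_mono[OF less[OF m(2)], of "exp (l * real k)"] cycle_prob_nonneg[of k c T v]
      by (intro mult_right_mono) auto
    also have "\<dots> = ?X v" by (simp add: m(1) add.commute mult_ac)
    finally show ?thesis .
  qed
  have PA: "Ew n (\<lambda>w. of_bool (?c w = v)) = ?P v" if "v \<in> ?A" for v
    using that by (intro cycle_prob_eq) auto
  have P1: "(\<Sum>v\<le>T. ?P v) = 1" using cycle_mean[OF k(2), of c "\<lambda>_. 1"] by (simp add: W.avg_const)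
  have split: "(\<Sum>v\<le>T. g v) = (\<Sum>v\<in>?A. g v) + (\<Sum>v\<in>?B. g v)" for g :: "nat \<Rightarrow> real"
    by (rule sum.Int_Diff) simp
  have "Ew n ?b \<le> Ew n (\<lambda>w. (\<Sum>v\<in>?A. of_bool (?c w = v) * ?b w) + exp (l * real k) * (1 - (\<Sum>v\<in>?A. of_bool (?c w = v))))"
    by (intro W.avg_mono pt)
  also have "\<dots> = (\<Sum>v\<in>?A. Ew n (\<lambda>w. of_bool (?c w = v) * ?b w)) + exp (l * real k) * (1 - (\<Sum>v\<in>?A. ?P v))"
    unfolding W.avg_add W.avg_cmult W.avg_diff W.avg_const by (simp add: W.avg_sum PA)
  also have "1 - (\<Sum>v\<in>?A. ?P v) = (\<Sum>v\<in>?B. ?P v)" using P1 split[of ?P] by simp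
  also have "(\<Sum>v\<in>?A. Ew n (\<lambda>w. of_bool (?c w = v) * ?b w)) + exp (l * real k) * (\<Sum>v\<in>?B. ?P v) \<le> (\<Sum>v\<in>?A. ?X v) + (\<Sum>v\<in>?B. ?X v)"
  proof (intro add_mono sum_mono cyc)
    show "exp (l * real k) * (\<Sum>v\<in>?B. ?P v) \<le> (\<Sum>v\<in>?B. ?X v)"
      unfolding sum_distrib_left
    proof (intro sum_mono mult_left_mono)
      fix v assume v: "v \<in> ?B"
      have "1 \<le> exp (l * real k) * exp (s * (real n + real T - real v))"
        using v ls by (simp flip: exp_add)
      then show "?P v \<le> ?P v * (exp (l * real k) * exp (s * (real n + real T - real v)))"
        using mult_left_mono[OF _ cycle_prob_nonneg[of k c T v], of 1] by simp
    qed simp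
  qed auto
  also have "\<dots> = (\<Sum>v\<le>T. ?X v)" by (rule split[symmetric])
  also have "\<dots> = exp (l * real k) * exp (s * (real n + real T)) * (exp (l * real k) * (\<Sum>v\<le>T. ?P v * exp (- s * real v)))"
    unfolding sum_distrib_left
  proof (intro sum.cong refl)
    fix v
    have "exp (s * (real n + real T - real v)) = exp (s * (real n + real T)) * exp (- s * real v)"
      by (simp add: algebra_simps flip: exp_add)
    then show "?X v = exp (l * real k) * exp (s * (real n + real T)) * (exp (l * real k) * (?P v * exp (- s * real v)))"
      by (simp only: mult_ac)
  qed
  also have "(\<Sum>v\<le>T. ?P v * exp (- s * real v)) = Ew T (\<lambda>w. exp (- s * real (?c w)))"
    using cycle_mean[OF k(2), of c "\<lambda>v. exp (- s * real v)"] by simp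
  also have "exp (l * real k) * exp (s * (real n + real T)) * (exp (l * real k) * \<dots>) \<le> exp (l * real k) * exp (s * (real n + real T)) * 1"
    by (intro mult_left_mono Z) auto
  finally show ?case by simp
qed

text \<open>
  The mean length of a cycle is the sum of the probabilities of being alive, which dominates a harmonic series.
\<close>

lemma cycle_mean_unbounded:
  assumes k: "0 < k" and \<delta>: "0 < \<delta>" "\<And>n. k \<le> n \<Longrightarrow> \<delta> / real n \<le> Ew n (\<lambda>w. of_bool (alive k c w))"
  shows "\<exists>T\<ge>k. A < Ew T (\<lambda>w. real (cycle_length k c T w))"
proof -
  have lower: "(\<Sum>n\<in>{k..<T}. \<delta> / real n) \<le> Ew T (\<lambda>w. real (cycle_length k c T w))" if "k \<le> T" for T
  proof -
    have "(\<Sum>n\<in>{k..<T}. \<delta> / real n) \<le> (\<Sum>n\<in>{k..<T}. Ew T (\<lambda>w. of_bool (alive k c (take n w))))"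
    proof (rule sum_mono)
      fix n assume n: "n \<in> {k..<T}"
      then have "Ew T (\<lambda>w. of_bool (alive k c (take n w))) = Ew n (\<lambda>w. of_bool (alive k c w))"
        by (intro W.avg_take) auto
      then show "\<delta> / real n \<le> Ew T (\<lambda>w. of_bool (alive k c (take n w)))" using \<delta>(2)[of n] n by simp
    qed
    also have "\<dots> = Ew T (\<lambda>w. \<Sum>n\<in>{k..<T}. of_bool (alive k c (take n w)))" by (rule W.avg_sum[symmetric]) simp
    also have "\<dots> \<le> Ew T (\<lambda>w. real (cycle_length k c T w))"
    proof (rule W.avg_mono)
      fix w :: "nat list" assume len: "length w = T"
      have lt: "n < cycle_length k c T w" if n: "n \<in> {k..<T}" and al: "alive k c (take n w)" for n
      proof (rule ccontr)
        assume "\<not> n < cycle_length k c T w"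
        define v where "v = cycle_length k c T w"
        have v: "v < T" "v \<le> n" using \<open>\<not> n < cycle_length k c T w\<close> n by (auto simp: v_def)
        have "dead k c T w v" using cycle_eq_iff[OF v(1), of k c w] by (simp add: v_def)
        then have "\<not> alive k c (take v w)" "k \<le> v" by (auto simp: dead_def)
        moreover have "alive k c (take v w)"
        proof -
          have tt: "take j (take n w) = take j (take v w)" if "j \<le> v" for j using v that by simp
          have cs: "contracting_start k (types (take v w))"
            using al \<open>k \<le> v\<close> n v by (simp add: alive_def low_walk_def contracting_start_def min_def take_map types_def split: if_splits)
          have "\<forall>j. k \<le> j \<and> j \<le> v \<longrightarrow> lslope (take j (types (take n w))) \<le> c"
            using al v n len unfolding alive_def low_walk_def by simp
          then have "\<forall>j. k \<le> j \<and> j \<le> v \<longrightarrow> lslope (take j (types (take v w))) \<le> c"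
            using tt by (simp flip: types_simps(5) del: take_take)
          moreover have "uncut (take v w)"
            unfolding uncut_def
          proof (intro allI impI)
            fix j assume "j \<le> length (take v w)"
            then have j: "j \<le> v" by simp
            then have "affine_word (take j (take n w))"
              using al v n len unfolding alive_def uncut_def by simp
            then show "affine_word (take j (take v w))" by (simp only: tt[OF j])
          qed
          ultimately show ?thesis using cs v n len by (simp add: alive_def low_walk_def)
        qed
        ultimately show False by simp
      qed
      have "(\<Sum>n\<in>{k..<T}. of_bool (alive k c (take n w))) \<le> (\<Sum>n\<in>{..<cycle_length k c T w}. (1::real))"
      proof -
        have "(\<Sum>n\<in>{k..<T}. of_bool (alive k c (take n w))) = (\<Sum>n\<in>{n\<in>{k..<T}. alive k c (take n w)}. (1::real))"
          by (simp add: of_bool_def sum.If_cases Int_def)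
        also have "\<dots> \<le> (\<Sum>n\<in>{..<cycle_length k c T w}. 1)" using lt by (intro sum_mono2) auto
        finally show ?thesis .
      qed
      then show "(\<Sum>n\<in>{k..<T}. of_bool (alive k c (take n w))) \<le> real (cycle_length k c T w)" by simp
    qed
    finally show ?thesis .
  qed
  have ns: "\<not> summable (\<lambda>n. \<delta> / real n)"
  proof
    assume "summable (\<lambda>n. \<delta> / real n)"
    then have "summable (\<lambda>n. (1 / \<delta>) * (\<delta> / real n))" by (rule summable_mult)
    then have "summable (\<lambda>n. inverse (real n))" using \<delta>(1) by (simp add: divide_inverse)
    then show False using not_summable_harmonic[where 'a=real] by simp
  qed
  have "\<exists>T\<ge>k. A < (\<Sum>n\<in>{k..<T}. \<delta> / real n)"
  proof (rule ccontr)
    assume "\<not> (\<exists>T\<ge>k. A < (\<Sum>n\<in>{k..<T}. \<delta> / real n))"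
    then have le: "(\<Sum>n\<in>{k..<k+T}. \<delta> / real n) \<le> A" for T by (auto simp: not_less)
    have "summable (\<lambda>n. \<delta> / real (n + k))"
    proof (rule summableI_nonneg_bounded)
      show "(\<Sum>n<T. \<delta> / real (n + k)) \<le> A" for T
        using le[of T] sum.shift_bounds_nat_ivl[of "\<lambda>n. \<delta> / real n" 0 k T] by (simp add: lessThan_atLeast0 add.commute)
    qed (use \<delta> in auto)
    then show False using ns summable_iff_shift[of "\<lambda>n. \<delta> / real n" k] by simp
  qed
  then show ?thesis using lower by (meson less_le_trans)
qed

text \<open>
  Cycles of mean length more than \<open>A = 2 * k / \<eta>\<close> make the fraction of far times less than \<open>\<eta>\<close>; the exponential moment turns this into
  summable tail probabilities.
\<close>

lemma far_bound_sublinear: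
  assumes L: "lyapunov_exponent M N p0 = 0" and c: "c \<le> 0" and \<eta>: "0 < \<eta>"
  obtains k T where "0 < k" "k \<le> T"
    "AE \<omega> in \<nu>. eventually (\<lambda>n. real (far_bound k c T (prefix_word n \<omega>)) < \<eta> * real n) sequentially"
proof -
  obtain k \<delta> where k: "0 < k" and \<delta>: "0 < \<delta>" "\<And>n. k \<le> n \<Longrightarrow> \<delta> / real n \<le> Ew n (\<lambda>w. of_bool (alive k c w))"
    using long_excursion[OF L c] by blast
  define A where "A = 2 * real k / \<eta>"
  obtain T where T: "k \<le> T" "A + 1 < Ew T (\<lambda>w. real (cycle_length k c T w))"
    using cycle_mean_unbounded[OF k \<delta>, of "A + 1"] by blast
  have T0: "0 < real T" using k T by simp
  \<comment> \<open>For a cycle length of at most \<open>T\<close> the quadratic error of \<open>exp (- s * length)\<close> is then at most \<open>s\<close>, and the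
    mean exceeds \<open>A\<close> by the margin one that absorbs this error.\<close>
  define s where "s = 2 / (real T)\<^sup>2"
  define l where "l = s * A / real k"
  have A0: "0 < A" using k \<eta> by (simp add: A_def)
  have s0: "0 < s" using T0 by (simp add: s_def)
  have l0: "0 < l" using s0 A0 k by (simp add: l_def)
  have lk: "l * real k = s * A" using k by (simp add: l_def)
  have l\<eta>: "l * \<eta> = 2 * s" using k \<eta> by (simp add: l_def A_def)
  have "Ew T (\<lambda>w. exp (- s * real (cycle_length k c T w))) \<le> Ew T (\<lambda>w. (1 + s) - s * real (cycle_length k c T w))"
  proof (rule W.avg_mono)
    fix w
    have "exp (- (s * real (cycle_length k c T w))) \<le> 1 - s * real (cycle_length k c T w) + (s * real (cycle_length k c T w))\<^sup>2 / 2"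
      using s0 by (intro exp_neg_le_quadratic) simp
    also have "(s * real (cycle_length k c T w))\<^sup>2 \<le> (s * real T)\<^sup>2"
      using s0 cycle_bounds(2)[OF T(1), of c w] by (intro power_mono mult_left_mono) auto
    also have "(s * real T)\<^sup>2 = 2 * s" using T0 by (simp add: s_def power2_eq_square)
    finally show "exp (- s * real (cycle_length k c T w)) \<le> (1 + s) - s * real (cycle_length k c T w)" by simp
  qed
  also have "\<dots> = (1 + s) - s * Ew T (\<lambda>w. real (cycle_length k c T w))"
    by (simp add: W.avg_diff W.avg_cmult W.avg_const)
  also have "\<dots> \<le> (1 + s) - s * (A + 1)" using T(2) s0 by simp
  also have "\<dots> = 1 + (- (s * A))" by (simp add: algebra_simps)
  also have "\<dots> \<le> exp (- (s * A))" by (rule exp_ge_add_one_self)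
  finally have "exp (l * real k) * Ew T (\<lambda>w. exp (- s * real (cycle_length k c T w))) \<le> exp (l * real k) * exp (- (s * A))"
    by (intro mult_left_mono) auto
  also have "\<dots> = 1" unfolding lk by (simp flip: exp_add)
  finally have Z: "exp (l * real k) * Ew T (\<lambda>w. exp (- s * real (cycle_length k c T w))) \<le> 1" .
  define B where "B n = {\<omega> \<in> space \<nu>. \<eta> * real n \<le> real (far_bound k c T (prefix_word n \<omega>))}" for n
  have "measure \<nu> (B n) \<le> exp (l * real k + s * real T) * exp (- s) ^ n" for n
  proof -
    have "measure \<nu> (B n) = Ew n (\<lambda>w. of_bool (\<eta> * real n \<le> real (far_bound k c T w)))"
      unfolding B_def by (rule prob_prefix)
    also have "\<dots> \<le> Ew n (\<lambda>w. exp (- (l * \<eta> * real n)) * exp (l * real (far_bound k c T w)))"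
    proof (rule W.avg_mono)
      fix w
      show "of_bool (\<eta> * real n \<le> real (far_bound k c T w)) \<le> exp (- (l * \<eta> * real n)) * exp (l * real (far_bound k c T w))"
        using l0 mult_left_mono[of "\<eta> * real n" "real (far_bound k c T w)" l]
        by (auto simp: mult.assoc simp flip: exp_add)
    qed
    also have "\<dots> = exp (- (l * \<eta> * real n)) * Ew n (\<lambda>w. exp (l * real (far_bound k c T w)))" by (rule W.avg_cmult)
    also have "\<dots> \<le> exp (- (l * \<eta> * real n)) * (exp (l * real k) * exp (s * (real n + real T)))"
      using l0 s0 by (intro mult_left_mono far_bound_exp_moment k T(1) Z) auto
    also have "\<dots> = exp (l * real k + s * real T) * exp (- s) ^ n"
      unfolding l\<eta> by (simp add: exp_of_nat_mult[symmetric] algebra_simps flip: exp_add)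
    finally show ?thesis .
  qed
  then have "summable (\<lambda>n. measure \<nu> (B n))"
    using s0 by (intro summable_comparison_test[OF _ summable_mult[OF summable_geometric[of "exp (- s)"]]])
                (auto intro!: exI[of _ 0])
  then have "AE \<omega> in \<nu>. eventually (\<lambda>n. \<omega> \<in> space \<nu> - B n) sequentially"
    by (intro borel_cantelli_AE1) (auto simp: B_def bp.emeasure_eq_measure)
  then have "AE \<omega> in \<nu>. eventually (\<lambda>n. real (far_bound k c T (prefix_word n \<omega>)) < \<eta> * real n) sequentially"
    by (eventually_elim, elim eventually_mono) (auto simp: B_def)
  with that k T(1) show thesis by blast
qed

theorem intermittency:
  assumes L: "lyapunov_exponent M N p0 = 0" and \<epsilon>: "0 < \<epsilon>"
  shows "AE \<omega> in \<nu>. \<forall>x\<in>{0..<1}. \<forall>y\<in>{0..<1}. (\<lambda>n. close_freq M N \<omega> x y \<epsilon> n) \<longlonglongrightarrow> 1"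
proof -
  define c where "c = min 0 (ln \<epsilon>)"
  have c: "c \<le> 0" "exp c \<le> \<epsilon>"
    using \<epsilon> exp_le_cancel_iff[of c "ln \<epsilon>"] by (auto simp: c_def)
  have "AE \<omega> in \<nu>. \<forall>x\<in>{0..<1}. \<forall>y\<in>{0..<1}. eventually (\<lambda>n. 1 - \<eta> \<le> close_freq M N \<omega> x y \<epsilon> n) sequentially"
    if \<eta>: "0 < \<eta>" for \<eta>
  proof -
    obtain k T where k: "0 < k" "k \<le> T"
      and AE: "AE \<omega> in \<nu>. eventually (\<lambda>n. real (far_bound k c T (prefix_word n \<omega>)) < \<eta> * real n) sequentially"
      using far_bound_sublinear[OF L c(1) \<eta>] by blast
    from AE AE_space show ?thesis
    proof (eventually_elim, intro ballI)
      fix \<omega> x y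
      assume ev: "eventually (\<lambda>n. real (far_bound k c T (prefix_word n \<omega>)) < \<eta> * real n) sequentially"
        and sp: "\<omega> \<in> space \<nu>" and x: "x \<in> {0..<1::real}" and y: "y \<in> {0..<1::real}"
      from ev eventually_gt_at_top[of 0]
      show "eventually (\<lambda>n. 1 - \<eta> \<le> close_freq M N \<omega> x y \<epsilon> n) sequentially"
      proof eventually_elim
        case (elim n)
        let ?F = "{i. i < n \<and> \<epsilon> \<le> orbit_dist M N \<omega> x y i}"
        have F: "?F = {i. i < length (prefix_word n \<omega>) \<and> \<epsilon> \<le> \<bar>act (take i (prefix_word n \<omega>)) x - act (take i (prefix_word n \<omega>)) y\<bar>}"
          by (auto simp: orbit_dist_def compos_eq_act take_prefix_word)
        have "card ?F \<le> far_bound k c T (prefix_word n \<omega>)"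
          unfolding F using x y by (intro far_count_le k c(2) set_prefix_word sp) auto
        then have cF: "real (card ?F) < \<eta> * real n" using elim(1) by linarith
        have "card {i. 0 \<le> i \<and> i < n \<and> orbit_dist M N \<omega> x y i < \<epsilon>} + card ?F = card {..<n}"
        proof -
          have "{i. 0 \<le> i \<and> i < n \<and> orbit_dist M N \<omega> x y i < \<epsilon>} \<union> ?F = {..<n}" by auto
          moreover have "{i. 0 \<le> i \<and> i < n \<and> orbit_dist M N \<omega> x y i < \<epsilon>} \<inter> ?F = {}" by auto
          ultimately show ?thesis by (metis (no_types, lifting) card_Un_disjoint finite_Un finite_lessThan)
        qed
        then have "real (card {i. 0 \<le> i \<and> i < n \<and> orbit_dist M N \<omega> x y i < \<epsilon>}) = real n - real (card ?F)"
          by (simp add: of_nat_add[symmetric] del: of_nat_add)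
        then show ?case
          using elim(2) cF unfolding close_freq_def by (simp add: field_simps)
      qed
    qed
  qed
  then have "AE \<omega> in \<nu>. \<forall>j. \<forall>x\<in>{0..<1}. \<forall>y\<in>{0..<1}. eventually (\<lambda>n. 1 - inverse (real (Suc j)) \<le> close_freq M N \<omega> x y \<epsilon> n) sequentially"
    by (subst AE_all_countable) auto
  then show ?thesis
  proof (eventually_elim, intro ballI)
    fix \<omega> x y
    assume *: "\<forall>j. \<forall>x\<in>{0..<1}. \<forall>y\<in>{0..<1}. eventually (\<lambda>n. 1 - inverse (real (Suc j)) \<le> close_freq M N \<omega> x y \<epsilon> n) sequentially"
      and x: "x \<in> {0..<1::real}" and y: "y \<in> {0..<1::real}"
    have le1: "close_freq M N \<omega> x y \<epsilon> n \<le> 1" for n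
    proof -
      have "card {i. 0 \<le> i \<and> i < n \<and> orbit_dist M N \<omega> x y i < \<epsilon>} \<le> card {..<n}"
        by (intro card_mono) auto
      then show ?thesis unfolding close_freq_def by (cases "n = 0") (auto simp: field_simps)
    qed
    show "(\<lambda>n. close_freq M N \<omega> x y \<epsilon> n) \<longlonglongrightarrow> 1"
    proof (rule order_tendstoI)
      fix a :: real assume "a < 1"
      then obtain j where "inverse (real (Suc j)) < 1 - a" using reals_Archimedean[of "1 - a"] by auto
      moreover have "eventually (\<lambda>n. 1 - inverse (real (Suc j)) \<le> close_freq M N \<omega> x y \<epsilon> n) sequentially"
        using * x y by blast
      ultimately show "eventually (\<lambda>n. a < close_freq M N \<omega> x y \<epsilon> n) sequentially"
        by (auto elim!: eventually_mono)
    next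
      fix a :: real assume "1 < a"
      then show "eventually (\<lambda>n. close_freq M N \<omega> x y \<epsilon> n < a) sequentially"
        using le1 by (auto intro!: always_eventually intro: le_less_trans)
    qed
  qed
qed

end

section \<open>Positive Lyapunov exponent: contraction of variation and supremum\<close>

lemma powr_subadditive:
  fixes x y s :: real
  assumes "0 < s" "s \<le> 1" "0 \<le> x" "0 \<le> y"
  shows "(x + y) powr s \<le> x powr s + y powr s"
proof (cases "x + y = 0")
  case True
  then show ?thesis using assms by simp
next
  case False
  then have z: "0 < x + y" using assms by simp
  have le: "u / (x + y) \<le> (u / (x + y)) powr s" if "0 \<le> u" "u \<le> x + y" for u
  proof (cases "u = 0")
    case False
    have "(u / (x + y)) powr 1 \<le> (u / (x + y)) powr s"
      using that z assms False by (intro powr_mono') auto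
    then show ?thesis using that z by simp
  qed (use assms in auto)
  have "1 = x / (x + y) + y / (x + y)" using z by (simp flip: add_divide_distrib)
  also have "\<dots> \<le> (x / (x + y)) powr s + (y / (x + y)) powr s" using le assms by (intro add_mono) auto
  also have "\<dots> = (x powr s + y powr s) / (x + y) powr s"
    using assms z by (simp add: powr_divide add_divide_distrib)
  finally show ?thesis using z by (simp add: pos_le_divide_eq)
qed

context random_maps begin

text \<open>
  A pair \<open>(v, b)\<close> bounds the mean variation \<open>v\<close> and the mean modulus \<open>b\<close> of a function with integral zero that is pushed forward by random
  digits, when the types are given. Expansion divides the variation by \<open>N\<close>, and the modulus is at most the variation; contraction multiplies
  the variation by \<open>M\<close> and creates two new jumps, while the mean modulus is unchanged.
\<close>

definition bound_step :: "bool \<Rightarrow> real \<times> real \<Rightarrow> real \<times> real" where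
  "bound_step z p = (case p of (v, b) \<Rightarrow> if z then (v / real N, min b (v / real N)) else (real M * (v + 2 * b), b))"

definition pair_mean :: "nat \<Rightarrow> (real \<times> real \<Rightarrow> real) \<Rightarrow> real \<times> real \<Rightarrow> real" where
  "pair_mean n \<phi> p = Eb n (\<lambda>t. \<phi> (fold bound_step t p))"

lemma pair_mean_0 [simp]: "pair_mean 0 \<phi> p = \<phi> p" by (simp add: pair_mean_def)

lemma pair_mean_Suc: "pair_mean (Suc n) \<phi> p = p0 * pair_mean n \<phi> (bound_step True p) + (1 - p0) * pair_mean n \<phi> (bound_step False p)"
  by (simp add: pair_mean_def Eb_Suc)

lemma pair_mean_add: "pair_mean (m + n) \<phi> p = pair_mean m (pair_mean n \<phi>) p"
  by (simp add: pair_mean_def B.avg_append)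

definition admissible :: "real \<times> real \<Rightarrow> bool" where "admissible p \<longleftrightarrow> 0 \<le> snd p \<and> snd p \<le> fst p"

lemma admissible_step: "admissible p \<Longrightarrow> admissible (bound_step z p)"
proof -
  assume "admissible p"
  then have *: "0 \<le> snd p" "snd p \<le> fst p" by (auto simp: admissible_def)
  have "1 * (fst p + 2 * snd p) \<le> real M * (fst p + 2 * snd p)"
    using * M2 by (intro mult_right_mono) auto
  then show ?thesis using * by (cases p) (auto simp: admissible_def bound_step_def)
qed

lemma admissible_fold: "admissible p \<Longrightarrow> admissible (fold bound_step t p)"
proof (induction t arbitrary: p)
  case (Cons z t)
  then show ?case using Cons.IH[OF admissible_step[OF Cons.prems]] by simp
qed simp

lemma pair_mean_mono: "(\<And>p. admissible p \<Longrightarrow> \<phi> p \<le> \<psi> p) \<Longrightarrow> admissible p \<Longrightarrow> pair_mean n \<phi> p \<le> pair_mean n \<psi> p"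
  unfolding pair_mean_def by (intro B.avg_mono) (use admissible_fold in blast)

lemma snd_step_le: "admissible p \<Longrightarrow> snd (bound_step z p) \<le> snd p"
  by (cases p) (auto simp: bound_step_def)

lemma snd_fold_le: "admissible p \<Longrightarrow> snd (fold bound_step t p) \<le> snd p"
proof (induction t arbitrary: p)
  case (Cons z t)
  then show ?case using order_trans[OF Cons.IH[OF admissible_step] snd_step_le] by simp
qed simp

lemma pair_mean_snd_le: "0 < s \<Longrightarrow> admissible p \<Longrightarrow> pair_mean n (\<lambda>p. snd p powr s) p \<le> snd p powr s"
proof -
  assume s: "0 < s" and p: "admissible p"
  have "pair_mean n (\<lambda>p. snd p powr s) p \<le> Eb n (\<lambda>_. snd p powr s)"
    unfolding pair_mean_def using s p snd_fold_le[OF p] admissible_fold[OF p] by (intro B.avg_mono powr_mono2) (auto simp: admissible_def)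
  then show ?thesis by (simp add: B.avg_const)
qed

text \<open>
  The \<open>s\<close>-th moment of the inverse slope of one symbol, which is the factor by which the \<open>s\<close>-th moment of the variation is multiplied in one step,
  apart from the new jumps.
\<close>

definition rate :: "real \<Rightarrow> real" where "rate s = p0 * real N powr - s + (1 - p0) * real M powr s"

lemma pair_mean_fst_le:
  assumes s: "0 < s" "s \<le> 1" and p: "admissible p"
  shows "pair_mean n (\<lambda>p. fst p powr s) p \<le> rate s ^ n * fst p powr s + (\<Sum>j<n. rate s ^ j) * (2 * real M powr s) * snd p powr s"
  using p
proof (induction n arbitrary: p)
  case (Suc n)
  obtain v b where p: "p = (v, b)" by (cases p)
  have vb: "0 \<le> b" "b \<le> v" using Suc.prems by (auto simp: p admissible_def)
  let ?S = "(\<Sum>j<n. rate s ^ j) * (2 * real M powr s)"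
  have r0: "0 \<le> rate s" using p0_pos p0_lt1 by (simp add: rate_def)
  have S0: "0 \<le> ?S" using r0 by (intro mult_nonneg_nonneg sum_nonneg) auto
  have T: "pair_mean n (\<lambda>p. fst p powr s) (bound_step True p) \<le> rate s ^ n * (real N powr - s * v powr s) + ?S * b powr s"
  proof -
    have "pair_mean n (\<lambda>p. fst p powr s) (bound_step True p) \<le> rate s ^ n * fst (bound_step True p) powr s + ?S * snd (bound_step True p) powr s"
      by (rule Suc.IH[OF admissible_step[OF Suc.prems]])
    also have "\<dots> \<le> rate s ^ n * (real N powr - s * v powr s) + ?S * b powr s"
      using vb s admissible_step[OF Suc.prems, of True]
      by (intro add_mono mult_left_mono S0 powr_mono2 zero_le_power r0)
         (auto simp: p bound_step_def powr_divide powr_minus_divide admissible_def)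
    finally show ?thesis .
  qed
  have F: "pair_mean n (\<lambda>p. fst p powr s) (bound_step False p) \<le> rate s ^ n * (real M powr s * (v powr s + 2 * b powr s)) + ?S * b powr s"
  proof -
    have "pair_mean n (\<lambda>p. fst p powr s) (bound_step False p) \<le> rate s ^ n * fst (bound_step False p) powr s + ?S * snd (bound_step False p) powr s"
      by (rule Suc.IH[OF admissible_step[OF Suc.prems]])
    also have "fst (bound_step False p) powr s = real M powr s * (v + 2 * b) powr s"
      using vb by (simp add: p bound_step_def powr_mult)
    also have "(v + 2 * b) powr s \<le> v powr s + 2 * b powr s"
    proof -
      have "(v + 2 * b) powr s \<le> v powr s + (2 * b) powr s" using s vb by (intro powr_subadditive) auto
      also have "(2 * b) powr s = 2 powr s * b powr s" using vb by (simp add: powr_mult)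
      also have "2 powr s * b powr s \<le> 2 * b powr s"
        using powr_mono[of s 1 "2::real"] s by (intro mult_right_mono) auto
      finally show ?thesis by simp
    qed
    also have "snd (bound_step False p) = b" by (simp add: p bound_step_def)
    finally show ?thesis using r0 by (simp add: mult_left_mono)
  qed
  have "pair_mean (Suc n) (\<lambda>p. fst p powr s) p
    \<le> p0 * (rate s ^ n * (real N powr - s * v powr s) + ?S * b powr s)
     + (1 - p0) * (rate s ^ n * (real M powr s * (v powr s + 2 * b powr s)) + ?S * b powr s)"
    unfolding pair_mean_Suc using T F p0_pos p0_lt1 by (intro add_mono mult_left_mono) auto
  also have "\<dots> = rate s ^ Suc n * v powr s + (1 - p0) * (rate s ^ n * (2 * real M powr s * b powr s)) + ?S * b powr s"
    by (simp add: rate_def algebra_simps)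
  also have "(1 - p0) * (rate s ^ n * (2 * real M powr s * b powr s)) \<le> rate s ^ n * (2 * real M powr s * b powr s)"
    using p0_pos p0_lt1 r0 by (intro mult_left_le_one_le) auto
  finally show ?case by (simp add: p algebra_simps)
qed simp

text \<open>
  With probability \<open>p0 ^ k\<close> there are \<open>k\<close> expansions in a row, and then the modulus is at most the variation divided by \<open>N ^ k\<close>.
\<close>

lemma pair_mean_snd_contract:
  assumes s: "0 < s" and p: "admissible p"
  shows "pair_mean k (\<lambda>p. snd p powr s) p \<le> (1 - p0 ^ k) * snd p powr s + p0 ^ k * (real N powr - s) ^ k * fst p powr s"
  using p
proof (induction k arbitrary: p)
  case 0
  then show ?case using s by (auto simp: admissible_def intro!: powr_mono2)
next
  case (Suc k)
  obtain v b where p: "p = (v, b)" by (cases p)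
  have vb: "0 \<le> b" "b \<le> v" using Suc.prems by (auto simp: p admissible_def)
  have "pair_mean k (\<lambda>p. snd p powr s) (bound_step True p)
     \<le> (1 - p0 ^ k) * snd (bound_step True p) powr s + p0 ^ k * (real N powr - s) ^ k * fst (bound_step True p) powr s"
    by (rule Suc.IH[OF admissible_step[OF Suc.prems]])
  also have "fst (bound_step True p) powr s = real N powr - s * v powr s"
    using vb by (simp add: p bound_step_def powr_divide powr_minus_divide)
  also have "(1 - p0 ^ k) * snd (bound_step True p) powr s \<le> (1 - p0 ^ k) * b powr s"
    using vb s admissible_step[OF Suc.prems, of True] p0_pos p0_lt1 power_le_one[of p0 k]
    by (intro mult_left_mono powr_mono2) (auto simp: p bound_step_def admissible_def)
  finally have T: "pair_mean k (\<lambda>p. snd p powr s) (bound_step True p)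
    \<le> (1 - p0 ^ k) * b powr s + p0 ^ k * (real N powr - s) ^ k * (real N powr - s * v powr s)" by simp
  have F: "pair_mean k (\<lambda>p. snd p powr s) (bound_step False p) \<le> b powr s"
    using pair_mean_snd_le[OF s admissible_step[OF Suc.prems, of False], of k] by (simp add: p bound_step_def)
  have "pair_mean (Suc k) (\<lambda>p. snd p powr s) p
    \<le> p0 * ((1 - p0 ^ k) * b powr s + p0 ^ k * (real N powr - s) ^ k * (real N powr - s * v powr s)) + (1 - p0) * b powr s"
    unfolding pair_mean_Suc using T F p0_pos p0_lt1 by (intro add_mono mult_left_mono) auto
  also have "\<dots> = (1 - p0 ^ Suc k) * snd p powr s + p0 ^ Suc k * (real N powr - s) ^ Suc k * fst p powr s"
    by (simp add: p algebra_simps)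
  finally show ?case .
qed

lemma rate_lt_1:
  assumes "lyapunov_exponent M N p0 > 0"
  obtains s where "0 < s" "s \<le> 1" "rate s < 1"
proof -
  have "p0 * (- ln (real N)) + (1 - p0) * ln (real M) < 0"
    using assms by (simp add: lyapunov_exponent_def)
  then obtain t where "0 < t" "t \<le> 1" "p0 * exp (t * - ln (real N)) + (1 - p0) * exp (t * ln (real M)) < 1"
    by (rule perturb_exp_moment)
  then show thesis using M_pos N_pos by (intro that[of t]) (auto simp: rate_def powr_def)
qed

text \<open>
  The variation contracts up to a multiple of the modulus, and the modulus contracts up to a small multiple of the variation. A
  suitable combination \<open>\<Phi>\<close> of their \<open>s\<close>-th powers therefore contracts under \<open>k\<close> steps, for large \<open>k\<close>.
\<close>

theorem pair_mean_snd_decay: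
  assumes L: "lyapunov_exponent M N p0 > 0"
  obtains K \<rho> where "0 < K" "0 < \<rho>" "\<rho> < 1" "\<And>n V. 0 < V \<Longrightarrow> pair_mean n snd (V, V) \<le> K * \<rho> ^ n * V"
proof -
  obtain s where s: "0 < s" "s \<le> 1" "rate s < 1" using rate_lt_1[OF L] by blast
  define q where "q = rate s"
  have q: "0 < q" "q < 1" using s p0_pos p0_lt1 N_pos M_pos unfolding q_def by (auto simp: rate_def intro!: add_pos_pos)
  define C where "C = 2 * real M powr s / (1 - q)"
  have C0: "0 < C" using q M_pos by (simp add: C_def)
  have Ns: "0 < real N powr - s" "real N powr - s < 1"
    using N2 s by (auto intro!: powr_less_one)
  have "(\<lambda>k. q ^ k + 2 * C * (real N powr - s) ^ k) \<longlonglongrightarrow> 0 + 2 * C * 0"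
    using q Ns by (intro tendsto_intros LIMSEQ_realpow_zero) auto
  then have "eventually (\<lambda>k. q ^ k + 2 * C * (real N powr - s) ^ k < 1) sequentially"
    by (intro order_tendstoD) auto
  then obtain k0 where k0: "\<And>k. k0 \<le> k \<Longrightarrow> q ^ k + 2 * C * (real N powr - s) ^ k < 1"
    by (auto simp: eventually_sequentially)
  define k where "k = Suc k0"
  have k: "0 < k" "q ^ k + 2 * C * (real N powr - s) ^ k < 1" using k0[of k] by (auto simp: k_def)
  have pk: "0 < p0 ^ k" "p0 ^ k \<le> 1" using p0_pos p0_lt1 by (auto intro: power_le_one)
  \<comment> \<open>With this weight of the modulus, the new jumps consume only half of the gain \<open>p0 ^ k\<close>.\<close>
  define B where "B = 2 * C / p0 ^ k"
  have B0: "0 < B" using C0 pk by (simp add: B_def)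
  define \<Phi> where "\<Phi> p = fst p powr s + B * snd p powr s" for p :: "real \<times> real"
  define \<theta> where "\<theta> = max (q ^ k + 2 * C * (real N powr - s) ^ k) (1 - p0 ^ k / 2)"
  have \<theta>: "0 < \<theta>" "\<theta> < 1" using pk k by (auto simp: \<theta>_def)
  have geo: "(\<Sum>j<k. q ^ j) * (2 * real M powr s) \<le> C"
  proof -
    have "(\<Sum>j<k. q ^ j) \<le> (\<Sum>j. q ^ j)" using q by (intro sum_le_suminf summable_geometric) auto
    also have "\<dots> = 1 / (1 - q)" using q by (intro suminf_geometric) auto
    finally have "(\<Sum>j<k. q ^ j) * (2 * real M powr s) \<le> 1 / (1 - q) * (2 * real M powr s)"
      by (intro mult_right_mono) auto
    then show ?thesis by (simp add: C_def)
  qed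
  have contract: "pair_mean k \<Phi> p \<le> \<theta> * \<Phi> p" if p: "admissible p" for p
  proof -
    have "pair_mean k \<Phi> p = pair_mean k (\<lambda>p. fst p powr s) p + B * pair_mean k (\<lambda>p. snd p powr s) p"
      unfolding pair_mean_def \<Phi>_def B.avg_add B.avg_cmult ..
    also have "\<dots> \<le> (q ^ k * fst p powr s + C * snd p powr s)
       + B * ((1 - p0 ^ k) * snd p powr s + p0 ^ k * (real N powr - s) ^ k * fst p powr s)"
    proof (intro add_mono mult_left_mono)
      have "pair_mean k (\<lambda>p. fst p powr s) p \<le> q ^ k * fst p powr s + (\<Sum>j<k. q ^ j) * (2 * real M powr s) * snd p powr s"
        unfolding q_def by (rule pair_mean_fst_le[OF s(1,2) p])
      also have "\<dots> \<le> q ^ k * fst p powr s + C * snd p powr s"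
        using geo by (intro add_left_mono mult_right_mono) auto
      finally show "pair_mean k (\<lambda>p. fst p powr s) p \<le> q ^ k * fst p powr s + C * snd p powr s" .
    qed (use B0 pair_mean_snd_contract[OF s(1) p, of k] in auto)
    also have "\<dots> = (q ^ k + (B * p0 ^ k) * (real N powr - s) ^ k) * fst p powr s + (C + B - B * p0 ^ k) * snd p powr s"
      by (simp add: algebra_simps)
    also have "B * p0 ^ k = 2 * C" using p0_pos by (simp add: B_def)
    also have "C + B - 2 * C = B * (1 - p0 ^ k / 2)" using p0_pos by (simp add: B_def field_simps)
    also have "(q ^ k + 2 * C * (real N powr - s) ^ k) * fst p powr s + B * (1 - p0 ^ k / 2) * snd p powr s
      \<le> \<theta> * fst p powr s + B * \<theta> * snd p powr s"
      using B0 by (intro add_mono mult_right_mono mult_left_mono) (auto simp: \<theta>_def)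
    also have "\<dots> = \<theta> * \<Phi> p" by (simp add: \<Phi>_def algebra_simps)
    finally show ?thesis .
  qed
  have iter: "pair_mean (j * k) \<Phi> p \<le> \<theta> ^ j * \<Phi> p" if p: "admissible p" for j p
  proof (induction j)
    case (Suc j)
    have "pair_mean (Suc j * k) \<Phi> p = pair_mean (j * k) (pair_mean k \<Phi>) p" using pair_mean_add[of "j * k" k \<Phi> p] by (simp add: add.commute)
    also have "\<dots> \<le> pair_mean (j * k) (\<lambda>p. \<theta> * \<Phi> p) p" by (intro pair_mean_mono contract p)
    also have "\<dots> = \<theta> * pair_mean (j * k) \<Phi> p" unfolding pair_mean_def B.avg_cmult ..
    also have "\<dots> \<le> \<theta> * (\<theta> ^ j * \<Phi> p)" using Suc \<theta> by (intro mult_left_mono) auto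
    finally show ?case by (simp add: mult_ac)
  qed simp
  define \<rho> where "\<rho> = \<theta> powr (1 / real k)"
  have \<rho>: "0 < \<rho>" "\<rho> < 1" using \<theta> k powr_less_mono2[of "1 / real k" \<theta> 1] by (auto simp: \<rho>_def)
  have \<rho>k: "\<rho> ^ k = \<theta>" using \<theta> k by (simp add: \<rho>_def powr_realpow[symmetric] powr_powr)
  have pow: "\<theta> ^ (n div k) \<le> \<rho> ^ n / \<theta>" for n
  proof -
    have "\<rho> ^ (k * (n div k)) * \<theta> \<le> \<rho> ^ (k * (n div k)) * \<rho> ^ (n mod k)"
      using \<rho> k unfolding \<rho>k[symmetric] by (intro mult_left_mono power_decreasing) auto
    also have "\<dots> = \<rho> ^ n" by (simp flip: power_add)
    finally show ?thesis using \<theta> by (simp add: power_mult \<rho>k pos_le_divide_eq)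
  qed
  show thesis
  proof (rule that[of "(1 + 1 / B) / \<theta>" \<rho>])
    show "0 < (1 + 1 / B) / \<theta>" using B0 \<theta> by (simp add: add_pos_pos)
    fix n and V :: real assume V: "0 < V"
    have d: "admissible (V, V)" using V by (simp add: admissible_def)
    have "pair_mean n snd (V, V) \<le> Eb n (\<lambda>t. V powr (1 - s) * snd (fold bound_step t (V, V)) powr s)"
      unfolding pair_mean_def
    proof (rule B.avg_mono)
      fix t
      let ?b = "snd (fold bound_step t (V, V))"
      have b: "0 \<le> ?b" "?b \<le> V" using admissible_fold[OF d, of t] snd_fold_le[OF d, of t] by (auto simp: admissible_def)
      show "?b \<le> V powr (1 - s) * ?b powr s"
      proof (cases "?b = 0")
        case False
        have "?b = ?b powr (1 - s) * ?b powr s" using b False by (simp flip: powr_add)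
        also have "\<dots> \<le> V powr (1 - s) * ?b powr s" using b s by (intro mult_right_mono powr_mono2) auto
        finally show ?thesis .
      qed simp
    qed
    also have "\<dots> = V powr (1 - s) * pair_mean n (\<lambda>p. snd p powr s) (V, V)" unfolding pair_mean_def B.avg_cmult ..
    also have "pair_mean n (\<lambda>p. snd p powr s) (V, V) = pair_mean (n div k * k) (pair_mean (n mod k) (\<lambda>p. snd p powr s)) (V, V)"
      by (simp flip: pair_mean_add)
    also have "\<dots> \<le> pair_mean (n div k * k) (\<lambda>p. snd p powr s) (V, V)" by (intro pair_mean_mono pair_mean_snd_le s d)
    also have "\<dots> \<le> pair_mean (n div k * k) (\<lambda>p. 1 / B * \<Phi> p) (V, V)"
      using B0 by (intro pair_mean_mono d) (auto simp: \<Phi>_def field_simps)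
    also have "\<dots> = 1 / B * pair_mean (n div k * k) \<Phi> (V, V)" unfolding pair_mean_def B.avg_cmult ..
    also have "\<dots> \<le> 1 / B * (\<theta> ^ (n div k) * \<Phi> (V, V))" using B0 by (intro mult_left_mono iter d) auto
    also have "\<dots> \<le> 1 / B * (\<rho> ^ n / \<theta> * \<Phi> (V, V))"
      using B0 pow[of n] by (intro mult_left_mono mult_right_mono) (auto simp: \<Phi>_def)
    also have "\<dots> = (1 + 1 / B) / \<theta> * \<rho> ^ n * V powr s" using B0 by (simp add: \<Phi>_def field_simps)
    finally have "pair_mean n snd (V, V) \<le> V powr (1 - s) * ((1 + 1 / B) / \<theta> * \<rho> ^ n * V powr s)"
      by (simp add: mult_left_mono)
    also have "\<dots> = (1 + 1 / B) / \<theta> * \<rho> ^ n * (V powr (1 - s) * V powr s)" by simp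
    also have "V powr (1 - s) * V powr s = V" using V by (simp flip: powr_add)
    finally show "pair_mean n snd (V, V) \<le> (1 + 1 / B) / \<theta> * \<rho> ^ n * V" .
  qed (rule \<rho>)+
qed

end

section \<open>Transfer operators and variation on the circle\<close>

text \<open>
  Functions on the unit interval are represented by functions of period one on the line, so that the circle has no boundary to be treated
  separately.
\<close>

definition regular :: "(real \<Rightarrow> real) \<Rightarrow> bool" where
  "regular h \<longleftrightarrow> h \<in> borel_measurable borel \<and> (\<forall>x. h (x + 1) = h x) \<and> (\<exists>C. \<forall>x. \<bar>h x\<bar> \<le> C)"

lemma regular_measurable: "regular h \<Longrightarrow> h \<in> borel_measurable borel"
  by (simp add: regular_def)

lemma regular_bounded: "regular h \<Longrightarrow> \<exists>C. \<forall>x. \<bar>h x\<bar> \<le> C"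
  by (simp add: regular_def)

lemma regular_integrable:
  assumes h: "regular h" and [measurable]: "f \<in> borel_measurable borel" and "\<And>x. \<bar>f x\<bar> \<le> D"
  shows "integrable lam (\<lambda>x. h x * f x)"
proof -
  obtain C where C: "\<And>x. \<bar>h x\<bar> \<le> C" using regular_bounded[OF h] by blast
  note regular_measurable[OF h, measurable]
  show ?thesis
  proof (rule integrable_lam_bounded)
    show "\<bar>h x * f x\<bar> \<le> C * D" for x
      unfolding abs_mult using C[of x] assms(3)[of x] by (intro mult_mono) auto
  qed measurable
qed

lemma periodic_nat:
  fixes h :: "real \<Rightarrow> real"
  assumes "\<And>x. h (x + 1) = h x" shows "h (x + real n) = h x"
proof (induction n)
  case (Suc n)
  then show ?case using assms[of "x + real n"] by (simp add: add_ac)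
qed simp

lemma periodic_frac:
  fixes h :: "real \<Rightarrow> real"
  assumes p: "\<And>x. h (x + 1) = h x" shows "h (frac x) = h x"
proof (cases "0 \<le> \<lfloor>x\<rfloor>")
  case True
  then have "x = frac x + real (nat \<lfloor>x\<rfloor>)" by (simp add: frac_def)
  then show ?thesis using periodic_nat[of h "frac x" "nat \<lfloor>x\<rfloor>", OF p] by simp
next
  case False
  then have "frac x = x + real (nat (- \<lfloor>x\<rfloor>))" by (simp add: frac_def)
  then show ?thesis using periodic_nat[of h x "nat (- \<lfloor>x\<rfloor>)", OF p] by simp
qed

lemma sum_branches_shift:
  fixes F :: "real \<Rightarrow> real"
  assumes K: "0 < K"
  shows "(\<Sum>k<K. F ((x + 1 + real k) / real K)) = (\<Sum>k<K. F ((x + real k) / real K)) + F (x / real K + 1) - F (x / real K)"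
proof -
  have "(\<Sum>k<K. F ((x + real k) / real K)) + F ((x + real K) / real K) = F (x / real K) + (\<Sum>k<K. F ((x + real (Suc k)) / real K))"
    using sum.lessThan_Suc[of "\<lambda>k. F ((x + real k) / real K)" K] sum.lessThan_Suc_shift[of "\<lambda>k. F ((x + real k) / real K)" K] by simp
  moreover have "(x + real K) / real K = x / real K + 1" using K by (simp add: add_divide_distrib)
  ultimately show ?thesis by (simp add: add_ac)
qed

text \<open>
  The variation over one period is at most \<open>v\<close>. Instead of taking a supremum over partitions, the bound is certified by a monotone
  function \<open>g\<close> that dominates all increments and grows by \<open>v\<close> in each period. Such certificates are easy to transport: the inverse branches of
  the expanding map average them, and a contraction rescales them.
\<close>

definition circle_var :: "(real \<Rightarrow> real) \<Rightarrow> real \<Rightarrow> bool" where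
  "circle_var h v \<longleftrightarrow> h \<in> borel_measurable borel \<and> (\<forall>x. h (x + 1) = h x) \<and>
     (\<exists>g. mono g \<and> (\<forall>x. g (x + 1) = g x + v) \<and> (\<forall>x y. x \<le> y \<longrightarrow> \<bar>h y - h x\<bar> \<le> g y - g x))"

lemma circle_var_diff:
  assumes "circle_var h v" shows "\<bar>h y - h x\<bar> \<le> v"
proof -
  obtain g where g: "\<And>x. g (x + 1) = g x + v" "\<And>x y. x \<le> y \<Longrightarrow> \<bar>h y - h x\<bar> \<le> g y - g x" "mono g"
    and p: "\<And>x. h (x + 1) = h x"
    using assms unfolding circle_var_def by auto
  have "\<bar>h (frac y) - h (frac x)\<bar> \<le> v"
  proof (cases "frac x \<le> frac y")
    case True
    have "frac y \<le> frac x + 1" using frac_lt_1[of y] frac_ge_0[of x] by linarith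
    then have "g (frac y) \<le> g (frac x) + v" using monoD[OF g(3)] g(1) by metis
    then show ?thesis using g(2)[OF True] by simp
  next
    case False
    have "frac x \<le> frac y + 1" using frac_lt_1[of x] frac_ge_0[of y] by linarith
    then have "g (frac x) \<le> g (frac y) + v" using monoD[OF g(3)] g(1) by metis
    then show ?thesis using g(2)[of "frac y" "frac x"] False by simp
  qed
  then show ?thesis using periodic_frac[of h, OF p] by simp
qed

lemma circle_var_nonneg: "circle_var h v \<Longrightarrow> 0 \<le> v"
  using circle_var_diff[of h v 0 0] by simp

lemma circle_var_regular: "circle_var h v \<Longrightarrow> regular h"
proof -
  assume h: "circle_var h v"
  have "\<bar>h x\<bar> \<le> \<bar>h 0\<bar> + v" for x using circle_var_diff[OF h, of x 0] by simp
  then show ?thesis using h unfolding regular_def circle_var_def by blast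
qed

lemma circle_var_sub_const:
  assumes "circle_var h v" shows "circle_var (\<lambda>x. h x - c) v"
proof -
  obtain g where "mono g" "\<forall>x. g (x + 1) = g x + v" "\<forall>x y. x \<le> y \<longrightarrow> \<bar>h y - h x\<bar> \<le> g y - g x"
    using assms(1) unfolding circle_var_def by auto
  then show ?thesis using assms unfolding circle_var_def by (auto intro!: exI[of _ g])
qed

lemma circle_var_le_mean:
  assumes h: "circle_var h v"
  shows "\<bar>h x - (\<integral>y. h y \<partial>lam)\<bar> \<le> v"
proof -
  have r: "regular h" by (rule circle_var_regular[OF h])
  have i: "integrable lam h" using regular_integrable[OF r, of "\<lambda>_. 1" 1] by simp
  have "(\<integral>y. h y \<partial>lam) \<le> (\<integral>y. h x + v \<partial>lam)"
  proof (rule integral_lam_mono)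
    show "h y \<le> h x + v" for y using circle_var_diff[OF h, of y x] by simp
  qed (use i in auto)
  moreover have "(\<integral>y. h x - v \<partial>lam) \<le> (\<integral>y. h y \<partial>lam)"
  proof (rule integral_lam_mono)
    show "h x - v \<le> h y" for y using circle_var_diff[OF h, of y x] by simp
  qed (use i in auto)
  ultimately show ?thesis by simp
qed

text \<open>
  Functions that are given on the unit interval and extended periodically. The first two bounds control the jumps from and to zero at the
  two ends of the interval.
\<close>

lemma circle_var_from_unit:
  fixes H G :: "real \<Rightarrow> real"
  assumes [measurable]: "H \<in> borel_measurable borel"
    and A: "\<And>u. \<bar>H u\<bar> \<le> G u" and B: "\<And>u. \<bar>H u\<bar> \<le> W - G u"
    and C: "\<And>u u'. u \<le> u' \<Longrightarrow> \<bar>H u' - H u\<bar> \<le> G u' - G u"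
  shows "circle_var (\<lambda>x. H (frac x)) W"
proof -
  have W0: "0 \<le> W" using A[of 0] B[of 0] by linarith
  have frac1: "frac (x + 1) = frac x" for x :: real by (simp add: frac_def)
  let ?g = "\<lambda>x. G (frac x) + real_of_int \<lfloor>x\<rfloor> * W"
  have key: "\<bar>H (frac y) - H (frac x)\<bar> \<le> ?g y - ?g x" if "x \<le> y" for x y
  proof (cases "\<lfloor>x\<rfloor> = \<lfloor>y\<rfloor>")
    case True
    then have "frac x \<le> frac y" using that by (simp add: frac_def)
    then show ?thesis using C[of "frac x" "frac y"] True by simp
  next
    case False
    then have "\<lfloor>x\<rfloor> + 1 \<le> \<lfloor>y\<rfloor>" using floor_mono[OF that] by simp
    then have "(real_of_int \<lfloor>x\<rfloor> + 1) * W \<le> real_of_int \<lfloor>y\<rfloor> * W" using W0 by (intro mult_right_mono) linarith+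
    then show ?thesis using A[of "frac y"] B[of "frac x"] by (simp add: algebra_simps)
  qed
  have "mono ?g" using key by (intro monoI) (smt (verit))
  then show ?thesis
    using key frac1 unfolding circle_var_def by (intro conjI exI[of _ ?g]) (auto simp: algebra_simps)
qed

lemma circle_var_times:
  assumes f: "circle_var f u" and g: "circle_var g v" and bd: "\<And>x. \<bar>f x\<bar> \<le> A" "\<And>x. \<bar>g x\<bar> \<le> B"
  shows "circle_var (\<lambda>x. f x * g x) (A * v + B * u)"
proof -
  obtain F where F: "mono F" "\<forall>x. F (x + 1) = F x + u" "\<And>x y. x \<le> y \<Longrightarrow> \<bar>f y - f x\<bar> \<le> F y - F x"
    using f unfolding circle_var_def by auto
  obtain G where G: "mono G" "\<forall>x. G (x + 1) = G x + v" "\<And>x y. x \<le> y \<Longrightarrow> \<bar>g y - g x\<bar> \<le> G y - G x"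
    using g unfolding circle_var_def by auto
  have AB: "0 \<le> A" "0 \<le> B" using bd[of 0] by auto
  let ?g = "\<lambda>x. A * G x + B * F x"
  have "\<bar>f y * g y - f x * g x\<bar> \<le> ?g y - ?g x" if "x \<le> y" for x y
  proof -
    have "f y * g y - f x * g x = f y * (g y - g x) + g x * (f y - f x)" by (simp add: algebra_simps)
    also have "\<bar>\<dots>\<bar> \<le> \<bar>f y\<bar> * \<bar>g y - g x\<bar> + \<bar>g x\<bar> * \<bar>f y - f x\<bar>"
      by (rule order_trans[OF abs_triangle_ineq]) (simp add: abs_mult)
    also have "\<dots> \<le> A * (G y - G x) + B * (F y - F x)"
      using bd AB F(3)[OF that] G(3)[OF that] by (intro add_mono mult_mono) auto
    finally show ?thesis by (simp add: algebra_simps)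
  qed
  moreover have "mono ?g" using F(1) G(1) AB by (intro monoI add_mono mult_left_mono) (auto dest: monoD)
  ultimately show ?thesis
    using f g F(2) G(2) unfolding circle_var_def by (intro conjI exI[of _ ?g]) (auto simp: algebra_simps)
qed

context random_maps begin

text \<open>
  The transfer operators describe how the density of a random point changes: averaging over the inverse branches for the expanding
  map, and concentration on one of \<open>M\<close> subintervals for a contraction.
\<close>

definition transfer :: "nat \<Rightarrow> (real \<Rightarrow> real) \<Rightarrow> real \<Rightarrow> real" where
  "transfer a h x = (if a = 0 then (\<Sum>k<N. h ((x + real k) / real N)) / real N
     else if real a - 1 \<le> real M * frac x \<and> real M * frac x < real a then real M * h (real M * x) else 0)"

lemma transfer_periodic:
  assumes "\<And>x. h (x + 1) = h x" shows "transfer a h (x + 1) = transfer a h x"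
proof -
  have "real M * (x + 1) = real M * x + real M" by (simp add: algebra_simps)
  moreover have "frac (x + 1) = frac x" by (simp add: frac_def)
  ultimately show ?thesis using periodic_nat[of h, OF assms]
    by (simp add: transfer_def sum_branches_shift[OF N_pos] assms)
qed

lemma transfer_measurable [measurable]:
  assumes [measurable]: "h \<in> borel_measurable borel" shows "transfer a h \<in> borel_measurable borel"
  unfolding transfer_def by (cases "a = 0") auto

lemma transfer_bounded:
  assumes C: "\<And>x. \<bar>h x\<bar> \<le> C" shows "\<bar>transfer a h x\<bar> \<le> real M * C"
proof (cases "a = 0")
  case True
  have C0: "0 \<le> C" using C[of 0] by simp
  have "\<bar>transfer a h x\<bar> \<le> (\<Sum>k<N. \<bar>h ((x + real k) / real N)\<bar>) / real N"
    using True by (simp add: transfer_def divide_right_mono)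
  also have "\<dots> \<le> (\<Sum>k<N. C) / real N" by (intro divide_right_mono sum_mono C) auto
  also have "\<dots> = C" using N_pos by simp
  also have "\<dots> \<le> real M * C" using M2 mult_right_mono[OF _ C0, of 1 "real M"] by simp
  finally show ?thesis .
next
  case False
  have C0: "0 \<le> C" using C[of 0] by simp
  show ?thesis using False C0 C[of "real M * x"] by (auto simp: transfer_def abs_mult intro: mult_left_mono)
qed

lemma regular_transfer: "regular h \<Longrightarrow> regular (transfer a h)"
  using transfer_bounded transfer_periodic transfer_measurable unfolding regular_def by metis

lemma integral_transfer:
  assumes h: "regular h" and [measurable]: "\<phi> \<in> borel_measurable borel" and bd: "\<And>x. \<bar>\<phi> x\<bar> \<le> D" and a: "a \<le> M"
  shows "(\<integral>x. h x * \<phi> (gen_map M N a x) \<partial>lam) = (\<integral>x. transfer a h x * \<phi> x \<partial>lam)"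
proof -
  obtain C where C: "\<And>x. \<bar>h x\<bar> \<le> C" using regular_bounded[OF h] by blast
  note [measurable] = regular_measurable[OF h]
  have p: "h (x + 1) = h x" for x using h by (simp add: regular_def)
  show ?thesis
  proof (cases "a = 0")
    case True
    have "(\<integral>x. h x * \<phi> (gen_map M N 0 x) \<partial>lam)
      = (\<Sum>k<N. \<integral>s. h ((s + real k) / real N) * \<phi> (gen_map M N 0 ((s + real k) / real N)) \<partial>lam) / real N"
    proof (rule integral_lam_branches[OF N_pos])
      show "\<bar>h x * \<phi> (gen_map M N 0 x)\<bar> \<le> C * D" for x
        unfolding abs_mult using C[of x] bd[of "gen_map M N 0 x"] by (intro mult_mono) auto
    qed measurable
    also have "\<dots> = (\<Sum>k<N. \<integral>s. h ((s + real k) / real N) * \<phi> s \<partial>lam) / real N"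
    proof (intro arg_cong2[where f="(/)"] sum.cong refl integral_lam_cong)
      fix s :: real and k :: nat assume "0 \<le> s" "s < 1"
      then have "frac (s + real k) = s" by (simp add: frac_unique_iff)
      then show "h ((s + real k) / real N) * \<phi> (gen_map M N 0 ((s + real k) / real N)) = h ((s + real k) / real N) * \<phi> s"
        using N_pos by (simp add: gen_map_def)
    qed measurable
    also have "(\<Sum>k<N. \<integral>s. h ((s + real k) / real N) * \<phi> s \<partial>lam) = (\<integral>s. (\<Sum>k<N. h ((s + real k) / real N) * \<phi> s) \<partial>lam)"
    proof (rule Bochner_Integration.integral_sum[symmetric])
      fix k
      show "integrable lam (\<lambda>s. h ((s + real k) / real N) * \<phi> s)"
      proof (rule integrable_lam_bounded)
        show "\<bar>h ((s + real k) / real N) * \<phi> s\<bar> \<le> C * D" for s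
          unfolding abs_mult using C[of "(s + real k) / real N"] bd[of s] by (intro mult_mono) auto
      qed measurable
    qed
    also have "(\<integral>s. (\<Sum>k<N. h ((s + real k) / real N) * \<phi> s) \<partial>lam) / real N
      = (\<integral>s. (\<Sum>k<N. h ((s + real k) / real N) * \<phi> s) / real N \<partial>lam)" by simp
    also have "\<dots> = (\<integral>s. transfer 0 h s * \<phi> s \<partial>lam)"
      by (intro Bochner_Integration.integral_cong refl) (simp add: transfer_def sum_distrib_right)
    finally show ?thesis unfolding True .
  next
    case False
    have "(\<integral>x. transfer a h x * \<phi> x \<partial>lam)
      = (\<Sum>k<M. \<integral>s. transfer a h ((s + real k) / real M) * \<phi> ((s + real k) / real M) \<partial>lam) / real M"
    proof (rule integral_lam_branches[OF M_pos])
      show "\<bar>transfer a h x * \<phi> x\<bar> \<le> (real M * C) * D" for x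
        unfolding abs_mult using transfer_bounded[of h C a x, OF C] bd[of x] by (intro mult_mono) auto
    qed measurable
    also have "\<dots> = (\<Sum>k<M. if k = a - 1 then \<integral>s. real M * (h s * \<phi> (gen_map M N a s)) \<partial>lam else 0) / real M"
    proof (intro arg_cong2[where f="(/)"] sum.cong refl)
      fix k assume k: "k \<in> {..<M}"
      have fr: "frac ((s + real k) / real M) = (s + real k) / real M" if "0 \<le> s" "s < 1" for s
      proof -
        have "s + real k < real M" using that k by (simp add: nat_less_real_le)
        then show ?thesis using that M_pos by (simp add: frac_eq)
      qed
      have hk: "h (s + real k) = h s" for s using periodic_nat[of h, OF p] .
      show "(\<integral>s. transfer a h ((s + real k) / real M) * \<phi> ((s + real k) / real M) \<partial>lam)
        = (if k = a - 1 then \<integral>s. real M * (h s * \<phi> (gen_map M N a s)) \<partial>lam else 0)"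
      proof (cases "k = a - 1")
        case True
        have ka: "real k = real a - 1" using True False by simp
        have "(\<integral>s. transfer a h ((s + real k) / real M) * \<phi> ((s + real k) / real M) \<partial>lam)
          = (\<integral>s. real M * (h s * \<phi> (gen_map M N a s)) \<partial>lam)"
        proof (rule integral_lam_cong)
          fix s :: real assume s: "0 \<le> s" "s < 1"
          have "transfer a h ((s + real k) / real M) = real M * h (s + real k)"
            using False M_pos s fr[OF s] ka by (simp add: transfer_def)
          show "transfer a h ((s + real k) / real M) * \<phi> ((s + real k) / real M) = real M * (h s * \<phi> (gen_map M N a s))"
          proof -
            have gm: "gen_map M N a s = (s + real k) / real M" using False ka by (simp add: gen_map_def)
            show ?thesis by (simp only: gm hk \<open>transfer a h ((s + real k) / real M) = real M * h (s + real k)\<close> mult.assoc)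
          qed
        qed measurable
        then show ?thesis using True by simp
      next
        case ne: False
        have "(\<integral>s. transfer a h ((s + real k) / real M) * \<phi> ((s + real k) / real M) \<partial>lam) = (\<integral>s. 0 \<partial>lam)"
        proof (rule integral_lam_cong)
          fix s :: real assume s: "0 \<le> s" "s < 1"
          have "\<not> (real a - 1 \<le> s + real k \<and> s + real k < real a)"
          proof
            assume *: "real a - 1 \<le> s + real k \<and> s + real k < real a"
            then have "real a < real k + 2" "real k < real a" using s by linarith+
            then have "k = a - 1" by linarith
            with ne show False by simp
          qed
          then have "transfer a h ((s + real k) / real M) = 0"
            using False M_pos fr[OF s] by (auto simp: transfer_def)
          then show "transfer a h ((s + real k) / real M) * \<phi> ((s + real k) / real M) = 0" by simp
        qed measurable
        then show ?thesis using ne by simp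
      qed
    qed
    also have "\<dots> = (\<integral>s. real M * (h s * \<phi> (gen_map M N a s)) \<partial>lam) / real M"
      using False a by (simp add: sum.delta)
    finally show ?thesis using M_pos by simp
  qed
qed

definition wtransfer :: "nat list \<Rightarrow> (real \<Rightarrow> real) \<Rightarrow> real \<Rightarrow> real" where
  "wtransfer = fold transfer"

lemma wtransfer_simps [simp]: "wtransfer [] h = h" "wtransfer (a # w) h = wtransfer w (transfer a h)"
  "wtransfer (u @ w) h = wtransfer w (wtransfer u h)"
  by (auto simp: wtransfer_def)

lemma regular_wtransfer: "regular h \<Longrightarrow> regular (wtransfer w h)"
  by (induction w arbitrary: h) (auto intro: regular_transfer)

lemma integral_wtransfer:
  assumes "regular h" and [measurable]: "\<phi> \<in> borel_measurable borel" and bd: "\<And>x. \<bar>\<phi> x\<bar> \<le> D" and "set w \<subseteq> {0..M}"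
  shows "(\<integral>x. h x * \<phi> (act w x) \<partial>lam) = (\<integral>x. wtransfer w h x * \<phi> x \<partial>lam)"
  using assms(1,4)
proof (induction w arbitrary: h)
  case (Cons a w)
  have "(\<integral>x. h x * \<phi> (act (a # w) x) \<partial>lam) = (\<integral>x. h x * (\<lambda>x. \<phi> (act w x)) (gen_map M N a x) \<partial>lam)" by simp
  also have "\<dots> = (\<integral>x. transfer a h x * \<phi> (act w x) \<partial>lam)"
    using Cons.prems bd by (intro integral_transfer) auto
  finally show ?case using Cons.IH[OF regular_transfer[OF Cons.prems(1)]] Cons.prems by simp
qed simp

text \<open>
  Duality with the sign of the transferred function as the test function.
\<close>

lemma integral_abs_wtransfer_le:
  assumes h: "regular h" and w: "set w \<subseteq> {0..M}"
  shows "(\<integral>x. \<bar>wtransfer w h x\<bar> \<partial>lam) \<le> (\<integral>x. \<bar>h x\<bar> \<partial>lam)"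
proof -
  have [measurable]: "wtransfer w h \<in> borel_measurable borel" "h \<in> borel_measurable borel"
    using regular_wtransfer[OF h] h by (auto simp: regular_def)
  have "(\<integral>x. \<bar>wtransfer w h x\<bar> \<partial>lam) = (\<integral>x. wtransfer w h x * sgn (wtransfer w h x) \<partial>lam)"
    by (simp add: abs_sgn)
  also have "\<dots> = (\<integral>x. h x * sgn (wtransfer w h (act w x)) \<partial>lam)"
    by (rule integral_wtransfer[OF h _ _ w, where D=1, symmetric]) (auto simp: sgn_if)
  also have "\<dots> \<le> (\<integral>x. \<bar>h x\<bar> \<partial>lam)"
  proof (rule integral_lam_mono)
    show "integrable lam (\<lambda>x. h x * sgn (wtransfer w h (act w x)))"
      by (rule regular_integrable[OF h, where D=1]) (auto simp: sgn_if)
    show "integrable lam (\<lambda>x. \<bar>h x\<bar>)" using regular_integrable[OF h, of "\<lambda>_. 1" 1] by simp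
    show "h x * sgn (wtransfer w h (act w x)) \<le> \<bar>h x\<bar>" for x by (auto simp: sgn_if)
  qed
  finally show ?thesis .
qed

lemma integral_wtransfer_1: "regular h \<Longrightarrow> set w \<subseteq> {0..M} \<Longrightarrow> (\<integral>x. wtransfer w h x \<partial>lam) = (\<integral>x. h x \<partial>lam)"
  using integral_wtransfer[of h "\<lambda>_. 1" 1 w] by simp

lemma circle_var_transfer_0:
  assumes "circle_var h v" shows "circle_var (transfer 0 h) (v / real N)"
proof -
  obtain g where g: "mono g" "\<And>x. g (x + 1) = g x + v" "\<And>x y. x \<le> y \<Longrightarrow> \<bar>h y - h x\<bar> \<le> g y - g x"
    and p: "\<And>x. h (x + 1) = h x" and [measurable]: "h \<in> borel_measurable borel"
    using assms unfolding circle_var_def by auto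
  let ?g = "\<lambda>x. (\<Sum>k<N. g ((x + real k) / real N)) / real N"
  have "mono ?g"
    using N_pos by (intro monoI divide_right_mono sum_mono monoD[OF g(1)]) auto
  moreover have "?g (x + 1) = ?g x + v / real N" for x
    unfolding sum_branches_shift[OF N_pos] by (simp add: g(2) add_divide_distrib)
  moreover have "\<bar>transfer 0 h y - transfer 0 h x\<bar> \<le> ?g y - ?g x" if "x \<le> y" for x y
  proof -
    have "\<bar>transfer 0 h y - transfer 0 h x\<bar> = \<bar>\<Sum>k<N. h ((y + real k) / real N) - h ((x + real k) / real N)\<bar> / real N"
      by (simp add: transfer_def sum_subtractf flip: diff_divide_distrib)
    also have "\<dots> \<le> (\<Sum>k<N. g ((y + real k) / real N) - g ((x + real k) / real N)) / real N"
      using that by (intro divide_right_mono order_trans[OF sum_abs] sum_mono g(3)) auto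
    also have "\<dots> = ?g y - ?g x" by (simp add: sum_subtractf diff_divide_distrib)
    finally show ?thesis .
  qed
  ultimately show ?thesis using transfer_periodic[of h 0, OF p] unfolding circle_var_def by (intro conjI exI[of _ ?g]) auto
qed

text \<open>
  The transferred function is a copy of \<open>h\<close>, compressed and multiplied by \<open>M\<close>, which vanishes outside one subinterval. Opening the circle at the
  point \<open>0\<close> costs one jump of height \<open>\<bar>h 0\<bar>\<close> at each end.
\<close>

lemma circle_var_transfer_digit:
  assumes h: "circle_var h v" and i: "i \<in> {1..M}"
  shows "circle_var (transfer i h) (real M * (v + 2 * \<bar>h 0\<bar>))"
proof -
  obtain g where g: "mono g" "\<And>x. g (x + 1) = g x + v" "\<And>x y. x \<le> y \<Longrightarrow> \<bar>h y - h x\<bar> \<le> g y - g x"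
    and p: "\<And>x. h (x + 1) = h x" and [measurable]: "h \<in> borel_measurable borel"
    using h unfolding circle_var_def by auto
  have v0: "0 \<le> v" by (rule circle_var_nonneg[OF h])
  define W where "W = v + 2 * \<bar>h 0\<bar>"
  have W0: "0 \<le> W" using v0 by (simp add: W_def)
  define lo where "lo u \<longleftrightarrow> real M * u < real i - 1" for u
  define mid where "mid u \<longleftrightarrow> real i - 1 \<le> real M * u \<and> real M * u < real i" for u
  define s where "s u = real M * u - (real i - 1)" for u
  define G where "G u = (if lo u then 0 else if mid u then \<bar>h 0\<bar> + g (s u) - g 0 else W)" for u
  define H where "H u = (if mid u then h (s u) else 0)" for u
  have s: "0 \<le> s u" "s u < 1" if "mid u" for u using that by (auto simp: mid_def s_def)
  have g1: "g 1 = g 0 + v" using g(2)[of 0] by simp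
  have h1: "h 1 = h 0" using p[of 0] by simp
  have A: "\<bar>H u\<bar> \<le> G u" for u
  proof (cases "mid u")
    case True
    then have "\<not> lo u" by (auto simp: mid_def lo_def)
    then show ?thesis using True g(3)[OF s(1)[OF True]] by (simp add: H_def G_def)
  next
    case False
    then show ?thesis using W0 by (simp add: H_def G_def)
  qed
  have B: "\<bar>H u\<bar> \<le> W - G u" for u
  proof (cases "mid u")
    case True
    then have "\<not> lo u" by (auto simp: mid_def lo_def)
    then show ?thesis using True g(3)[of "s u" 1] s[OF True] by (simp add: H_def G_def W_def g1 h1)
  next
    case False
    then show ?thesis using W0 by (simp add: H_def G_def)
  qed
  have G0: "0 \<le> G u" "G u \<le> W" for u using A[of u] B[of u] by auto
  have C: "\<bar>H u' - H u\<bar> \<le> G u' - G u" if "u \<le> u'" for u u'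
  proof -
    have Mu: "real M * u \<le> real M * u'" using that by (intro mult_left_mono) auto
    consider "mid u" "mid u'" | "mid u" "\<not> mid u'" | "\<not> mid u" by blast
    then show ?thesis
    proof cases
      case 1
      then have "\<not> lo u" "\<not> lo u'" by (auto simp: mid_def lo_def)
      moreover have "\<bar>h (s u') - h (s u)\<bar> \<le> g (s u') - g (s u)" using Mu by (intro g(3)) (simp add: s_def)
      ultimately show ?thesis using 1 by (simp add: H_def G_def)
    next
      case 2
      then have "\<not> lo u'" using Mu by (auto simp: mid_def lo_def)
      then show ?thesis using 2 B[of u] by (simp add: H_def G_def)
    next
      case 3
      show ?thesis
      proof (cases "lo u")
        case True
        then show ?thesis using 3 A[of u'] by (simp add: H_def G_def)
      next
        case False
        then have "\<not> lo u'" "\<not> mid u'" using 3 Mu by (auto simp: mid_def lo_def)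
        then show ?thesis using 3 False by (simp add: H_def G_def)
      qed
    qed
  qed
  have T: "transfer i h x = real M * H (frac x)" for x
  proof -
    have "h (real M * x) = h (frac (real M * x))" using periodic_frac[of h, OF p] by simp
    also have "frac (real M * x) = frac (s (frac x))"
    proof -
      have "real M * x = s (frac x) + real_of_int (int M * \<lfloor>x\<rfloor> + (int i - 1))"
        by (simp add: s_def frac_def algebra_simps)
      moreover have "frac (u + real_of_int m) = frac u" for u m by (simp add: frac_def)
      ultimately show ?thesis by metis
    qed
    also have "h (frac (s (frac x))) = h (s (frac x))" using periodic_frac[of h, OF p] .
    finally show ?thesis using i by (simp add: transfer_def H_def mid_def)
  qed
  have "circle_var (\<lambda>x. (real M * H (frac x))) (real M * W)"
  proof (rule circle_var_from_unit[where G="\<lambda>u. real M * G u"])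
    show "(\<lambda>u. real M * H u) \<in> borel_measurable borel"
      unfolding H_def mid_def s_def by measurable
    show "\<bar>real M * H u\<bar> \<le> real M * G u" for u
      using A[of u] by (simp add: abs_mult mult_left_mono)
    show "\<bar>real M * H u\<bar> \<le> real M * W - real M * G u" for u
      using mult_left_mono[OF B[of u], of "real M"] by (simp add: abs_mult right_diff_distrib)
    show "\<bar>real M * H u' - real M * H u\<bar> \<le> real M * G u' - real M * G u" if "u \<le> u'" for u u'
      using mult_left_mono[OF C[OF that], of "real M"] by (simp add: abs_mult flip: right_diff_distrib)
  qed
  moreover have "transfer i h = (\<lambda>x. real M * H (frac x))" using T by auto
  ultimately show ?thesis unfolding W_def by simp
qed

text \<open>
  Exactly one subinterval contains a given point. The mean over the digits therefore has no factor \<open>M\<close>, which keeps the mean modulus bounded.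
\<close>

lemma sum_transfer_digits:
  shows "(\<Sum>i\<in>{1..M}. \<bar>transfer i h x\<bar>) / real M = \<bar>h (real M * x)\<bar>"
    and "(\<Sum>i\<in>{1..M}. transfer i h x) / real M = h (real M * x)"
proof -
  define j where "j = nat \<lfloor>real M * frac x\<rfloor> + 1"
  have "0 \<le> real M * frac x" by simp
  then have j: "real j - 1 \<le> real M * frac x" "real M * frac x < real j" unfolding j_def by linarith+
  have "real M * frac x < real M * 1" using frac_lt_1[of x] M_pos by (intro mult_strict_left_mono) auto
  then have "real j < real M + 1" using j by linarith
  then have "j \<le> M" by linarith
  moreover have "1 \<le> j" by (simp add: j_def)
  ultimately have jM: "j \<in> {1..M}" by simp
  have T: "transfer i h x = (if i = j then real M * h (real M * x) else 0)" if "i \<in> {1..M}" for i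
  proof -
    have "real i - 1 \<le> real M * frac x \<and> real M * frac x < real i \<longleftrightarrow> i = j" using j by linarith
    then show ?thesis using that by (simp add: transfer_def)
  qed
  have "(\<Sum>i\<in>{1..M}. \<bar>transfer i h x\<bar>) = (\<Sum>i\<in>{1..M}. if i = j then \<bar>real M * h (real M * x)\<bar> else 0)"
    by (rule sum.cong) (auto simp: T)
  then show "(\<Sum>i\<in>{1..M}. \<bar>transfer i h x\<bar>) / real M = \<bar>h (real M * x)\<bar>"
    using jM M_pos by (simp add: abs_mult)
  have "(\<Sum>i\<in>{1..M}. transfer i h x) = (\<Sum>i\<in>{1..M}. if i = j then real M * h (real M * x) else 0)"
    by (rule sum.cong) (auto simp: T)
  then show "(\<Sum>i\<in>{1..M}. transfer i h x) / real M = h (real M * x)"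
    using jM M_pos by simp
qed


section \<open>Exponential mixing of the transferred functions\<close>

text \<open>
  The second component is an upper bound of the variation that is computed along the word.
\<close>

definition vstep :: "nat \<Rightarrow> (real \<Rightarrow> real) \<times> real \<Rightarrow> (real \<Rightarrow> real) \<times> real" where
  "vstep a p = (transfer a (fst p), if a = 0 then snd p / real N else real M * (snd p + 2 * \<bar>fst p 0\<bar>))"

definition var_bound :: "nat list \<Rightarrow> (real \<Rightarrow> real) \<Rightarrow> real \<Rightarrow> real" where
  "var_bound w h v = snd (fold vstep w (h, v))"

lemma fst_fold_vstep: "fst (fold vstep w p) = wtransfer w (fst p)"
  by (induction w arbitrary: p) (auto simp: vstep_def)

lemma var_bound_simps [simp]:
  "var_bound [] h v = v"
  "var_bound (w @ [0]) h v = var_bound w h v / real N"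
  "i \<noteq> 0 \<Longrightarrow> var_bound (w @ [i]) h v = real M * (var_bound w h v + 2 * \<bar>wtransfer w h 0\<bar>)"
  by (auto simp: var_bound_def vstep_def fst_fold_vstep)

lemma circle_var_wtransfer:
  assumes "circle_var h v" "set w \<subseteq> {0..M}"
  shows "circle_var (wtransfer w h) (var_bound w h v)"
  using assms(2)
proof (induction w rule: rev_induct)
  case (snoc a w)
  then have cv: "circle_var (wtransfer w h) (var_bound w h v)" by simp
  show ?case
  proof (cases "a = 0")
    case True
    then show ?thesis using circle_var_transfer_0[OF cv] by simp
  next
    case False
    then show ?thesis using circle_var_transfer_digit[OF cv, of a] snoc.prems by simp
  qed
qed (simp add: assms)

lemma average_digits_le:
  fixes f :: "nat \<Rightarrow> real"
  assumes "\<And>i. i \<in> {1..M} \<Longrightarrow> f i \<le> c" shows "(\<Sum>i\<in>{1..M}. f i) / real M \<le> c"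
proof -
  have "(\<Sum>i\<in>{1..M}. f i) \<le> (\<Sum>i\<in>{1..M}. c)" by (rule sum_mono) (rule assms)
  then show ?thesis using M_pos by (simp add: field_simps)
qed

text \<open>
  Taking means over the digits, with the types given, is essential: the new jumps have the height \<open>\<bar>h 0\<bar>\<close>, which can be large
  for particular digits, but whose mean does not increase.
\<close>

lemma Et_transfer_bounds:
  assumes h: "circle_var h V" and int0: "(\<integral>x. h x \<partial>lam) = 0"
  shows "Et t (\<lambda>w. var_bound w h V) \<le> fst (fold bound_step t (V, V))
    \<and> (\<forall>x. Et t (\<lambda>w. \<bar>wtransfer w h x\<bar>) \<le> snd (fold bound_step t (V, V)))
    \<and> Et t (\<lambda>w. \<integral>x. \<bar>wtransfer w h x\<bar> \<partial>lam) \<le> snd (fold bound_step t (V, V))"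
proof (induction t rule: rev_induct)
  case Nil
  have r: "regular h" by (rule circle_var_regular[OF h])
  have hx: "\<bar>h x\<bar> \<le> V" for x using circle_var_le_mean[OF h, of x] int0 by simp
  have "(\<integral>x. \<bar>h x\<bar> \<partial>lam) \<le> (\<integral>x. V \<partial>lam)"
  proof (rule integral_lam_mono)
    show "integrable lam (\<lambda>x. \<bar>h x\<bar>)" using regular_integrable[OF r, of "\<lambda>_. 1" 1] by simp
  qed (use hx in auto)
  then show ?case using hx by simp
next
  case (snoc z t)
  have h_reg: "regular h" by (rule circle_var_regular[OF h])
  define v where "v = fst (fold bound_step t (V, V))"
  define b where "b = snd (fold bound_step t (V, V))"
  have p: "fold bound_step t (V, V) = (v, b)" by (simp add: v_def b_def)
  have IH: "Et t (\<lambda>w. var_bound w h V) \<le> v" "\<And>x. Et t (\<lambda>w. \<bar>wtransfer w h x\<bar>) \<le> b"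
    "Et t (\<lambda>w. \<integral>x. \<bar>wtransfer w h x\<bar> \<partial>lam) \<le> b"
    using snoc.IH by (auto simp: v_def b_def)
  have cvw: "circle_var (wtransfer w h) (var_bound w h V)" and int: "(\<integral>x. wtransfer w h x \<partial>lam) = 0"
    and reg: "regular (wtransfer w h)" if "set w \<subseteq> {0..M}" for w
    using circle_var_wtransfer[OF h that] integral_wtransfer_1[OF h_reg that] int0 regular_wtransfer[OF h_reg] by auto
  have l1: "(\<integral>x. \<bar>transfer a (wtransfer w h) x\<bar> \<partial>lam) \<le> (\<integral>x. \<bar>wtransfer w h x\<bar> \<partial>lam)"
    if "set w \<subseteq> {0..M}" "a \<le> M" for w a
    using integral_abs_wtransfer_le[OF reg[OF that(1)], of "[a]"] that by simp
  show ?case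
  proof (cases z)
    case True
    have tp: "fold bound_step (t @ [z]) (V, V) = (v / real N, min b (v / real N))" using True by (simp add: p bound_step_def)
    have E: "Et (t @ [z]) F = Et t (\<lambda>w. F (w @ [0]))" for F using True by (simp add: Et_snoc)
    have vN: "Et t (\<lambda>w. var_bound w h V / real N) \<le> v / real N"
      unfolding Et_divide using IH(1) by (rule divide_right_mono) simp
    have sup: "\<bar>transfer 0 (wtransfer w h) x\<bar> \<le> var_bound w h V / real N" if w: "set w \<subseteq> {0..M}" for w x
    proof -
      have cv: "circle_var (wtransfer (w @ [0]) h) (var_bound (w @ [0]) h V)"
        using w by (intro circle_var_wtransfer[OF h]) auto
      have "set (w @ [0]) \<subseteq> {0..M}" using w by simp
      from integral_wtransfer_1[OF h_reg this] circle_var_le_mean[OF cv, of x] int0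
      show ?thesis by simp
    qed
    have "Et t (\<lambda>w. \<bar>transfer 0 (wtransfer w h) x\<bar>) \<le> b" for x
    proof -
      have "Et t (\<lambda>w. \<bar>transfer 0 (wtransfer w h) x\<bar>) \<le> Et t (\<lambda>w. (\<Sum>k<N. \<bar>wtransfer w h ((x + real k) / real N)\<bar>) / real N)"
        by (rule Et_mono) (simp add: transfer_def divide_right_mono)
      also have "\<dots> = (\<Sum>k<N. Et t (\<lambda>w. \<bar>wtransfer w h ((x + real k) / real N)\<bar>)) / real N"
        by (simp add: Et_divide Et_sum)
      also have "\<dots> \<le> (\<Sum>k<N. b) / real N" by (intro divide_right_mono sum_mono IH) auto
      finally show ?thesis using N_pos by simp
    qed
    moreover have "Et t (\<lambda>w. \<bar>transfer 0 (wtransfer w h) x\<bar>) \<le> v / real N" for x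
      by (rule order_trans[OF Et_mono vN]) (rule sup)
    moreover have "Et t (\<lambda>w. \<integral>x. \<bar>transfer 0 (wtransfer w h) x\<bar> \<partial>lam) \<le> b"
      by (rule order_trans[OF Et_mono IH(3)]) (rule l1, auto)
    moreover have "Et t (\<lambda>w. \<integral>x. \<bar>transfer 0 (wtransfer w h) x\<bar> \<partial>lam) \<le> v / real N"
    proof (rule order_trans[OF Et_mono vN])
      fix w assume w: "set w \<subseteq> {0..M}"
      have "(\<integral>x. \<bar>transfer 0 (wtransfer w h) x\<bar> \<partial>lam) \<le> (\<integral>x. var_bound w h V / real N \<partial>lam)"
      proof (rule integral_lam_mono)
        show "integrable lam (\<lambda>x. \<bar>transfer 0 (wtransfer w h) x\<bar>)"
          using regular_integrable[OF regular_transfer[OF reg[OF w]], of "\<lambda>_. 1" 1] by simp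
      qed (use sup[OF w] in auto)
      then show "(\<integral>x. \<bar>transfer 0 (wtransfer w h) x\<bar> \<partial>lam) \<le> var_bound w h V / real N" by simp
    qed
    ultimately show ?thesis unfolding E tp using vN by simp
  next
    case False
    have tp: "fold bound_step (t @ [z]) (V, V) = (real M * (v + 2 * b), b)" using False by (simp add: p bound_step_def)
    have E: "Et (t @ [z]) F = Et t (\<lambda>w. (\<Sum>i\<in>{1..M}. F (w @ [i])) / real M)" for F using False by (simp add: Et_snoc)
    have "Et t (\<lambda>w. (\<Sum>i\<in>{1..M}. var_bound (w @ [i]) h V) / real M)
        \<le> Et t (\<lambda>w. real M * (var_bound w h V + 2 * \<bar>wtransfer w h 0\<bar>))"
      by (intro Et_mono average_digits_le) simp
    also have "\<dots> = real M * (Et t (\<lambda>w. var_bound w h V) + 2 * Et t (\<lambda>w. \<bar>wtransfer w h 0\<bar>))"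
      unfolding Et_cmult Et_add ..
    also have "\<dots> \<le> real M * (v + 2 * b)" by (intro mult_left_mono add_mono IH) auto
    finally have 1: "Et t (\<lambda>w. (\<Sum>i\<in>{1..M}. var_bound (w @ [i]) h V) / real M) \<le> real M * (v + 2 * b)" .
    have 2: "Et t (\<lambda>w. (\<Sum>i\<in>{1..M}. \<bar>wtransfer (w @ [i]) h x\<bar>) / real M) \<le> b" for x
    proof -
      have "(\<Sum>i\<in>{1..M}. \<bar>wtransfer (w @ [i]) h x\<bar>) / real M = \<bar>wtransfer w h (real M * x)\<bar>" for w
        using sum_transfer_digits(1)[of "wtransfer w h" x] by simp
      then show ?thesis using IH(2)[of "real M * x"] by simp
    qed
    have 3: "Et t (\<lambda>w. (\<Sum>i\<in>{1..M}. \<integral>x. \<bar>wtransfer (w @ [i]) h x\<bar> \<partial>lam) / real M) \<le> b"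
      by (rule order_trans[OF Et_mono IH(3)], rule average_digits_le) (simp add: l1)
    show ?thesis unfolding E tp using 1 2 3 by simp
  qed
qed

theorem transfer_mixing:
  assumes L: "lyapunov_exponent M N p0 > 0"
  obtains K \<rho> where "0 < K" "0 < \<rho>" "\<rho> < 1"
    "\<And>h V k. 0 < V \<Longrightarrow> circle_var h V \<Longrightarrow> (\<integral>x. h x \<partial>lam) = 0 \<Longrightarrow>
      Ew k (\<lambda>w. \<integral>x. \<bar>wtransfer w h x\<bar> \<partial>lam) \<le> K * \<rho> ^ k * V"
proof -
  obtain K \<rho> where K: "0 < K" "0 < \<rho>" "\<rho> < 1" "\<And>n V. 0 < V \<Longrightarrow> pair_mean n snd (V, V) \<le> K * \<rho> ^ n * V"
    using pair_mean_snd_decay[OF L] by blast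
  show thesis
  proof (rule that[OF K(1-3)])
    fix h :: "real \<Rightarrow> real" and V k assume V: "0 < V" and h: "circle_var h V" "(\<integral>x. h x \<partial>lam) = 0"
    have "Ew k (\<lambda>w. \<integral>x. \<bar>wtransfer w h x\<bar> \<partial>lam) \<le> pair_mean k snd (V, V)"
      unfolding Ew_eq_Eb_Et pair_mean_def using Et_transfer_bounds[OF h] by (intro B.avg_mono) blast
    then show "Ew k (\<lambda>w. \<integral>x. \<bar>wtransfer w h x\<bar> \<partial>lam) \<le> K * \<rho> ^ k * V"
      using K(4)[OF V, of k] by linarith
  qed
qed

text \<open>
  The density at the end of the word \<open>w\<close> of a point that starts uniformly distributed.
\<close>

definition push_density :: "nat list \<Rightarrow> real \<Rightarrow> real" where "push_density w = wtransfer w (\<lambda>_. 1)"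
definition density_var :: "nat list \<Rightarrow> real" where "density_var w = var_bound w (\<lambda>_. 1) 0"

lemma circle_var_1: "circle_var (\<lambda>_. 1) 0"
  unfolding circle_var_def by (auto intro!: exI[of _ "\<lambda>_. 0"] monoI)

lemma regular_1: "regular (\<lambda>_. 1)" by (rule circle_var_regular[OF circle_var_1])

lemma density_circle_var: "set w \<subseteq> {0..M} \<Longrightarrow> circle_var (push_density w) (density_var w)"
  unfolding push_density_def density_var_def by (rule circle_var_wtransfer[OF circle_var_1])

lemma regular_density: "regular (push_density w)"
  unfolding push_density_def by (rule regular_wtransfer[OF regular_1])

lemma integral_push_density: "set w \<subseteq> {0..M} \<Longrightarrow> (\<integral>x. push_density w x \<partial>lam) = 1"
  unfolding push_density_def by (simp add: integral_wtransfer_1[OF regular_1])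

lemma density_nonneg: "0 \<le> push_density w x"
proof (induction w arbitrary: x rule: rev_induct)
  case (snoc a w)
  then show ?case by (auto simp: push_density_def transfer_def intro!: sum_nonneg divide_nonneg_nonneg)
qed (simp add: push_density_def)

lemma density_le: "set w \<subseteq> {0..M} \<Longrightarrow> push_density w x \<le> 1 + density_var w"
  using circle_var_le_mean[OF density_circle_var, of w x] integral_push_density[of w] by simp

lemma density_var_nonneg: "set w \<subseteq> {0..M} \<Longrightarrow> 0 \<le> density_var w"
  using circle_var_nonneg density_circle_var by blast

text \<open>
  Lebesgue measure is stationary for the random maps.
\<close>

lemma Ew_density: "Ew n (\<lambda>w. push_density w x) = 1"
proof (induction n arbitrary: x)
  case (Suc n)
  have "Ew (Suc n) (\<lambda>w. push_density w x)
    = Ew n (\<lambda>w. p0 * ((\<Sum>k<N. push_density w ((x + real k) / real N)) / real N) + (1 - p0) * push_density w (real M * x))"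
    unfolding Ew_snoc
  proof (rule W.avg_cong)
    fix w :: "nat list"
    have "(\<Sum>i\<in>{1..M}. push_density (w @ [i]) x) / real M = push_density w (real M * x)"
      using sum_transfer_digits(2)[of "push_density w" x] by (simp add: push_density_def)
    moreover have "push_density (w @ [0]) x = (\<Sum>k<N. push_density w ((x + real k) / real N)) / real N"
      by (simp add: push_density_def transfer_def)
    ultimately show "p0 * push_density (w @ [0]) x + (1 - p0) * ((\<Sum>i\<in>{1..M}. push_density (w @ [i]) x) / real M)
      = p0 * ((\<Sum>k<N. push_density w ((x + real k) / real N)) / real N) + (1 - p0) * push_density w (real M * x)" by simp
  qed
  also have "\<dots> = p0 * ((\<Sum>k<N. Ew n (\<lambda>w. push_density w ((x + real k) / real N))) / real N) + (1 - p0) * Ew n (\<lambda>w. push_density w (real M * x))"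
    using W.avg_cmult[of n "inverse (real N)"] by (simp add: W.avg_add W.avg_cmult W.avg_sum divide_inverse mult.commute[of _ "inverse (real N)"])
  also have "\<dots> = 1" using N_pos by (simp add: Suc.IH)
  finally show ?case .
qed (simp add: push_density_def)

text \<open>
  In the mean the jumps created by a contraction have height at most \<open>1\<close>, by \<open>Ew_density\<close>. So the \<open>s\<close>-th moments of the variation satisfy an affine
  recursion with contraction factor \<open>rate s\<close>.
\<close>

theorem density_var_moment:
  assumes s: "0 < s" "s \<le> 1" "rate s < 1"
  obtains C where "0 < C" "\<And>n. Ew n (\<lambda>w. (1 + density_var w) powr s) \<le> C"
proof -
  define D where "D = 4 * real M powr s"
  have r0: "0 \<le> rate s" using p0_pos p0_lt1 by (simp add: rate_def)
  have le: "Ew n (\<lambda>w. density_var w powr s) \<le> D / (1 - rate s)" for n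
  proof (induction n)
    case 0
    show ?case using s by (simp add: density_var_def D_def)
  next
    case (Suc n)
    have "Ew (Suc n) (\<lambda>w. density_var w powr s) \<le> Ew n (\<lambda>w. rate s * density_var w powr s + real M powr s * (2 * (1 + push_density w 0)))"
      unfolding Ew_snoc
    proof (rule W.avg_mono)
      fix w assume w: "set w \<subseteq> {0..M}"
      have v0: "0 \<le> density_var w" by (rule density_var_nonneg[OF w])
      have d0: "0 \<le> push_density w 0" by (rule density_nonneg)
      have z: "density_var (w @ [0]) powr s = real N powr - s * density_var w powr s"
        using v0 by (simp add: density_var_def powr_divide powr_minus_divide)
      have "(\<Sum>i\<in>{1..M}. density_var (w @ [i]) powr s) / real M \<le> real M powr s * (density_var w powr s + 2 * (1 + push_density w 0))"
      proof (rule average_digits_le)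
        fix i assume "i \<in> {1..M}"
        then have "density_var (w @ [i]) powr s = (real M * (density_var w + 2 * push_density w 0)) powr s"
          using d0 by (simp add: density_var_def push_density_def)
        also have "\<dots> = real M powr s * (density_var w + 2 * push_density w 0) powr s" using v0 d0 by (simp add: powr_mult)
        also have "(density_var w + 2 * push_density w 0) powr s \<le> density_var w powr s + (2 * push_density w 0) powr s"
          using s v0 d0 by (intro powr_subadditive) auto
        also have "(2 * push_density w 0) powr s \<le> (2 * (1 + push_density w 0)) powr s" using s d0 by (intro powr_mono2) auto
        also have "(2 * (1 + push_density w 0)) powr s \<le> (2 * (1 + push_density w 0)) powr 1" using s d0 by (intro powr_mono) auto
        finally show "density_var (w @ [i]) powr s \<le> real M powr s * (density_var w powr s + 2 * (1 + push_density w 0))"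
          using d0 by (simp add: mult_left_mono)
      qed
      then have "p0 * density_var (w @ [0]) powr s + (1 - p0) * ((\<Sum>i\<in>{1..M}. density_var (w @ [i]) powr s) / real M)
        \<le> p0 * (real N powr - s * density_var w powr s) + (1 - p0) * (real M powr s * (density_var w powr s + 2 * (1 + push_density w 0)))"
        unfolding z using p0_lt1 by (intro add_left_mono mult_left_mono) auto
      also have "\<dots> = rate s * density_var w powr s + (1 - p0) * (real M powr s * (2 * (1 + push_density w 0)))"
        by (simp add: rate_def algebra_simps)
      also have "(1 - p0) * (real M powr s * (2 * (1 + push_density w 0))) \<le> real M powr s * (2 * (1 + push_density w 0))"
        using p0_pos p0_lt1 d0 by (intro mult_left_le_one_le) auto
      finally show "p0 * density_var (w @ [0]) powr s + (1 - p0) * ((\<Sum>i\<in>{1..M}. density_var (w @ [i]) powr s) / real M)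
        \<le> rate s * density_var w powr s + real M powr s * (2 * (1 + push_density w 0))" by simp
    qed
    also have "\<dots> = rate s * Ew n (\<lambda>w. density_var w powr s) + D"
      unfolding W.avg_add W.avg_cmult by (simp add: W.avg_const Ew_density D_def)
    also have "\<dots> \<le> rate s * (D / (1 - rate s)) + D" using mult_left_mono[OF Suc r0] by simp
    also have "\<dots> = D / (1 - rate s)" using s by (simp add: field_simps)
    finally show ?case .
  qed
  show thesis
  proof (rule that[of "1 + D / (1 - rate s)"])
    show "0 < 1 + D / (1 - rate s)" using s by (auto simp: D_def intro!: add_pos_nonneg)
    fix n
    have "Ew n (\<lambda>w. (1 + density_var w) powr s) \<le> Ew n (\<lambda>w. 1 + density_var w powr s)"
      using s powr_subadditive[of s 1] by (intro W.avg_mono) (auto dest: density_var_nonneg)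
    also have "\<dots> = 1 + Ew n (\<lambda>w. density_var w powr s)" by (simp add: W.avg_add W.avg_const)
    finally show "Ew n (\<lambda>w. (1 + density_var w) powr s) \<le> 1 + D / (1 - rate s)" using le[of n] by simp
  qed
qed

end

section \<open>Decorrelation of two orbits\<close>

interpretation LL: pair_prob_space lam lam ..

lemma integrable_LL_bounded:
  fixes f :: "real \<times> real \<Rightarrow> real"
  assumes "f \<in> borel_measurable (borel \<Otimes>\<^sub>M borel)" "\<And>x. \<bar>f x\<bar> \<le> C"
  shows "integrable (lam \<Otimes>\<^sub>M lam) f"
proof (rule LL.P.integrable_const_bound[where B=C])
  have "sets (lam \<Otimes>\<^sub>M lam) = sets (borel \<Otimes>\<^sub>M borel)" by (intro sets_pair_measure_cong) auto
  then show "f \<in> borel_measurable (lam \<Otimes>\<^sub>M lam)" using assms(1) measurable_cong_sets by blast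
qed (use assms(2) in auto)

text \<open>
  The fractional parts make the indicator periodic in both arguments; inside the unit interval it is the indicator of a distance
  less than \<open>\<epsilon>\<close>.
\<close>

definition near :: "real \<Rightarrow> real \<Rightarrow> real \<Rightarrow> real" where
  "near \<epsilon> x y = of_bool (\<bar>frac x - frac y\<bar> < \<epsilon>)"

lemma near_measurable [measurable (raw)]:
  assumes [measurable]: "f \<in> borel_measurable Q" "g \<in> borel_measurable Q"
  shows "(\<lambda>z. near \<epsilon> (f z) (g z)) \<in> borel_measurable Q"
  unfolding near_def by measurable

lemma near_bounds: "0 \<le> near \<epsilon> x y" "near \<epsilon> x y \<le> 1" "\<bar>near \<epsilon> x y\<bar> \<le> 1"
  by (auto simp: near_def)

lemma near_sym: "near \<epsilon> x y = near \<epsilon> y x"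
  by (auto simp: near_def abs_minus_commute)

lemma circle_var_near: "circle_var (\<lambda>x. near \<epsilon> x y) 2"
proof -
  define b where "b = frac y"
  have "circle_var (\<lambda>x. (\<lambda>u. of_bool (\<bar>u - b\<bar> < \<epsilon>)) (frac x)) 2"
  proof (rule circle_var_from_unit[where G="\<lambda>u. of_bool (b - \<epsilon> < u) + of_bool (b + \<epsilon> \<le> u)"])
    show "(\<lambda>u::real. of_bool (\<bar>u - b\<bar> < \<epsilon>) :: real) \<in> borel_measurable borel" by measurable
  qed (auto simp: of_bool_def abs_if split: if_splits)
  then show ?thesis by (simp add: near_def b_def)
qed

context random_maps begin

lemma transfer_measurable_param:
  assumes H: "(\<lambda>p. H (fst p) (snd p)) \<in> borel_measurable (borel \<Otimes>\<^sub>M borel)"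
  shows "(\<lambda>p. transfer a (H (fst p)) (snd p)) \<in> borel_measurable (borel \<Otimes>\<^sub>M (borel :: real measure))"
proof -
  have comp: "(\<lambda>p. H (fst p) (f (snd p))) \<in> borel_measurable (borel \<Otimes>\<^sub>M borel)"
    if [measurable]: "f \<in> borel_measurable borel" for f :: "real \<Rightarrow> real"
  proof -
    have "(\<lambda>p. (fst p, f (snd p))) \<in> measurable (borel \<Otimes>\<^sub>M borel) (borel \<Otimes>\<^sub>M borel)" by measurable
    from measurable_compose[OF this H] show ?thesis by simp
  qed
  have [measurable]: "(\<lambda>p. H (fst p) ((snd p + real k) / real N)) \<in> borel_measurable (borel \<Otimes>\<^sub>M borel)" for k
    by (rule comp[of "\<lambda>x. (x + real k) / real N"]) measurable
  have [measurable]: "(\<lambda>p. H (fst p) (real M * snd p)) \<in> borel_measurable (borel \<Otimes>\<^sub>M borel)"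
    by (rule comp[of "\<lambda>x. real M * x"]) measurable
  show ?thesis unfolding transfer_def by (cases "a = 0") auto
qed

lemma wtransfer_measurable_param:
  assumes "(\<lambda>p. H (fst p) (snd p)) \<in> borel_measurable (borel \<Otimes>\<^sub>M borel)"
  shows "(\<lambda>p. wtransfer w (H (fst p)) (snd p)) \<in> borel_measurable (borel \<Otimes>\<^sub>M (borel :: real measure))"
  using assms
proof (induction w arbitrary: H)
  case (Cons a w)
  then show ?case using Cons.IH[of "\<lambda>y. transfer a (H y)", OF transfer_measurable_param[OF Cons.prems]] by simp
qed simp

lemma Ew_integral:
  fixes f :: "nat list \<Rightarrow> real \<Rightarrow> real"
  assumes "\<And>w. set w \<subseteq> {0..M} \<Longrightarrow> integrable lam (f w)"
  shows "integrable lam (\<lambda>y. Ew n (\<lambda>w. f w y)) \<and> (\<integral>y. Ew n (\<lambda>w. f w y) \<partial>lam) = Ew n (\<lambda>w. \<integral>y. f w y \<partial>lam)"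
  using assms
proof (induction n arbitrary: f)
  case (Suc n)
  have IH: "integrable lam (\<lambda>y. Ew n (\<lambda>w. f (a # w) y)) \<and> (\<integral>y. Ew n (\<lambda>w. f (a # w) y) \<partial>lam) = Ew n (\<lambda>w. \<integral>y. f (a # w) y \<partial>lam)"
    if "a \<in> {0..M}" for a
    using that by (intro Suc.IH Suc.prems) auto
  then show ?case by (auto simp: word_avg.simps(2) Bochner_Integration.integral_sum)
qed simp

text \<open>
  For a fixed word, \<open>pair_close\<close> is the probability that two independent uniform points are \<open>\<epsilon>\<close>-close at its end, and \<open>joint_close\<close> the probability that
  they are \<open>\<epsilon>\<close>-close after \<open>u\<close> and \<open>\<epsilon>'\<close>-close after the continuation by \<open>w\<close>.
\<close>

definition pair_close :: "real \<Rightarrow> nat list \<Rightarrow> real" where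
  "pair_close \<epsilon> w = (\<integral>y. (\<integral>x. near \<epsilon> (act w x) (act w y) \<partial>lam) \<partial>lam)"

definition joint_close :: "real \<Rightarrow> real \<Rightarrow> nat list \<Rightarrow> nat list \<Rightarrow> real" where
  "joint_close \<epsilon> \<epsilon>' u w = (\<integral>y. (\<integral>x. near \<epsilon> (act u x) (act u y) * near \<epsilon>' (act (u @ w) x) (act (u @ w) y) \<partial>lam) \<partial>lam)"

text \<open>
  When one orbit is at \<open>y\<close> at the end of \<open>u\<close>, the other is close to it with probability \<open>local_mass u \<epsilon> y\<close>. The density of the other orbit on this event
  differs from the constant \<open>local_mass u \<epsilon> y\<close> by the function \<open>fluct u \<epsilon> y\<close> of integral zero, and \<open>memory u \<epsilon> w y\<close> is what remains of this function
  after the word \<open>w\<close>.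
\<close>

definition local_mass :: "nat list \<Rightarrow> real \<Rightarrow> real \<Rightarrow> real" where
  "local_mass u \<epsilon> y = (\<integral>x. push_density u x * near \<epsilon> x y \<partial>lam)"

definition fluct :: "nat list \<Rightarrow> real \<Rightarrow> real \<Rightarrow> real \<Rightarrow> real" where
  "fluct u \<epsilon> y x = push_density u x * near \<epsilon> x y - local_mass u \<epsilon> y"

definition memory :: "nat list \<Rightarrow> real \<Rightarrow> nat list \<Rightarrow> real \<Rightarrow> real" where
  "memory u \<epsilon> w y = (\<integral>x. \<bar>wtransfer w (fluct u \<epsilon> y) x\<bar> \<partial>lam)"

lemma density_measurable [measurable]: "push_density u \<in> borel_measurable borel"
  by (rule regular_measurable[OF regular_density])

lemma local_mass_measurable [measurable]: "local_mass u \<epsilon> \<in> borel_measurable borel"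
  unfolding local_mass_def by measurable

lemma act_integral_const: "set w \<subseteq> {0..M} \<Longrightarrow> \<phi> \<in> borel_measurable borel \<Longrightarrow> (\<And>x. \<bar>\<phi> x\<bar> \<le> D) \<Longrightarrow>
    (\<integral>x. \<phi> (act w x) \<partial>lam) = (\<integral>x. push_density w x * \<phi> x \<partial>lam)"
  using integral_wtransfer[OF regular_1, of \<phi> D w] by (simp add: push_density_def)

context
  fixes u :: "nat list" assumes u: "set u \<subseteq> {0..M}"
begin

lemma density_integrable_times:
  assumes "f \<in> borel_measurable borel" "\<And>x. \<bar>f x\<bar> \<le> D"
  shows "integrable lam (\<lambda>x. push_density u x * f x)"
  using regular_integrable[OF regular_density assms] .

lemma density_average_abs_le:
  assumes "f \<in> borel_measurable borel" "\<And>x. \<bar>f x\<bar> \<le> D"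
  shows "\<bar>\<integral>x. push_density u x * f x \<partial>lam\<bar> \<le> D"
proof -
  have "\<bar>\<integral>x. push_density u x * f x \<partial>lam\<bar> \<le> (\<integral>x. \<bar>push_density u x * f x\<bar> \<partial>lam)" by (rule integral_abs_bound)
  also have "\<dots> \<le> (\<integral>x. push_density u x * D \<partial>lam)"
  proof (rule integral_lam_mono)
    show "integrable lam (\<lambda>x. \<bar>push_density u x * f x\<bar>)" using density_integrable_times[OF assms] by simp
    show "integrable lam (\<lambda>x. push_density u x * D)" by (rule density_integrable_times[of _ "\<bar>D\<bar>"]) auto
    show "\<bar>push_density u x * f x\<bar> \<le> push_density u x * D" for x
      using assms(2)[of x] density_nonneg[of u x] by (simp add: abs_mult mult_left_mono)
  qed
  also have "\<dots> = D" using integral_push_density[OF u] by simp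
  finally show ?thesis .
qed

lemma local_mass_bounds: "0 \<le> local_mass u \<epsilon> y" "local_mass u \<epsilon> y \<le> 1"
  using density_average_abs_le[of "\<lambda>x. near \<epsilon> x y" 1] near_bounds density_nonneg
  by (auto simp: local_mass_def intro!: Bochner_Integration.integral_nonneg)

lemma circle_var_fluct: "circle_var (fluct u \<epsilon> y) (2 + 3 * density_var u)"
proof -
  have "\<bar>push_density u x\<bar> \<le> 1 + density_var u" for x using density_le[OF u, of x] density_nonneg[of u x] by simp
  then have "circle_var (\<lambda>x. push_density u x * near \<epsilon> x y) ((1 + density_var u) * 2 + 1 * density_var u)"
    by (rule circle_var_times[OF density_circle_var[OF u] circle_var_near _ near_bounds(3)])
  from circle_var_sub_const[OF this, of "local_mass u \<epsilon> y"] show ?thesis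
    unfolding fluct_def by (simp add: algebra_simps)
qed

lemma regular_fluct: "regular (fluct u \<epsilon> y)"
  by (rule circle_var_regular[OF circle_var_fluct])

lemma integral_fluct: "(\<integral>x. fluct u \<epsilon> y x \<partial>lam) = 0"
  unfolding fluct_def
  by (subst Bochner_Integration.integral_diff) (auto simp: local_mass_def intro!: density_integrable_times[where D=1] near_bounds)

lemma fluct_test:
  assumes w: "set w \<subseteq> {0..M}" and [measurable]: "\<phi> \<in> borel_measurable borel" and bd: "\<And>x. \<bar>\<phi> x\<bar> \<le> 1"
  shows "\<bar>(\<integral>x. push_density u x * (near \<epsilon> x y * \<phi> (act w x)) \<partial>lam) - local_mass u \<epsilon> y * (\<integral>x. \<phi> (act w x) \<partial>lam)\<bar> \<le> memory u \<epsilon> w y"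
proof -
  have i1: "integrable lam (\<lambda>x. push_density u x * (near \<epsilon> x y * \<phi> (act w x)))"
    by (rule density_integrable_times[where D=1]) (auto simp: abs_mult intro!: mult_le_one near_bounds bd)
  have i2: "integrable lam (\<lambda>x. \<phi> (act w x))" by (rule integrable_lam_bounded[where C=1]) (auto simp: bd)
  have "(\<integral>x. push_density u x * (near \<epsilon> x y * \<phi> (act w x)) \<partial>lam) - local_mass u \<epsilon> y * (\<integral>x. \<phi> (act w x) \<partial>lam)
    = (\<integral>x. push_density u x * (near \<epsilon> x y * \<phi> (act w x)) - local_mass u \<epsilon> y * \<phi> (act w x) \<partial>lam)"
    using i1 i2 by simp
  also have "\<dots> = (\<integral>x. fluct u \<epsilon> y x * \<phi> (act w x) \<partial>lam)"
    by (simp add: fluct_def left_diff_distrib mult.assoc)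
  also have "\<dots> = (\<integral>x. wtransfer w (fluct u \<epsilon> y) x * \<phi> x \<partial>lam)"
    by (rule integral_wtransfer[OF regular_fluct _ bd w]) measurable
  also have "\<bar>\<dots>\<bar> \<le> (\<integral>x. \<bar>wtransfer w (fluct u \<epsilon> y) x * \<phi> x\<bar> \<partial>lam)" by (rule integral_abs_bound)
  also have "\<dots> \<le> memory u \<epsilon> w y"
    unfolding memory_def
  proof (rule integral_lam_mono)
    have r: "regular (wtransfer w (fluct u \<epsilon> y))" by (rule regular_wtransfer[OF regular_fluct])
    show "integrable lam (\<lambda>x. \<bar>wtransfer w (fluct u \<epsilon> y) x * \<phi> x\<bar>)"
      using regular_integrable[OF r assms(2) bd] by simp
    show "integrable lam (\<lambda>x. \<bar>wtransfer w (fluct u \<epsilon> y) x\<bar>)"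
      using regular_integrable[OF r, of "\<lambda>_. 1" 1] by simp
    show "\<bar>wtransfer w (fluct u \<epsilon> y) x * \<phi> x\<bar> \<le> \<bar>wtransfer w (fluct u \<epsilon> y) x\<bar>" for x
      using bd[of x] by (simp add: abs_mult mult_left_le)
  qed
  finally show ?thesis .
qed

lemma memory_bounds:
  assumes "set w \<subseteq> {0..M}" shows "0 \<le> memory u \<epsilon> w y" "memory u \<epsilon> w y \<le> 2"
proof -
  show "0 \<le> memory u \<epsilon> w y" unfolding memory_def by (intro Bochner_Integration.integral_nonneg) auto
  have "memory u \<epsilon> w y \<le> (\<integral>x. \<bar>fluct u \<epsilon> y x\<bar> \<partial>lam)"
    unfolding memory_def by (rule integral_abs_wtransfer_le[OF regular_fluct assms])
  also have "\<dots> \<le> (\<integral>x. push_density u x * near \<epsilon> x y + local_mass u \<epsilon> y \<partial>lam)"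
  proof (rule integral_lam_mono)
    show "integrable lam (\<lambda>x. \<bar>fluct u \<epsilon> y x\<bar>)" using regular_integrable[OF regular_fluct, of "\<lambda>_. 1" 1] by simp
    show "integrable lam (\<lambda>x. push_density u x * near \<epsilon> x y + local_mass u \<epsilon> y)"
      using density_integrable_times[of "\<lambda>x. near \<epsilon> x y" 1] near_bounds by simp
    show "\<bar>fluct u \<epsilon> y x\<bar> \<le> push_density u x * near \<epsilon> x y + local_mass u \<epsilon> y" for x
      using mult_nonneg_nonneg[OF density_nonneg[of u x] near_bounds(1)[of \<epsilon> x y]] local_mass_bounds(1)[of \<epsilon> y]
      by (simp add: fluct_def abs_le_iff)
  qed
  also have "\<dots> = 2 * local_mass u \<epsilon> y"
    using density_integrable_times[of "\<lambda>x. near \<epsilon> x y" 1] near_bounds by (simp add: local_mass_def)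
  finally show "memory u \<epsilon> w y \<le> 2" using local_mass_bounds(2)[of \<epsilon> y] by linarith
qed

lemma memory_measurable [measurable]: "memory u \<epsilon> w \<in> borel_measurable borel"
proof -
  have "(\<lambda>p. fluct u \<epsilon> (fst p) (snd p)) \<in> borel_measurable (borel \<Otimes>\<^sub>M borel)"
    unfolding fluct_def by measurable
  from wtransfer_measurable_param[OF this, of w]
  have [measurable]: "(\<lambda>p. wtransfer w (fluct u \<epsilon> (fst p)) (snd p)) \<in> borel_measurable (borel \<Otimes>\<^sub>M lam)"
    by (simp cong: measurable_cong_sets sets_pair_measure_cong)
  have "(\<lambda>(y, x). \<bar>wtransfer w (fluct u \<epsilon> y) x\<bar>) \<in> borel_measurable (borel \<Otimes>\<^sub>M lam)"
    unfolding case_prod_beta by measurable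
  then show ?thesis unfolding memory_def by (rule lam.borel_measurable_lebesgue_integral)
qed

lemma pair_close_density: "pair_close \<epsilon> u = (\<integral>y. push_density u y * local_mass u \<epsilon> y \<partial>lam)"
proof -
  have "(\<integral>x. near \<epsilon> (act u x) (act u y) \<partial>lam) = local_mass u \<epsilon> (act u y)" for y
    unfolding local_mass_def using act_integral_const[OF u, of "\<lambda>x. near \<epsilon> x (act u y)" 1] near_bounds by simp
  then have "pair_close \<epsilon> u = (\<integral>y. local_mass u \<epsilon> (act u y) \<partial>lam)" by (simp add: pair_close_def)
  also have "\<dots> = (\<integral>y. push_density u y * local_mass u \<epsilon> y \<partial>lam)"
    by (rule act_integral_const[OF u _, where D=1]) (use local_mass_bounds in \<open>auto simp: abs_le_iff intro: order_trans[of _ 0]\<close>)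
  finally show ?thesis .
qed

text \<open>
  Given the symbols, the two orbits are independent. First the orbit of \<open>x\<close> and then the orbit of \<open>y\<close> is replaced, at the end of \<open>u\<close>, by a new uniform point;
  each replacement costs the mean of the remaining memory.
\<close>

theorem joint_close_factorizes:
  assumes w: "set w \<subseteq> {0..M}"
  shows "\<bar>joint_close \<epsilon> \<epsilon>' u w - pair_close \<epsilon> u * pair_close \<epsilon>' w\<bar> \<le> 2 * (\<integral>y. push_density u y * memory u \<epsilon> w y \<partial>lam)"
proof -
  let ?r = "push_density u" and ?m = "local_mass u \<epsilon>" and ?e = "memory u \<epsilon> w"
  define \<Psi> where "\<Psi> y = (\<integral>x. ?r x * (near \<epsilon> x y * near \<epsilon>' (act w x) (act w y)) \<partial>lam)" for y
  define \<kappa> where "\<kappa> z = (\<integral>x. near \<epsilon>' (act w x) z \<partial>lam)" for z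
  have [measurable]: "\<Psi> \<in> borel_measurable borel" "\<kappa> \<in> borel_measurable borel"
    unfolding \<Psi>_def \<kappa>_def by measurable
  have cc: "\<bar>near \<epsilon> x y * near \<epsilon>' x' y'\<bar> \<le> 1" for x y x' y'
    unfolding abs_mult by (intro mult_le_one near_bounds) auto
  have \<Psi>1: "\<bar>\<Psi> y\<bar> \<le> 1" for y
    unfolding \<Psi>_def by (rule density_average_abs_le) (use cc in auto)
  have \<kappa>01: "0 \<le> \<kappa> z" "\<kappa> z \<le> 1" for z
  proof -
    show "0 \<le> \<kappa> z" unfolding \<kappa>_def by (intro Bochner_Integration.integral_nonneg near_bounds)
    have "\<kappa> z \<le> (\<integral>x. 1 \<partial>lam)" unfolding \<kappa>_def
      by (intro integral_lam_mono integrable_lam_bounded[where C=1]) (auto intro: near_bounds)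
    then show "\<kappa> z \<le> 1" by simp
  qed
  have \<kappa>a: "\<bar>\<kappa> z\<bar> \<le> 1" for z using \<kappa>01[of z] by simp
  have m1: "\<bar>?m y\<bar> \<le> 1" for y using local_mass_bounds[of \<epsilon> y] by simp
  have e2: "\<bar>?e y\<bar> \<le> 2" for y using memory_bounds[OF w, of \<epsilon> y] by simp
  have J: "joint_close \<epsilon> \<epsilon>' u w = (\<integral>y. ?r y * \<Psi> y \<partial>lam)"
  proof -
    have "(\<integral>x. near \<epsilon> (act u x) (act u y) * near \<epsilon>' (act (u @ w) x) (act (u @ w) y) \<partial>lam) = \<Psi> (act u y)" for y
      unfolding \<Psi>_def
      using act_integral_const[OF u, of "\<lambda>x. near \<epsilon> x (act u y) * near \<epsilon>' (act w x) (act w (act u y))" 1] cc by simp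
    then have "joint_close \<epsilon> \<epsilon>' u w = (\<integral>y. \<Psi> (act u y) \<partial>lam)" by (simp add: joint_close_def)
    also have "\<dots> = (\<integral>y. ?r y * \<Psi> y \<partial>lam)" by (rule act_integral_const[OF u _ \<Psi>1]) measurable
    finally show ?thesis .
  qed
  have step: "\<bar>(\<integral>y. ?r y * f y \<partial>lam) - (\<integral>y. ?r y * g y \<partial>lam)\<bar> \<le> (\<integral>y. ?r y * ?e y \<partial>lam)"
    if [measurable]: "f \<in> borel_measurable borel" "g \<in> borel_measurable borel"
      and b: "\<And>y. \<bar>f y\<bar> \<le> 1" "\<And>y. \<bar>g y\<bar> \<le> 1" and d: "\<And>y. \<bar>f y - g y\<bar> \<le> ?e y" for f g
  proof -
    have i: "integrable lam (\<lambda>y. ?r y * f y)" "integrable lam (\<lambda>y. ?r y * g y)" "integrable lam (\<lambda>y. ?r y * ?e y)"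
      using b e2 by (auto intro!: density_integrable_times)
    have "(\<integral>y. ?r y * f y \<partial>lam) - (\<integral>y. ?r y * g y \<partial>lam) = (\<integral>y. ?r y * f y - ?r y * g y \<partial>lam)" using i by simp
    also have "\<bar>\<dots>\<bar> \<le> (\<integral>y. \<bar>?r y * f y - ?r y * g y\<bar> \<partial>lam)" by (rule integral_abs_bound)
    also have "\<dots> \<le> (\<integral>y. ?r y * ?e y \<partial>lam)"
    proof (rule integral_lam_mono)
      show "\<bar>?r y * f y - ?r y * g y\<bar> \<le> ?r y * ?e y" for y
        using mult_left_mono[OF d[of y] density_nonneg[of u y]] density_nonneg[of u y]
        by (simp add: abs_mult flip: right_diff_distrib)
    qed (use i in auto)
    finally show ?thesis .
  qed
  have s1: "\<bar>(\<integral>y. ?r y * \<Psi> y \<partial>lam) - (\<integral>y. ?r y * (?m y * \<kappa> (act w y)) \<partial>lam)\<bar> \<le> (\<integral>y. ?r y * ?e y \<partial>lam)"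
  proof (rule step)
    show "\<bar>\<Psi> y - ?m y * \<kappa> (act w y)\<bar> \<le> ?e y" for y
      unfolding \<Psi>_def \<kappa>_def by (rule fluct_test[OF w, of "\<lambda>z. near \<epsilon>' z (act w y)"]) (auto intro: near_bounds)
    show "\<bar>?m y * \<kappa> (act w y)\<bar> \<le> 1" for y unfolding abs_mult by (intro mult_le_one m1 \<kappa>a) auto
  qed (use \<Psi>1 in auto)
  define \<Omega> where "\<Omega> s = (\<integral>y. ?r y * (near \<epsilon> y s * \<kappa> (act w y)) \<partial>lam)" for s
  have [measurable]: "\<Omega> \<in> borel_measurable borel" unfolding \<Omega>_def by measurable
  have c\<kappa>: "\<bar>near \<epsilon> y s * \<kappa> z\<bar> \<le> 1" for y s z
    unfolding abs_mult by (intro mult_le_one near_bounds \<kappa>a) auto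
  \<comment> \<open>The integrals are exchanged in order to replace the second orbit while the first one is kept fixed.\<close>
  have swap: "(\<integral>y. ?r y * (?m y * \<kappa> (act w y)) \<partial>lam) = (\<integral>s. ?r s * \<Omega> s \<partial>lam)"
  proof -
    have R: "\<bar>?r x\<bar> \<le> 1 + density_var u" for x using density_le[OF u, of x] density_nonneg[of u x] by simp
    have "integrable (lam \<Otimes>\<^sub>M lam) (\<lambda>(s, y). ?r s * (?r y * (near \<epsilon> y s * \<kappa> (act w y))))"
    proof (rule integrable_LL_bounded)
      show "(\<lambda>(s, y). ?r s * (?r y * (near \<epsilon> y s * \<kappa> (act w y)))) \<in> borel_measurable (borel \<Otimes>\<^sub>M borel)" by measurable
      fix p :: "real \<times> real"
      have "\<bar>?r (fst p)\<bar> * (\<bar>?r (snd p)\<bar> * \<bar>near \<epsilon> (snd p) (fst p) * \<kappa> (act w (snd p))\<bar>)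
        \<le> (1 + density_var u) * ((1 + density_var u) * 1)"
        using R[of "fst p"] R[of "snd p"] density_var_nonneg[OF u] by (intro mult_mono R c\<kappa>) auto
      then show "\<bar>case p of (s, y) \<Rightarrow> ?r s * (?r y * (near \<epsilon> y s * \<kappa> (act w y)))\<bar> \<le> (1 + density_var u) * ((1 + density_var u) * 1)"
        by (simp add: case_prod_beta abs_mult)
    qed
    from LL.Fubini_integral[OF this]
    have "(\<integral>y. (\<integral>s. ?r s * (?r y * (near \<epsilon> y s * \<kappa> (act w y))) \<partial>lam) \<partial>lam) = (\<integral>s. (\<integral>y. ?r s * (?r y * (near \<epsilon> y s * \<kappa> (act w y))) \<partial>lam) \<partial>lam)" .
    moreover have "(\<integral>s. ?r s * (?r y * (near \<epsilon> y s * \<kappa> (act w y))) \<partial>lam) = ?r y * (?m y * \<kappa> (act w y))" for y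
    proof -
      have "(\<integral>s. ?r s * (?r y * (near \<epsilon> y s * \<kappa> (act w y))) \<partial>lam) = (\<integral>s. (?r y * \<kappa> (act w y)) * (?r s * near \<epsilon> s y) \<partial>lam)"
        by (intro Bochner_Integration.integral_cong refl) (simp add: near_sym mult_ac)
      also have "\<dots> = (?r y * \<kappa> (act w y)) * ?m y" unfolding local_mass_def by (rule integral_mult_right_zero)
      finally show ?thesis by (simp add: mult_ac)
    qed
    ultimately show ?thesis by (simp add: \<Omega>_def)
  qed
  have \<kappa>bar: "(\<integral>y. \<kappa> (act w y) \<partial>lam) = pair_close \<epsilon>' w" by (simp add: \<kappa>_def pair_close_def)
  have s2: "\<bar>(\<integral>s. ?r s * \<Omega> s \<partial>lam) - (\<integral>s. ?r s * (?m s * pair_close \<epsilon>' w) \<partial>lam)\<bar> \<le> (\<integral>y. ?r y * ?e y \<partial>lam)"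
  proof (rule step)
    show "\<bar>\<Omega> s - ?m s * pair_close \<epsilon>' w\<bar> \<le> ?e s" for s
      unfolding \<Omega>_def \<kappa>bar[symmetric] by (rule fluct_test[OF w _ \<kappa>a]) measurable
    show "\<bar>\<Omega> s\<bar> \<le> 1" for s unfolding \<Omega>_def by (rule density_average_abs_le) (use c\<kappa> in auto)
    have "\<bar>pair_close \<epsilon>' w\<bar> \<le> (\<integral>y. \<bar>\<kappa> (act w y)\<bar> \<partial>lam)" unfolding \<kappa>bar[symmetric] by (rule integral_abs_bound)
    also have "\<dots> \<le> (\<integral>y. 1 \<partial>lam)"
      by (intro integral_lam_mono integrable_lam_bounded[where C=1]) (auto intro: \<kappa>a)
    finally have "\<bar>pair_close \<epsilon>' w\<bar> \<le> 1" by simp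
    then show "\<bar>?m s * pair_close \<epsilon>' w\<bar> \<le> 1" for s unfolding abs_mult by (intro mult_le_one m1) auto
  qed auto
  have "(\<integral>s. ?r s * (?m s * pair_close \<epsilon>' w) \<partial>lam) = pair_close \<epsilon> u * pair_close \<epsilon>' w"
    unfolding pair_close_density by (simp flip: mult.assoc)
  then show ?thesis using s1 s2 unfolding J swap by linarith
qed

end

text \<open>
  The memory decays exponentially by \<open>transfer_mixing\<close>, in proportion to the variation of the density at the end of \<open>u\<close>. This variation has only a
  small moment, and the memory is also at most \<open>2\<close>; interpolating between the two bounds leaves the \<open>s\<close>-th power of the rate.
\<close>

theorem decorrelation:
  assumes L: "lyapunov_exponent M N p0 > 0"
  obtains K \<theta> where "0 < K" "0 < \<theta>" "\<theta> < 1"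
    "\<And>\<epsilon> \<epsilon>' i k. \<bar>Ew i (\<lambda>u. Ew k (\<lambda>w. joint_close \<epsilon> \<epsilon>' u w)) - Ew i (pair_close \<epsilon>) * Ew k (pair_close \<epsilon>')\<bar> \<le> K * \<theta> ^ k"
proof -
  obtain s where s: "0 < s" "s \<le> 1" "rate s < 1" using rate_lt_1[OF L] by blast
  obtain C where C: "0 < C" "\<And>n. Ew n (\<lambda>w. (1 + density_var w) powr s) \<le> C"
    using density_var_moment[OF s] by blast
  obtain K \<rho> where K: "0 < K" "0 < \<rho>" "\<rho> < 1"
    "\<And>h V k. 0 < V \<Longrightarrow> circle_var h V \<Longrightarrow> (\<integral>x. h x \<partial>lam) = 0 \<Longrightarrow>
      Ew k (\<lambda>w. \<integral>x. \<bar>wtransfer w h x\<bar> \<partial>lam) \<le> K * \<rho> ^ k * V"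
    using transfer_mixing[OF L] by blast
  show thesis
  proof (rule that[of "4 * ((3 * K) powr s * C)" "\<rho> powr s"])
    show "0 < 4 * ((3 * K) powr s * C)" using K C by simp
    show "0 < \<rho> powr s" using K by simp
    show "\<rho> powr s < 1" using K s powr_less_mono2[of s \<rho> 1] by simp
    fix \<epsilon> \<epsilon>' :: real and i k :: nat
    have per_u: "\<bar>Ew k (\<lambda>w. joint_close \<epsilon> \<epsilon>' u w) - pair_close \<epsilon> u * Ew k (pair_close \<epsilon>')\<bar>
        \<le> 4 * ((3 * K) powr s * (\<rho> powr s) ^ k) * (1 + density_var u) powr s" if u: "set u \<subseteq> {0..M}" for u
    proof -
      let ?v = "density_var u"
      have v0: "0 \<le> ?v" by (rule density_var_nonneg[OF u])
      define m where "m = min 2 (K * \<rho> ^ k * (2 + 3 * ?v))"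
      have m0: "0 \<le> m" using K v0 by (simp add: m_def)
      have i1: "integrable lam (\<lambda>y. push_density u y * memory u \<epsilon> w y)" if "set w \<subseteq> {0..M}" for w
        by (rule density_integrable_times[OF u, where D=2])
           (use memory_bounds[OF u that] memory_measurable[OF u] in \<open>auto simp: abs_le_iff intro: order_trans[of _ 0]\<close>)
      have "\<bar>Ew k (\<lambda>w. joint_close \<epsilon> \<epsilon>' u w) - pair_close \<epsilon> u * Ew k (pair_close \<epsilon>')\<bar>
        = \<bar>Ew k (\<lambda>w. joint_close \<epsilon> \<epsilon>' u w - pair_close \<epsilon> u * pair_close \<epsilon>' w)\<bar>"
        by (simp add: W.avg_diff W.avg_cmult)
      also have "\<dots> \<le> Ew k (\<lambda>w. \<bar>joint_close \<epsilon> \<epsilon>' u w - pair_close \<epsilon> u * pair_close \<epsilon>' w\<bar>)" by (rule W.avg_abs)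
      also have "\<dots> \<le> Ew k (\<lambda>w. 2 * (\<integral>y. push_density u y * memory u \<epsilon> w y \<partial>lam))"
        by (intro W.avg_mono joint_close_factorizes[OF u])
      also have "\<dots> = 2 * (\<integral>y. Ew k (\<lambda>w. push_density u y * memory u \<epsilon> w y) \<partial>lam)"
        using Ew_integral[of "\<lambda>w y. push_density u y * memory u \<epsilon> w y" k, OF i1] by (simp add: W.avg_cmult)
      also have "(\<integral>y. Ew k (\<lambda>w. push_density u y * memory u \<epsilon> w y) \<partial>lam) \<le> (\<integral>y. push_density u y * m \<partial>lam)"
      proof (rule integral_lam_mono)
        show "integrable lam (\<lambda>y. Ew k (\<lambda>w. push_density u y * memory u \<epsilon> w y))"
          using Ew_integral[of "\<lambda>w y. push_density u y * memory u \<epsilon> w y" k, OF i1] by simp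
        show "integrable lam (\<lambda>y. push_density u y * m)" by (rule density_integrable_times[OF u, of _ "\<bar>m\<bar>"]) auto
        fix y :: real
        have "Ew k (\<lambda>w. memory u \<epsilon> w y) \<le> Ew k (\<lambda>_. 2)" by (intro W.avg_mono memory_bounds[OF u])
        moreover have "Ew k (\<lambda>w. memory u \<epsilon> w y) \<le> K * \<rho> ^ k * (2 + 3 * ?v)"
          unfolding memory_def using v0 by (intro K(4) circle_var_fluct[OF u] integral_fluct[OF u]) auto
        ultimately have "Ew k (\<lambda>w. memory u \<epsilon> w y) \<le> m" by (simp add: m_def W.avg_const)
        then show "Ew k (\<lambda>w. push_density u y * memory u \<epsilon> w y) \<le> push_density u y * m"
          unfolding W.avg_cmult using density_nonneg[of u y] by (rule mult_left_mono)
      qed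
      also have "(\<integral>y. push_density u y * m \<partial>lam) = m" using integral_push_density[OF u] by simp
      also have "m \<le> 2 * ((3 * K) powr s * (\<rho> powr s) ^ k) * (1 + ?v) powr s"
      proof -
        have "m \<le> 2 * min 1 (3 * K * \<rho> ^ k * (1 + ?v))"
        proof -
          have "K * \<rho> ^ k * (2 + 3 * ?v) \<le> K * \<rho> ^ k * (2 * (3 * (1 + ?v)))" using K v0 by (intro mult_left_mono) auto
          also have "\<dots> = 2 * (3 * K * \<rho> ^ k * (1 + ?v))" by (simp only: mult_ac)
          finally have Z: "K * \<rho> ^ k * (2 + 3 * ?v) \<le> 2 * (3 * K * \<rho> ^ k * (1 + ?v))" .
          have "min 2 Z \<le> 2 * min 1 Y" if "Z \<le> 2 * Y" for Y Z :: real using that by (simp add: min_def)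
          from this[OF Z] show ?thesis by (simp only: m_def)
        qed
        also have "min 1 (3 * K * \<rho> ^ k * (1 + ?v)) \<le> (3 * K * \<rho> ^ k * (1 + ?v)) powr s"
          using s K v0 by (intro min_1_powr) auto
        also have "\<dots> = (3 * K) powr s * (\<rho> powr s) ^ k * (1 + ?v) powr s"
        proof -
          have "(\<rho> ^ k) powr s = (\<rho> powr s) ^ k"
            using K by (simp add: powr_powr mult.commute flip: powr_realpow)
          then show ?thesis using K v0 by (simp add: powr_mult)
        qed
        finally show ?thesis by simp
      qed
      finally show ?thesis by simp
    qed
    have "\<bar>Ew i (\<lambda>u. Ew k (\<lambda>w. joint_close \<epsilon> \<epsilon>' u w)) - Ew i (pair_close \<epsilon>) * Ew k (pair_close \<epsilon>')\<bar>
      = \<bar>Ew i (\<lambda>u. Ew k (\<lambda>w. joint_close \<epsilon> \<epsilon>' u w) - Ew k (pair_close \<epsilon>') * pair_close \<epsilon> u)\<bar>"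
      unfolding W.avg_diff W.avg_cmult by (simp add: mult.commute)
    also have "\<dots> \<le> Ew i (\<lambda>u. \<bar>Ew k (\<lambda>w. joint_close \<epsilon> \<epsilon>' u w) - Ew k (pair_close \<epsilon>') * pair_close \<epsilon> u\<bar>)" by (rule W.avg_abs)
    also have "\<dots> \<le> Ew i (\<lambda>u. 4 * ((3 * K) powr s * (\<rho> powr s) ^ k) * (1 + density_var u) powr s)"
      using per_u by (intro W.avg_mono) (simp add: mult.commute)
    also have "\<dots> = 4 * ((3 * K) powr s * (\<rho> powr s) ^ k) * Ew i (\<lambda>u. (1 + density_var u) powr s)" by (rule W.avg_cmult)
    also have "\<dots> \<le> 4 * ((3 * K) powr s * (\<rho> powr s) ^ k) * C" using C(2)[of i] by (intro mult_left_mono) auto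
    finally show "\<bar>Ew i (\<lambda>u. Ew k (\<lambda>w. joint_close \<epsilon> \<epsilon>' u w)) - Ew i (pair_close \<epsilon>) * Ew k (pair_close \<epsilon>')\<bar>
      \<le> 4 * ((3 * K) powr s * C) * (\<rho> powr s) ^ k" by (simp add: mult_ac)
  qed
qed

text \<open>
  The density is at most one plus its variation. So the distance of the two points falls into a range of width \<open>\<delta>\<close> with probability at most
  \<open>2 * \<delta> * (1 + variation)\<close>, and the moment of the variation turns this into a Hoelder bound that is uniform in time.
\<close>

theorem pair_close_modulus:
  assumes L: "lyapunov_exponent M N p0 > 0"
  obtains C s where "0 < C" "0 < s"
    "\<And>\<epsilon> \<delta> i. 0 \<le> \<epsilon> \<Longrightarrow> 0 \<le> \<delta> \<Longrightarrow> Ew i (pair_close (\<epsilon> + \<delta>)) - Ew i (pair_close \<epsilon>) \<le> C * \<delta> powr s"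
proof -
  obtain s where s: "0 < s" "s \<le> 1" "rate s < 1" using rate_lt_1[OF L] by blast
  obtain C where C: "0 < C" "\<And>n. Ew n (\<lambda>w. (1 + density_var w) powr s) \<le> C"
    using density_var_moment[OF s] by blast
  show thesis
  proof (rule that[of "2 powr s * C" s])
    show "0 < 2 powr s * C" using C by simp
    fix \<epsilon> \<delta> :: real and i :: nat assume e: "0 \<le> \<epsilon>" "0 \<le> \<delta>"
    have "pair_close (\<epsilon> + \<delta>) u - pair_close \<epsilon> u \<le> (2 * \<delta>) powr s * (1 + density_var u) powr s" if u: "set u \<subseteq> {0..M}" for u
    proof -
      let ?v = "density_var u"
      have v0: "0 \<le> ?v" by (rule density_var_nonneg[OF u])
      have ic: "integrable lam (\<lambda>x. push_density u x * near a x y)" for a y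
        by (rule density_integrable_times[OF u, where D=1]) (auto intro: near_bounds)
      have mb: "\<bar>local_mass u a y\<bar> \<le> 1" for a y using local_mass_bounds[OF u, of a y] by simp
      have im: "integrable lam (\<lambda>y. push_density u y * local_mass u a y)" for a
        by (rule density_integrable_times[OF u, where D=1]) (auto intro: mb)
      define m where "m = min 1 (2 * \<delta> * (1 + ?v))"
      have diff: "local_mass u (\<epsilon> + \<delta>) y - local_mass u \<epsilon> y \<le> m" for y
      proof -
        let ?b = "frac y"
        have "local_mass u (\<epsilon> + \<delta>) y - local_mass u \<epsilon> y = (\<integral>x. push_density u x * near (\<epsilon> + \<delta>) x y - push_density u x * near \<epsilon> x y \<partial>lam)"
          using ic by (simp add: local_mass_def)
        also have "\<dots> \<le> (\<integral>x. (1 + ?v) * (indicator {?b - \<epsilon> - \<delta>..?b - \<epsilon>} x + indicator {?b + \<epsilon>..?b + \<epsilon> + \<delta>} x) \<partial>lam)"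
        proof (rule integral_lam_mono)
          show "integrable lam (\<lambda>x. push_density u x * near (\<epsilon> + \<delta>) x y - push_density u x * near \<epsilon> x y)" using ic by simp
          show "integrable lam (\<lambda>x. (1 + ?v) * (indicator {?b - \<epsilon> - \<delta>..?b - \<epsilon>} x + indicator {?b + \<epsilon>..?b + \<epsilon> + \<delta>} x))"
            using v0 by (intro integrable_lam_bounded[where C="(1 + ?v) * 2"]) (auto simp: indicator_def)
          fix x :: real assume x: "0 \<le> x" "x < 1"
          have d: "near (\<epsilon> + \<delta>) x y - near \<epsilon> x y \<le> indicator {?b - \<epsilon> - \<delta>..?b - \<epsilon>} x + indicator {?b + \<epsilon>..?b + \<epsilon> + \<delta>} x"
            using x by (auto simp: near_def frac_eq indicator_def)
          have "push_density u x * near (\<epsilon> + \<delta>) x y - push_density u x * near \<epsilon> x y = push_density u x * (near (\<epsilon> + \<delta>) x y - near \<epsilon> x y)"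
            by (simp add: right_diff_distrib)
          also have "\<dots> \<le> push_density u x * (indicator {?b - \<epsilon> - \<delta>..?b - \<epsilon>} x + indicator {?b + \<epsilon>..?b + \<epsilon> + \<delta>} x)"
            by (rule mult_left_mono[OF d density_nonneg])
          also have "\<dots> \<le> (1 + ?v) * (indicator {?b - \<epsilon> - \<delta>..?b - \<epsilon>} x + indicator {?b + \<epsilon>..?b + \<epsilon> + \<delta>} x)"
            by (intro mult_right_mono density_le[OF u]) auto
          finally show "push_density u x * near (\<epsilon> + \<delta>) x y - push_density u x * near \<epsilon> x y
            \<le> (1 + ?v) * (indicator {?b - \<epsilon> - \<delta>..?b - \<epsilon>} x + indicator {?b + \<epsilon>..?b + \<epsilon> + \<delta>} x)" .
        qed
        also have "\<dots> = (1 + ?v) * (measure lam {?b - \<epsilon> - \<delta>..?b - \<epsilon>} + measure lam {?b + \<epsilon>..?b + \<epsilon> + \<delta>})"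
          by (subst integral_mult_right_zero, subst Bochner_Integration.integral_add)
             (auto intro!: integrable_lam_bounded[where C=1])
        also have "\<dots> \<le> (1 + ?v) * (\<delta> + \<delta>)"
          using measure_lam_interval[of "?b - \<epsilon> - \<delta>" "?b - \<epsilon>"] measure_lam_interval[of "?b + \<epsilon>" "?b + \<epsilon> + \<delta>"] e v0
          by (intro mult_left_mono add_mono) auto
        finally have "local_mass u (\<epsilon> + \<delta>) y - local_mass u \<epsilon> y \<le> 2 * \<delta> * (1 + ?v)" by (simp add: algebra_simps)
        moreover have "local_mass u (\<epsilon> + \<delta>) y - local_mass u \<epsilon> y \<le> 1"
          using local_mass_bounds[OF u, of "\<epsilon> + \<delta>" y] local_mass_bounds[OF u, of \<epsilon> y] by linarith
        ultimately show ?thesis by (simp add: m_def)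
      qed
      have "pair_close (\<epsilon> + \<delta>) u - pair_close \<epsilon> u = (\<integral>y. push_density u y * local_mass u (\<epsilon> + \<delta>) y - push_density u y * local_mass u \<epsilon> y \<partial>lam)"
        using im by (simp add: pair_close_density[OF u])
      also have "\<dots> \<le> (\<integral>y. push_density u y * m \<partial>lam)"
      proof (rule integral_lam_mono)
        show "integrable lam (\<lambda>y. push_density u y * m)" by (rule density_integrable_times[OF u, of _ "\<bar>m\<bar>"]) auto
        show "push_density u y * local_mass u (\<epsilon> + \<delta>) y - push_density u y * local_mass u \<epsilon> y \<le> push_density u y * m" for y
          using mult_left_mono[OF diff[of y] density_nonneg[of u y]] by (simp add: right_diff_distrib)
      qed (use im in auto)
      also have "\<dots> = m" using integral_push_density[OF u] by simp
      also have "m \<le> (2 * \<delta> * (1 + ?v)) powr s" unfolding m_def using s e v0 by (intro min_1_powr) auto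
      also have "\<dots> = (2 * \<delta>) powr s * (1 + ?v) powr s" using e v0 by (simp add: powr_mult)
      finally show ?thesis .
    qed
    then have "Ew i (\<lambda>u. pair_close (\<epsilon> + \<delta>) u - pair_close \<epsilon> u) \<le> Ew i (\<lambda>u. (2 * \<delta>) powr s * (1 + density_var u) powr s)"
      by (intro W.avg_mono)
    also have "\<dots> = (2 * \<delta>) powr s * Ew i (\<lambda>u. (1 + density_var u) powr s)" by (rule W.avg_cmult)
    also have "\<dots> \<le> (2 * \<delta>) powr s * C" using C(2)[of i] by (intro mult_left_mono) auto
    also have "\<dots> = 2 powr s * C * \<delta> powr s" using e by (simp add: powr_mult mult_ac)
    finally show "Ew i (pair_close (\<epsilon> + \<delta>)) - Ew i (pair_close \<epsilon>) \<le> 2 powr s * C * \<delta> powr s"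
      by (simp add: W.avg_diff)
  qed (rule s)
qed

end

section \<open>Almost sure frequencies\<close>

lemma average_along_squares:
  fixes S :: "nat \<Rightarrow> real"
  assumes mono: "mono S" and nonneg: "0 \<le> S 0"
    and lim: "(\<lambda>m. S (m\<^sup>2) / (real m)\<^sup>2) \<longlonglongrightarrow> P"
  shows "(\<lambda>n. S n / real n) \<longlonglongrightarrow> P"
proof -
  define r where "r n = nat \<lfloor>sqrt (real n)\<rfloor>" for n
  have r: "(r n)\<^sup>2 \<le> n" "n \<le> (Suc (r n))\<^sup>2" for n
  proof -
    have le: "real (r n) \<le> sqrt (real n)" "sqrt (real n) \<le> real (Suc (r n))"
      unfolding r_def by (simp_all) linarith
    have "(real (r n))\<^sup>2 \<le> (sqrt (real n))\<^sup>2" using le by (intro power_mono) auto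
    then have "real ((r n)\<^sup>2) \<le> real n" by simp
    then show "(r n)\<^sup>2 \<le> n" by (simp only: of_nat_le_iff)
    have "(sqrt (real n))\<^sup>2 \<le> (real (Suc (r n)))\<^sup>2" using le by (intro power_mono) auto
    then have "real n \<le> real ((Suc (r n))\<^sup>2)" by simp
    then show "n \<le> (Suc (r n))\<^sup>2" by (simp only: of_nat_le_iff)
  qed
  have r_lim: "filterlim r at_top sequentially"
    unfolding r_def
    by (intro filterlim_compose[OF filterlim_nat_sequentially] filterlim_compose[OF filterlim_floor_sequentially]
        filterlim_compose[OF sqrt_at_top] filterlim_real_sequentially)
  have S0: "0 \<le> S n" for n using nonneg monoD[OF mono, of 0 n] by simp
  have ratio: "(\<lambda>m. (real (Suc m))\<^sup>2 / (real m)\<^sup>2) \<longlonglongrightarrow> 1"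
  proof -
    have "(\<lambda>m. real (Suc m) / real m) \<longlonglongrightarrow> 1" by (rule LIMSEQ_Suc_n_over_n)
    from tendsto_power[OF this, of 2] show ?thesis by (simp add: power_divide)
  qed
  define lo where "lo m = S (m\<^sup>2) / (real m)\<^sup>2 / ((real (Suc m))\<^sup>2 / (real m)\<^sup>2)" for m
  define hi where "hi m = S ((Suc m)\<^sup>2) / (real (Suc m))\<^sup>2 * ((real (Suc m))\<^sup>2 / (real m)\<^sup>2)" for m
  have "lo \<longlonglongrightarrow> P / 1" unfolding lo_def by (intro tendsto_divide lim ratio) simp
  then have lo: "(\<lambda>n. lo (r n)) \<longlonglongrightarrow> P" using filterlim_compose[OF _ r_lim, of lo] by simp
  have "hi \<longlonglongrightarrow> P * 1" unfolding hi_def using LIMSEQ_Suc[OF lim] by (intro tendsto_mult ratio) simp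
  then have hi: "(\<lambda>n. hi (r n)) \<longlonglongrightarrow> P" using filterlim_compose[OF _ r_lim, of hi] by simp
  have ev: "eventually (\<lambda>n. 0 < r n \<and> 0 < n) sequentially"
    using eventually_compose_filterlim[OF eventually_gt_at_top[of 0] r_lim] eventually_gt_at_top[of 0] by (rule eventually_conj)
  show ?thesis
  proof (rule tendsto_sandwich[OF _ _ lo hi])
    show "eventually (\<lambda>n. lo (r n) \<le> S n / real n) sequentially"
      using ev
    proof eventually_elim
      case (elim n)
      have "lo (r n) = S ((r n)\<^sup>2) / (real (Suc (r n)))\<^sup>2" using elim by (simp add: lo_def)
      also have "\<dots> \<le> S n / (real (Suc (r n)))\<^sup>2" using monoD[OF mono r(1)] by (intro divide_right_mono) auto
      also have "\<dots> \<le> S n / real n"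
      proof (rule divide_left_mono)
        show "real n \<le> (real (Suc (r n)))\<^sup>2" using r(2)[of n] by (metis of_nat_le_iff of_nat_power)
      qed (use S0 elim in auto)
      finally show ?case .
    qed
    show "eventually (\<lambda>n. S n / real n \<le> hi (r n)) sequentially"
      using ev
    proof eventually_elim
      case (elim n)
      have "S n / real n \<le> S n / (real (r n))\<^sup>2"
      proof (rule divide_left_mono)
        show "(real (r n))\<^sup>2 \<le> real n" using r(1)[of n] by (metis of_nat_le_iff of_nat_power)
      qed (use S0 elim in auto)
      also have "\<dots> \<le> S ((Suc (r n))\<^sup>2) / (real (r n))\<^sup>2" using monoD[OF mono r(2)] by (intro divide_right_mono) auto
      also have "\<dots> = hi (r n)" by (simp add: hi_def)
      finally show ?case .
    qed
  qed
qed

lemma sum_geometric_distance: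
  fixes \<theta> :: real
  assumes "0 < \<theta>" "\<theta> < 1"
  shows "(\<Sum>j<n. \<theta> ^ (if i \<le> j then j - i else i - j)) \<le> 2 / (1 - \<theta>)"
proof -
  have geo: "(\<Sum>m\<in>A. \<theta> ^ m) \<le> 1 / (1 - \<theta>)" if "finite A" for A
  proof -
    have "(\<Sum>m\<in>A. \<theta> ^ m) \<le> (\<Sum>m. \<theta> ^ m)" using assms that by (intro sum_le_suminf summable_geometric) auto
    also have "\<dots> = 1 / (1 - \<theta>)" using assms by (intro suminf_geometric) auto
    finally show ?thesis .
  qed
  have "(\<Sum>j<n. \<theta> ^ (if i \<le> j then j - i else i - j))
    = (\<Sum>j\<in>{j\<in>{..<n}. i \<le> j}. \<theta> ^ (j - i)) + (\<Sum>j\<in>{j\<in>{..<n}. \<not> i \<le> j}. \<theta> ^ (i - j))"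
    by (simp add: if_distrib[of "\<lambda>m. \<theta> ^ m"] sum.If_cases Int_def conj_commute cong: if_cong)
  also have "(\<Sum>j\<in>{j\<in>{..<n}. i \<le> j}. \<theta> ^ (j - i)) = (\<Sum>m\<in>(\<lambda>j. j - i) ` {j\<in>{..<n}. i \<le> j}. \<theta> ^ m)"
    by (subst sum.reindex) (auto simp: inj_on_def)
  also have "\<dots> \<le> 1 / (1 - \<theta>)" by (rule geo) simp
  also have "(\<Sum>j\<in>{j\<in>{..<n}. \<not> i \<le> j}. \<theta> ^ (i - j)) = (\<Sum>m\<in>(\<lambda>j. i - j) ` {j\<in>{..<n}. \<not> i \<le> j}. \<theta> ^ m)"
    by (subst sum.reindex) (auto simp: inj_on_def)
  also have "\<dots> \<le> 1 / (1 - \<theta>)" by (rule geo) simp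
  finally show ?thesis by simp
qed

text \<open>
  Convergence at the rational thresholds extends to all thresholds because the frequencies are monotone in the threshold and the limit is
  continuous.
\<close>

lemma monotone_limits_extend:
  fixes F :: "nat \<Rightarrow> real \<Rightarrow> real" and P :: "real \<Rightarrow> real"
  assumes mono: "\<And>n a b. a \<le> b \<Longrightarrow> F n a \<le> F n b"
    and rat: "\<And>r. r \<in> \<rat> \<Longrightarrow> 0 < r \<Longrightarrow> (\<lambda>n. F n r) \<longlonglongrightarrow> P r"
    and mod: "0 < s" "\<And>\<epsilon> \<delta>. 0 \<le> \<epsilon> \<Longrightarrow> 0 \<le> \<delta> \<Longrightarrow> P (\<epsilon> + \<delta>) - P \<epsilon> \<le> C * \<delta> powr s"
    and \<epsilon>: "0 < \<epsilon>"
  shows "(\<lambda>n. F n \<epsilon>) \<longlonglongrightarrow> P \<epsilon>"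
proof -
  have small: "\<exists>d>0. d < \<epsilon> \<and> (\<forall>\<delta>. 0 \<le> \<delta> \<and> \<delta> < d \<longrightarrow> C * \<delta> powr s < \<eta>)" if \<eta>: "0 < \<eta>" for \<eta>
  proof -
    define d where "d = min (\<epsilon> / 2) ((\<eta> / (\<bar>C\<bar> + 1)) powr (1 / s))"
    have d: "0 < d" "d < \<epsilon>" using \<epsilon> \<eta> by (auto simp: d_def min_def)
    have "C * \<delta> powr s < \<eta>" if \<delta>: "0 \<le> \<delta>" "\<delta> < d" for \<delta>
    proof -
      have "\<delta> powr s < d powr s" using \<delta> mod(1) by (intro powr_less_mono2) auto
      also have "\<dots> \<le> ((\<eta> / (\<bar>C\<bar> + 1)) powr (1 / s)) powr s" using d mod(1) by (intro powr_mono2) (auto simp: d_def)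
      also have "\<dots> = \<eta> / (\<bar>C\<bar> + 1)" using \<eta> mod(1) by (simp add: powr_powr)
      finally have lt: "\<delta> powr s < \<eta> / (\<bar>C\<bar> + 1)" .
      have "C * \<delta> powr s \<le> (\<bar>C\<bar> + 1) * \<delta> powr s" by (intro mult_right_mono) auto
      also have "\<dots> < \<eta>" using lt by (simp add: field_simps)
      finally show ?thesis .
    qed
    then show ?thesis using d by blast
  qed
  show ?thesis
  proof (rule order_tendstoI)
    fix a assume "a < P \<epsilon>"
    then obtain d where d: "0 < d" "d < \<epsilon>" "\<And>\<delta>. 0 \<le> \<delta> \<Longrightarrow> \<delta> < d \<Longrightarrow> C * \<delta> powr s < P \<epsilon> - a"
      using small[of "P \<epsilon> - a"] by auto
    obtain r where r: "r \<in> \<rat>" "\<epsilon> - d < r" "r < \<epsilon>" using Rats_dense_in_real[of "\<epsilon> - d" \<epsilon>] d by auto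
    have "P (r + (\<epsilon> - r)) - P r \<le> C * (\<epsilon> - r) powr s" using r d by (intro mod(2)) auto
    moreover have "C * (\<epsilon> - r) powr s < P \<epsilon> - a" using r by (intro d(3)) auto
    ultimately have "a < P r" by simp
    moreover have "(\<lambda>n. F n r) \<longlonglongrightarrow> P r" using r d by (intro rat) auto
    ultimately have "eventually (\<lambda>n. a < F n r) sequentially" by (simp add: order_tendstoD)
    then show "eventually (\<lambda>n. a < F n \<epsilon>) sequentially"
      by eventually_elim (use mono[of r \<epsilon>] r in \<open>auto intro: less_le_trans\<close>)
  next
    fix a assume "P \<epsilon> < a"
    then obtain d where d: "0 < d" "\<And>\<delta>. 0 \<le> \<delta> \<Longrightarrow> \<delta> < d \<Longrightarrow> C * \<delta> powr s < a - P \<epsilon>"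
      using small[of "a - P \<epsilon>"] by auto
    obtain r where r: "r \<in> \<rat>" "\<epsilon> < r" "r < \<epsilon> + d" using Rats_dense_in_real[of \<epsilon> "\<epsilon> + d"] d by auto
    have "P (\<epsilon> + (r - \<epsilon>)) - P \<epsilon> \<le> C * (r - \<epsilon>) powr s" using r \<epsilon> by (intro mod(2)) auto
    moreover have "C * (r - \<epsilon>) powr s < a - P \<epsilon>" using r by (intro d(2)) auto
    ultimately have "P r < a" by simp
    moreover have "(\<lambda>n. F n r) \<longlonglongrightarrow> P r" using r \<epsilon> by (intro rat) auto
    ultimately have "eventually (\<lambda>n. F n r < a) sequentially" by (simp add: order_tendstoD)
    then show "eventually (\<lambda>n. F n \<epsilon> < a) sequentially"
      by eventually_elim (use mono[of \<epsilon> r] r in \<open>auto intro: le_less_trans\<close>)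
  qed
qed

context random_maps begin

sublocale Q: pair_prob_space \<nu> "lam \<Otimes>\<^sub>M lam" ..

abbreviation "\<mu> \<equiv> \<nu> \<Otimes>\<^sub>M (lam \<Otimes>\<^sub>M lam)"

definition hit :: "real \<Rightarrow> nat \<Rightarrow> (nat \<Rightarrow> nat) \<times> real \<times> real \<Rightarrow> real" where
  "hit \<epsilon> i z = near \<epsilon> (act (prefix_word i (fst z)) (fst (snd z))) (act (prefix_word i (fst z)) (snd (snd z)))"

lemma sets_lam_lam [measurable_cong]: "sets (lam \<Otimes>\<^sub>M lam) = sets (borel \<Otimes>\<^sub>M borel)"
  by (intro sets_pair_measure_cong) auto

lemma hit_measurable [measurable]: "hit \<epsilon> i \<in> borel_measurable (\<nu> \<Otimes>\<^sub>M (borel \<Otimes>\<^sub>M borel))"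
proof -
  have "(\<lambda>z. (\<lambda>w z. near \<epsilon> (act w (fst (snd z))) (act w (snd (snd z)))) (prefix_word i (fst z)) z)
    \<in> borel_measurable (\<nu> \<Otimes>\<^sub>M (borel \<Otimes>\<^sub>M borel))"
    by (rule measurable_compose_countable) measurable
  then show ?thesis unfolding hit_def .
qed

lemma hit_measurable' [measurable]: "hit \<epsilon> i \<in> borel_measurable \<mu>"
proof -
  have "sets \<mu> = sets (\<nu> \<Otimes>\<^sub>M (borel \<Otimes>\<^sub>M borel))" by (intro sets_pair_measure_cong sets_lam_lam refl)
  then show ?thesis using hit_measurable measurable_cong_sets by blast
qed

lemma hit_bounds: "0 \<le> hit \<epsilon> i z" "hit \<epsilon> i z \<le> 1"
  by (auto simp: hit_def near_bounds)

lemma integrable_\<mu>: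
  fixes f :: "(nat \<Rightarrow> nat) \<times> real \<times> real \<Rightarrow> real"
  assumes "f \<in> borel_measurable \<mu>" "\<And>z. \<bar>f z\<bar> \<le> C"
  shows "integrable \<mu> f"
  using assms by (intro Q.P.integrable_const_bound[where B=C]) auto

lemma integral_hit2:
  "(\<integral>z. hit \<epsilon> i z * hit \<epsilon>' (i + k) z \<partial>\<mu>) = Ew i (\<lambda>u. Ew k (\<lambda>w. joint_close \<epsilon> \<epsilon>' u w))"
proof -
  have b: "\<bar>hit \<epsilon> i z * hit \<epsilon>' (i + k) z\<bar> \<le> 1" for z
    unfolding abs_mult using hit_bounds[of \<epsilon> i z] hit_bounds[of \<epsilon>' "i + k" z] by (intro mult_le_one) auto
  define G where "G w = (\<integral>y. (\<integral>x. near \<epsilon> (act (take i w) x) (act (take i w) y) * near \<epsilon>' (act w x) (act w y) \<partial>lam) \<partial>lam)" for w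
  have inner: "(\<integral>p. hit \<epsilon> i (\<omega>, p) * hit \<epsilon>' (i + k) (\<omega>, p) \<partial>(lam \<Otimes>\<^sub>M lam)) = G (prefix_word (i + k) \<omega>)" for \<omega>
  proof -
    define f where "f x y = near \<epsilon> (act (prefix_word i \<omega>) x) (act (prefix_word i \<omega>) y) * near \<epsilon>' (act (prefix_word (i + k) \<omega>) x) (act (prefix_word (i + k) \<omega>) y)" for x y
    have "integrable (lam \<Otimes>\<^sub>M lam) (case_prod f)"
    proof (rule integrable_LL_bounded)
      show "case_prod f \<in> borel_measurable (borel \<Otimes>\<^sub>M borel)" unfolding f_def by measurable
      show "\<bar>case_prod f p\<bar> \<le> 1" for p
        unfolding f_def case_prod_beta abs_mult by (intro mult_le_one near_bounds) auto
    qed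
    from LL.integral_snd[OF this]
    have "(\<integral>p. case_prod f p \<partial>(lam \<Otimes>\<^sub>M lam)) = (\<integral>y. (\<integral>x. f x y \<partial>lam) \<partial>lam)" by simp
    moreover have "(\<lambda>p. hit \<epsilon> i (\<omega>, p) * hit \<epsilon>' (i + k) (\<omega>, p)) = case_prod f"
      by (auto simp: fun_eq_iff hit_def f_def)
    ultimately show ?thesis by (simp add: G_def f_def take_prefix_word)
  qed
  have "integrable \<mu> (\<lambda>z. hit \<epsilon> i z * hit \<epsilon>' (i + k) z)" by (rule integrable_\<mu>[OF _ b]) measurable
  from Q.integral_fst'[OF this]
  have "(\<integral>z. hit \<epsilon> i z * hit \<epsilon>' (i + k) z \<partial>\<mu>) = (\<integral>\<omega>. (\<integral>p. hit \<epsilon> i (\<omega>, p) * hit \<epsilon>' (i + k) (\<omega>, p) \<partial>(lam \<Otimes>\<^sub>M lam)) \<partial>\<nu>)" by simp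
  also have "\<dots> = (\<integral>\<omega>. G (prefix_word (i + k) \<omega>) \<partial>\<nu>)" unfolding inner ..
  also have "(\<integral>\<omega>. G (prefix_word (i + k) \<omega>) \<partial>\<nu>) = Ew (i + k) G" by (rule integral_prefix)
  also have "\<dots> = Ew i (\<lambda>u. Ew k (\<lambda>w. joint_close \<epsilon> \<epsilon>' u w))"
    unfolding W.avg_append by (intro W.avg_cong) (simp add: G_def joint_close_def)
  finally show ?thesis .
qed

lemma near_2: "near 2 x y = 1"
proof -
  have "\<bar>frac x - frac y\<bar> < 2"
    using frac_ge_0[of x] frac_lt_1[of x] frac_ge_0[of y] frac_lt_1[of y] by linarith
  then show ?thesis by (simp add: near_def)
qed

lemma joint_close_2: "joint_close 2 \<epsilon> u w = pair_close \<epsilon> (u @ w)"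
  by (simp add: joint_close_def pair_close_def near_2)

lemma pair_close_2: "pair_close 2 = (\<lambda>_. 1)" by (simp add: fun_eq_iff pair_close_def near_2)

lemma integral_hit: "(\<integral>z. hit \<epsilon> j z \<partial>\<mu>) = Ew j (pair_close \<epsilon>)"
proof -
  have "hit 2 0 z = 1" for z by (simp add: hit_def near_2)
  then show ?thesis using integral_hit2[of 2 0 \<epsilon> j] by (simp add: joint_close_2)
qed

lemma hit_eq_close_freq:
  assumes "\<omega> \<in> space \<nu>" "0 \<le> x" "x < 1" "0 \<le> y" "y < 1"
  shows "close_freq M N \<omega> x y \<epsilon> n = (\<Sum>i<n. hit \<epsilon> i (\<omega>, x, y)) / real n"
proof -
  have "hit \<epsilon> i (\<omega>, x, y) = of_bool (orbit_dist M N \<omega> x y i < \<epsilon>)" for i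
  proof -
    have "0 \<le> act (prefix_word i \<omega>) x \<and> act (prefix_word i \<omega>) x < 1" "0 \<le> act (prefix_word i \<omega>) y \<and> act (prefix_word i \<omega>) y < 1"
      using assms by (auto intro!: act_unit[THEN conjunct1] act_unit[THEN conjunct2] set_prefix_word)
    then show ?thesis by (simp add: hit_def near_def orbit_dist_def compos_eq_act frac_eq)
  qed
  then have "(\<Sum>i<n. hit \<epsilon> i (\<omega>, x, y)) = (\<Sum>i<n. of_bool (orbit_dist M N \<omega> x y i < \<epsilon>))" by simp
  also have "\<dots> = real (card ({..<n} \<inter> {i. orbit_dist M N \<omega> x y i < \<epsilon>}))" by (simp add: sum_of_bool_eq)
  also have "{..<n} \<inter> {i. orbit_dist M N \<omega> x y i < \<epsilon>} = {i. 0 \<le> i \<and> i < n \<and> orbit_dist M N \<omega> x y i < \<epsilon>}" by auto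
  finally show ?thesis by (simp add: close_freq_def)
qed

definition limit_freq :: "real \<Rightarrow> real" where "limit_freq \<epsilon> = lim (\<lambda>k. Ew k (pair_close \<epsilon>))"

text \<open>
  Exponential decorrelation bounds the variance of the sum of the first \<open>n\<close> indicators by a multiple of \<open>n\<close>. By Chebyshev's inequality and the
  Borel-Cantelli lemma the averages converge along the squares, and by monotonicity of the sums along all \<open>n\<close>.
\<close>

theorem hit_average_converges:
  assumes L: "lyapunov_exponent M N p0 > 0"
  shows "(\<lambda>k. Ew k (pair_close \<epsilon>)) \<longlonglongrightarrow> limit_freq \<epsilon>"
    and "AE z in \<mu>. (\<lambda>n. (\<Sum>i<n. hit \<epsilon> i z) / real n) \<longlonglongrightarrow> limit_freq \<epsilon>"
proof -
  obtain K \<theta> where K: "0 < K" "0 < \<theta>" "\<theta> < 1"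
    and dec: "\<And>\<epsilon> \<epsilon>' i k. \<bar>Ew i (\<lambda>u. Ew k (\<lambda>w. joint_close \<epsilon> \<epsilon>' u w)) - Ew i (pair_close \<epsilon>) * Ew k (pair_close \<epsilon>')\<bar> \<le> K * \<theta> ^ k"
    using decorrelation[OF L] by blast
  define c where "c k = Ew k (pair_close \<epsilon>)" for k
  define P where "P = limit_freq \<epsilon>"
  have c01: "0 \<le> c k" "c k \<le> 1" for k
  proof -
    have "0 \<le> (\<integral>z. hit \<epsilon> k z \<partial>\<mu>)" by (intro Bochner_Integration.integral_nonneg hit_bounds)
    then show "0 \<le> c k" by (simp add: c_def integral_hit)
    have "(\<integral>z. hit \<epsilon> k z \<partial>\<mu>) \<le> (\<integral>z. 1 \<partial>\<mu>)"
      by (intro integral_mono integrable_\<mu>[where C=1]) (use hit_bounds[of \<epsilon> k] in auto)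
    then show "c k \<le> 1" by (simp add: c_def integral_hit Q.P.prob_space)
  qed
  \<comment> \<open>With the threshold \<open>2\<close> the condition at time \<open>i\<close> is void, so decorrelation says that the law of the distance after \<open>k\<close> further steps
    hardly depends on \<open>i\<close>.\<close>
  have shift: "\<bar>c (i + k) - c k\<bar> \<le> K * \<theta> ^ k" for i k
    using dec[of i k 2 \<epsilon>] by (simp add: joint_close_2 pair_close_2 W.avg_const c_def W.avg_append[symmetric])
  have "Cauchy c"
  proof (rule metric_CauchyI)
    fix e :: real assume e: "0 < e"
    have "(\<lambda>k. K * \<theta> ^ k) \<longlonglongrightarrow> K * 0" using K by (intro tendsto_intros LIMSEQ_realpow_zero) auto
    then have "eventually (\<lambda>k. K * \<theta> ^ k < e / 2) sequentially" using e by (intro order_tendstoD) auto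
    then obtain k where k: "K * \<theta> ^ k < e / 2" by (auto simp: eventually_sequentially)
    have "dist (c m) (c n) < e" if "k \<le> m" "k \<le> n" for m n
      using shift[of "m - k" k] shift[of "n - k" k] that k unfolding dist_real_def by simp
    then show "\<exists>M. \<forall>m\<ge>M. \<forall>n\<ge>M. dist (c m) (c n) < e" by blast
  qed
  then have "convergent c" by (rule Cauchy_convergent)
  then have cP: "c \<longlonglongrightarrow> P" unfolding P_def limit_freq_def c_def by (simp add: convergent_LIMSEQ_iff)
  then show "(\<lambda>k. Ew k (pair_close \<epsilon>)) \<longlonglongrightarrow> limit_freq \<epsilon>" unfolding c_def P_def .
  have cP_rate: "\<bar>c k - P\<bar> \<le> K * \<theta> ^ k" for k
  proof -
    have "(\<lambda>i. \<bar>c (i + k) - c k\<bar>) \<longlonglongrightarrow> \<bar>P - c k\<bar>"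
      by (intro tendsto_intros LIMSEQ_ignore_initial_segment cP)
    then have "\<bar>P - c k\<bar> \<le> K * \<theta> ^ k" by (rule LIMSEQ_le_const2) (use shift in auto)
    then show ?thesis by (simp add: abs_minus_commute)
  qed
  have P01: "0 \<le> P" "P \<le> 1" using cP c01 by (auto intro: LIMSEQ_le_const LIMSEQ_le_const2)
  define Y where "Y i z = hit \<epsilon> i z - P" for i z
  have [measurable]: "Y i \<in> borel_measurable \<mu>" for i unfolding Y_def by measurable
  have Y1: "\<bar>Y i z\<bar> \<le> 1" for i z using hit_bounds[of \<epsilon> i z] P01 by (auto simp: Y_def)
  have YY1: "\<bar>Y i z * Y j z\<bar> \<le> 1" for i j z unfolding abs_mult by (intro mult_le_one Y1) auto
  have unit_mult: "a * b \<le> \<bar>b\<bar>" if "0 \<le> a" "a \<le> 1" for a b :: real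
    by (rule order_trans[OF mult_left_mono[of b "\<bar>b\<bar>" a] mult_left_le_one_le]) (use that in auto)
  have cov1: "(\<integral>z. Y i z * Y (i + k) z \<partial>\<mu>) \<le> 3 * K * \<theta> ^ k" for i k
  proof -
    have ih: "integrable \<mu> (hit \<epsilon> j)" for j using hit_bounds[of \<epsilon> j] by (intro integrable_\<mu>[where C=1]) auto
    have ihh: "integrable \<mu> (\<lambda>z. hit \<epsilon> i z * hit \<epsilon> (i + k) z)"
    proof (rule integrable_\<mu>)
      show "\<bar>hit \<epsilon> i z * hit \<epsilon> (i + k) z\<bar> \<le> 1" for z
        unfolding abs_mult using hit_bounds[of \<epsilon> i z] hit_bounds[of \<epsilon> "i + k" z] by (intro mult_le_one) auto
    qed measurable
    have "(\<integral>z. Y i z * Y (i + k) z \<partial>\<mu>) = (\<integral>z. hit \<epsilon> i z * hit \<epsilon> (i + k) z - P * hit \<epsilon> i z - P * hit \<epsilon> (i + k) z + P * P \<partial>\<mu>)"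
      by (intro Bochner_Integration.integral_cong refl) (simp add: Y_def algebra_simps)
    also have "\<dots> = (\<integral>z. hit \<epsilon> i z * hit \<epsilon> (i + k) z \<partial>\<mu>) - P * c i - P * c (i + k) + P * P"
      using ih ihh by (simp add: integral_hit c_def Q.P.prob_space)
    also have "\<dots> = ((\<integral>z. hit \<epsilon> i z * hit \<epsilon> (i + k) z \<partial>\<mu>) - c i * c k) + c i * (c k - P) + P * (P - c (i + k))"
      by (simp add: algebra_simps)
    also have "\<dots> \<le> K * \<theta> ^ k + K * \<theta> ^ k + K * \<theta> ^ k"
    proof (intro add_mono)
      show "(\<integral>z. hit \<epsilon> i z * hit \<epsilon> (i + k) z \<partial>\<mu>) - c i * c k \<le> K * \<theta> ^ k"
        using dec[of i k \<epsilon> \<epsilon>] by (simp add: integral_hit2 c_def)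
      have "c i * (c k - P) \<le> \<bar>c k - P\<bar>" using c01[of i] by (rule unit_mult)
      then show "c i * (c k - P) \<le> K * \<theta> ^ k" using cP_rate[of k] by simp
      have "P * (P - c (i + k)) \<le> \<bar>P - c (i + k)\<bar>" using P01 by (rule unit_mult)
      moreover have "\<theta> ^ (i + k) \<le> \<theta> ^ k" using K by (intro power_decreasing) auto
      then have "K * \<theta> ^ (i + k) \<le> K * \<theta> ^ k" using K by (intro mult_left_mono) auto
      ultimately show "P * (P - c (i + k)) \<le> K * \<theta> ^ k" using cP_rate[of "i + k"] by linarith
    qed
    finally show ?thesis by simp
  qed
  have cov: "(\<integral>z. Y i z * Y j z \<partial>\<mu>) \<le> 3 * K * \<theta> ^ (if i \<le> j then j - i else i - j)" for i j
    using cov1[of i "j - i"] cov1[of j "i - j"] by (auto simp: mult.commute)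
  define D where "D = 6 * K / (1 - \<theta>)"
  have D0: "0 < D" using K by (simp add: D_def)
  have var: "(\<integral>z. (\<Sum>i<n. Y i z)\<^sup>2 \<partial>\<mu>) \<le> D * real n" for n
  proof -
    have "(\<integral>z. (\<Sum>i<n. Y i z)\<^sup>2 \<partial>\<mu>) = (\<integral>z. (\<Sum>i<n. \<Sum>j<n. Y i z * Y j z) \<partial>\<mu>)"
      by (simp add: power2_eq_square sum_product)
    also have "\<dots> = (\<Sum>i<n. \<Sum>j<n. \<integral>z. Y i z * Y j z \<partial>\<mu>)"
      by (simp add: Bochner_Integration.integral_sum integrable_\<mu>[OF _ YY1])
    also have "\<dots> \<le> (\<Sum>i<n. \<Sum>j<n. 3 * K * \<theta> ^ (if i \<le> j then j - i else i - j))" by (intro sum_mono cov)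
    also have "\<dots> \<le> (\<Sum>i<n. 3 * K * (2 / (1 - \<theta>)))"
      unfolding sum_distrib_left[symmetric] using K
      by (intro sum_mono mult_left_mono sum_geometric_distance) auto
    also have "\<dots> = D * real n" by (simp add: D_def)
    finally show ?thesis .
  qed
  define A where "A m z = (\<Sum>i<m\<^sup>2. Y i z) / (real m)\<^sup>2" for m z
  have [measurable]: "A m \<in> borel_measurable \<mu>" for m unfolding A_def by measurable
  have "AE z in \<mu>. eventually (\<lambda>m. \<bar>A m z\<bar> < \<eta>) sequentially" if \<eta>: "0 < \<eta>" for \<eta>
  proof -
    define B where "B m = {z \<in> space \<mu>. \<eta> \<le> \<bar>A m z\<bar>}" for m
    have Bm [measurable]: "B m \<in> sets \<mu>" for m unfolding B_def by measurable
    have bound: "measure \<mu> (B m) \<le> D / \<eta>\<^sup>2 * (1 / (real m)\<^sup>2)" if m: "0 < m" for m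
    proof -
      have sb: "\<bar>\<Sum>i<m\<^sup>2. Y i z\<bar> \<le> real (m\<^sup>2)" for z
      proof -
        have "\<bar>\<Sum>i<m\<^sup>2. Y i z\<bar> \<le> (\<Sum>i<m\<^sup>2. \<bar>Y i z\<bar>)" by (rule sum_abs)
        also have "\<dots> \<le> (\<Sum>i<m\<^sup>2. 1)" by (intro sum_mono Y1)
        finally show ?thesis by simp
      qed
      have "B m \<inter> space \<mu> = B m" by (auto simp: B_def)
      then have "measure \<mu> (B m) = (\<integral>z. indicator (B m) z \<partial>\<mu>)" by simp
      also have "\<dots> \<le> (\<integral>z. (\<Sum>i<m\<^sup>2. Y i z)\<^sup>2 / (\<eta> * (real m)\<^sup>2)\<^sup>2 \<partial>\<mu>)"
      proof (rule integral_mono)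
        show "integrable \<mu> (indicator (B m) :: _ \<Rightarrow> real)" by (rule integrable_\<mu>[where C=1]) (auto simp: indicator_def)
        have "integrable \<mu> (\<lambda>z. (\<Sum>i<m\<^sup>2. Y i z)\<^sup>2)"
        proof (rule integrable_\<mu>)
          show "\<bar>(\<Sum>i<m\<^sup>2. Y i z)\<^sup>2\<bar> \<le> (real (m\<^sup>2))\<^sup>2" for z
            using power_mono[OF sb[of z], of 2] by simp
        qed measurable
        then show "integrable \<mu> (\<lambda>z. (\<Sum>i<m\<^sup>2. Y i z)\<^sup>2 / (\<eta> * (real m)\<^sup>2)\<^sup>2)" by simp
        fix z
        show "indicator (B m) z \<le> (\<Sum>i<m\<^sup>2. Y i z)\<^sup>2 / (\<eta> * (real m)\<^sup>2)\<^sup>2"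
        proof (cases "z \<in> B m")
          case True
          then have "\<eta> \<le> \<bar>\<Sum>i<m\<^sup>2. Y i z\<bar> / (real m)\<^sup>2" by (auto simp: B_def A_def)
          then have "\<eta> * (real m)\<^sup>2 \<le> \<bar>\<Sum>i<m\<^sup>2. Y i z\<bar>" using m by (simp add: field_simps)
          then have "(\<eta> * (real m)\<^sup>2)\<^sup>2 \<le> (\<Sum>i<m\<^sup>2. Y i z)\<^sup>2" using \<eta> power_mono[of "\<eta> * (real m)\<^sup>2" "\<bar>\<Sum>i<m\<^sup>2. Y i z\<bar>" 2] by simp
          moreover have "0 < (\<eta> * (real m)\<^sup>2)\<^sup>2" using \<eta> m by simp
          ultimately show ?thesis using True by (simp add: le_divide_eq)
        qed simp
      qed
      also have "\<dots> = (\<integral>z. (\<Sum>i<m\<^sup>2. Y i z)\<^sup>2 \<partial>\<mu>) / (\<eta> * (real m)\<^sup>2)\<^sup>2" by simp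
      also have "\<dots> \<le> (D * real (m\<^sup>2)) / (\<eta> * (real m)\<^sup>2)\<^sup>2" by (intro divide_right_mono var) auto
      also have "\<dots> = D / \<eta>\<^sup>2 * (1 / (real m)\<^sup>2)" using m \<eta> by (simp add: power_mult_distrib field_simps power2_eq_square)
      finally show ?thesis .
    qed
    have sum: "summable (\<lambda>m. D / \<eta>\<^sup>2 * (1 / (real m)\<^sup>2))"
      using inverse_power_summable[of 2, where 'a=real] by (intro summable_mult) (simp add: divide_inverse)
    have sumB: "summable (\<lambda>m. measure \<mu> (B m))"
    proof (rule summable_comparison_test_ev[OF _ sum])
      show "eventually (\<lambda>m. norm (measure \<mu> (B m)) \<le> D / \<eta>\<^sup>2 * (1 / (real m)\<^sup>2)) sequentially"
        using eventually_gt_at_top[of 0] by eventually_elim (use bound in simp)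
    qed
    have "emeasure \<mu> (B m) < \<infinity>" for m by (simp add: Q.P.emeasure_eq_measure)
    from borel_cantelli_AE1[OF Bm this sumB]
    have "AE z in \<mu>. eventually (\<lambda>m. z \<in> space \<mu> - B m) sequentially" .
    then show ?thesis by (eventually_elim, elim eventually_mono) (auto simp: B_def not_le)
  qed
  then have "AE z in \<mu>. \<forall>j. eventually (\<lambda>m. \<bar>A m z\<bar> < inverse (real (Suc j))) sequentially"
    by (subst AE_all_countable) auto
  then show "AE z in \<mu>. (\<lambda>n. (\<Sum>i<n. hit \<epsilon> i z) / real n) \<longlonglongrightarrow> limit_freq \<epsilon>"
  proof eventually_elim
    case (elim z)
    have "(\<lambda>m. A m z) \<longlonglongrightarrow> 0"
    proof (rule tendstoI)
      fix e :: real assume "0 < e"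
      then obtain j where j: "inverse (real (Suc j)) < e" using reals_Archimedean by blast
      from elim[rule_format, of j] show "eventually (\<lambda>m. dist (A m z) 0 < e) sequentially"
        by eventually_elim (use j in simp)
    qed
    then have "(\<lambda>m. A m z + P) \<longlonglongrightarrow> 0 + P" by (intro tendsto_intros)
    moreover have "eventually (\<lambda>m. A m z + P = (\<Sum>i<m\<^sup>2. hit \<epsilon> i z) / (real m)\<^sup>2) sequentially"
      using eventually_gt_at_top[of 0] by eventually_elim (simp add: A_def Y_def sum_subtractf field_simps)
    ultimately have "(\<lambda>m. (\<Sum>i<m\<^sup>2. hit \<epsilon> i z) / (real m)\<^sup>2) \<longlonglongrightarrow> P" by (simp add: filterlim_cong)
    then have "(\<lambda>n. (\<Sum>i<n. hit \<epsilon> i z) / real n) \<longlonglongrightarrow> P"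
      by (intro average_along_squares) (auto intro!: monoI sum_mono2 hit_bounds)
    then show ?case by (simp add: P_def)
  qed
qed

text \<open>
  Both measures are Lebesgue measure on the unit square; they differ in their \<open>\<sigma>\<close>-algebras, one on the plane and one on the square.
\<close>

lemma AE_unit_square:
  assumes "AE p in lam \<Otimes>\<^sub>M lam. R p" and R: "Measurable.pred (borel \<Otimes>\<^sub>M borel) R"
  shows "AE p in unit_square_measure. R p"
proof -
  note R[measurable]
  have sq [measurable]: "{0..<1::real} \<times> {0..<1::real} \<in> sets (borel \<Otimes>\<^sub>M (borel :: real measure))"
    by (rule pair_measureI) auto
  have pr: "Measurable.pred (borel \<Otimes>\<^sub>M borel) (\<lambda>p :: real \<times> real. p \<in> {0..<1} \<times> {0..<1} \<longrightarrow> R p)"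
    by measurable
  have "AE x in lam. AE y in lam. R (x, y)" using LL.AE_pair[OF assms(1)] .
  then have "AE x in lborel. x \<in> {0..<1} \<longrightarrow> (AE y in lborel. y \<in> {0..<1} \<longrightarrow> R (x, y))"
    unfolding unit_lebesgue_def by (simp add: AE_density indicator_def)
  then have "AE x in lborel. AE y in lborel. (x, y) \<in> {0..<1} \<times> {0..<1} \<longrightarrow> R (x, y)"
    by eventually_elim auto
  then have "AE p in lborel \<Otimes>\<^sub>M lborel. p \<in> {0..<1} \<times> {0..<1} \<longrightarrow> R p"
    using pr by (intro lborel_pair.AE_pair_measure) (auto simp: space_pair_measure pred_def simp del: mem_Times_iff cong: measurable_cong_sets sets_pair_measure_cong)
  then have "AE p in lborel. p \<in> {0..<1} \<times> {0..<1} \<longrightarrow> R p" by (simp only: lborel_prod)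
  moreover have "{0..<1} \<times> {0..<1} \<in> sets (lborel :: (real \<times> real) measure)"
    using sq by (simp only: borel_prod sets_lborel)
  ultimately show ?thesis unfolding unit_square_measure_def by (subst AE_restrict_space_iff) auto
qed

theorem frequencies_converge:
  assumes L: "lyapunov_exponent M N p0 > 0"
  shows "AE (\<omega>, x, y) in \<nu> \<Otimes>\<^sub>M unit_square_measure.
    \<exists>P :: real \<Rightarrow> real. (\<forall>\<epsilon>>0. (\<lambda>n. close_freq M N \<omega> x y \<epsilon> n) \<longlonglongrightarrow> P \<epsilon>) \<and> (P \<longlongrightarrow> 0) (at_right 0)"
proof -
  \<comment> \<open>Convergence at the positive rational thresholds, written with countable quantifiers so that its measurability is
    evident.\<close>
  define R where "R z \<longleftrightarrow> (\<forall>a b j :: nat. \<exists>m. \<forall>n\<ge>m.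
    \<bar>(\<Sum>i<n. hit (real (Suc a) / real (Suc b)) i z) / real n - limit_freq (real (Suc a) / real (Suc b))\<bar> < inverse (real (Suc j)))" for z
  have R [measurable]: "Measurable.pred (\<nu> \<Otimes>\<^sub>M (borel \<Otimes>\<^sub>M borel)) R" unfolding R_def by measurable
  have "AE z in \<mu>. R z"
    unfolding R_def AE_all_countable
  proof (intro allI)
    fix a b j :: nat
    let ?r = "real (Suc a) / real (Suc b)"
    from hit_average_converges(2)[OF L, of ?r]
    show "AE z in \<mu>. \<exists>m. \<forall>n\<ge>m. \<bar>(\<Sum>i<n. hit ?r i z) / real n - limit_freq ?r\<bar> < inverse (real (Suc j))"
    proof eventually_elim
      case (elim z)
      from LIMSEQ_D[OF elim, of "inverse (real (Suc j))"] show ?case by simp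
    qed
  qed
  then have "AE \<omega> in \<nu>. AE p in lam \<Otimes>\<^sub>M lam. R (\<omega>, p)" by (rule Q.AE_pair)
  with AE_space have "AE \<omega> in \<nu>. AE p in unit_square_measure. R (\<omega>, p)"
  proof eventually_elim
    case (elim \<omega>)
    have "Measurable.pred (borel \<Otimes>\<^sub>M borel) (\<lambda>p. R (\<omega>, p))" using elim(1) by measurable
    then show ?case using elim(2) by (rule AE_unit_square[rotated])
  qed
  moreover interpret US: pair_sigma_finite \<nu> unit_square_measure
  proof -
    have "sigma_finite_measure unit_square_measure"
      unfolding unit_square_measure_def
    proof (intro sigma_finite_measure_restrict_space lborel.sigma_finite_measure_axioms)
      have "{0..<1::real} \<times> {0..<1::real} \<in> sets (borel \<Otimes>\<^sub>M (borel :: real measure))" by (rule pair_measureI) auto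
      then show "{0..<1::real} \<times> {0..<1::real} \<in> sets lborel" by (simp only: borel_prod sets_lborel)
    qed
    then show "pair_sigma_finite \<nu> unit_square_measure"
      by (intro pair_sigma_finite.intro bp.sigma_finite_measure_axioms)
  qed
  have "(\<lambda>p. p) \<in> measurable unit_square_measure (borel \<Otimes>\<^sub>M borel)"
    unfolding unit_square_measure_def borel_prod by (intro measurable_restrict_space1) auto
  then have [measurable]: "(\<lambda>z. (fst z, snd z)) \<in> measurable (\<nu> \<Otimes>\<^sub>M unit_square_measure) (\<nu> \<Otimes>\<^sub>M (borel \<Otimes>\<^sub>M borel))"
    by (intro measurable_Pair measurable_fst measurable_compose[OF measurable_snd])
  have "{z \<in> space (\<nu> \<Otimes>\<^sub>M unit_square_measure). R z} \<in> sets (\<nu> \<Otimes>\<^sub>M unit_square_measure)"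
    using measurable_compose[OF \<open>(\<lambda>z. (fst z, snd z)) \<in> _\<close> R] by (simp add: pred_def)
  ultimately have "AE z in \<nu> \<Otimes>\<^sub>M unit_square_measure. R z" by (intro US.AE_pair_measure)
  moreover have "AE z in \<nu> \<Otimes>\<^sub>M unit_square_measure. z \<in> space (\<nu> \<Otimes>\<^sub>M unit_square_measure)" by (rule AE_space)
  ultimately show ?thesis
  proof eventually_elim
    case (elim z)
    obtain \<omega> x y where z: "z = (\<omega>, x, y)" by (cases z)
    have sp: "\<omega> \<in> space \<nu>" "0 \<le> x" "x < 1" "0 \<le> y" "y < 1"
      using elim(2) by (auto simp: z space_pair_measure unit_square_measure_def space_restrict_space)
    obtain C s where C: "0 < C" "0 < s"
      and mod: "\<And>\<epsilon> \<delta> i. 0 \<le> \<epsilon> \<Longrightarrow> 0 \<le> \<delta> \<Longrightarrow> Ew i (pair_close (\<epsilon> + \<delta>)) - Ew i (pair_close \<epsilon>) \<le> C * \<delta> powr s"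
      using pair_close_modulus[OF L] by blast
    have lmod: "limit_freq (\<epsilon> + \<delta>) - limit_freq \<epsilon> \<le> C * \<delta> powr s" if "0 \<le> \<epsilon>" "0 \<le> \<delta>" for \<epsilon> \<delta>
      using tendsto_diff[OF hit_average_converges(1)[OF L, of "\<epsilon> + \<delta>"] hit_average_converges(1)[OF L, of \<epsilon>]]
      by (rule LIMSEQ_le_const2) (use mod[OF that] in auto)
    have rat: "(\<lambda>n. close_freq M N \<omega> x y r n) \<longlonglongrightarrow> limit_freq r" if r: "r \<in> \<rat>" "0 < r" for r
    proof -
      obtain a b where ab: "r = real (Suc a) / real (Suc b)"
      proof -
        obtain m n where mn: "n \<noteq> 0" "\<bar>r\<bar> = real m / real n" using Rats_abs_nat_div_natE[OF r(1)] by metis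
        then have "0 < m" using r(2) by (cases m) auto
        then show thesis using mn r(2) by (intro that[of "m - 1" "n - 1"]) auto
      qed
      show ?thesis
      proof (rule LIMSEQ_I)
        fix e :: real assume "0 < e"
        then obtain j where j: "inverse (real (Suc j)) < e" using reals_Archimedean by blast
        from elim(1) obtain m where "\<And>n. m \<le> n \<Longrightarrow> \<bar>(\<Sum>i<n. hit r i z) / real n - limit_freq r\<bar> < inverse (real (Suc j))"
          unfolding R_def ab by blast
        then show "\<exists>m. \<forall>n\<ge>m. norm (close_freq M N \<omega> x y r n - limit_freq r) < e"
          using j unfolding hit_eq_close_freq[OF sp] z by (intro exI[of _ m]) (auto intro: less_trans)
      qed
    qed
    have mono: "close_freq M N \<omega> x y a n \<le> close_freq M N \<omega> x y b n" if "a \<le> b" for a b n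
      unfolding close_freq_def using that
      by (intro mult_left_mono of_nat_mono card_mono) auto
    have conv: "(\<lambda>n. close_freq M N \<omega> x y \<epsilon> n) \<longlonglongrightarrow> limit_freq \<epsilon>" if "0 < \<epsilon>" for \<epsilon>
      by (rule monotone_limits_extend[where F="\<lambda>n \<epsilon>. close_freq M N \<omega> x y \<epsilon> n", OF mono rat C(2) lmod that]) auto
    have "(limit_freq \<longlongrightarrow> 0) (at_right 0)"
    proof (rule tendsto_sandwich[OF _ _ tendsto_const])
      have "limit_freq 0 = 0"
      proof -
        have "pair_close 0 = (\<lambda>_. 0)" by (simp add: fun_eq_iff pair_close_def near_def)
        then have "(\<lambda>k. 0) \<longlonglongrightarrow> limit_freq 0" using hit_average_converges(1)[OF L, of 0] by (simp add: W.avg_const)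
        then show ?thesis using LIMSEQ_unique tendsto_const by blast
      qed
      then show "eventually (\<lambda>\<epsilon>. limit_freq \<epsilon> \<le> C * \<epsilon> powr s) (at_right 0)"
        using lmod[of 0] eventually_at_right_less[of 0] by (auto elim!: eventually_mono)
      show "eventually (\<lambda>\<epsilon>. 0 \<le> limit_freq \<epsilon>) (at_right 0)"
        using eventually_at_right_less[of 0]
      proof eventually_elim
        case (elim \<epsilon>)
        show ?case using conv[OF elim] by (rule LIMSEQ_le_const) (auto simp: close_freq_def)
      qed
      have "((\<lambda>\<epsilon>. C * \<epsilon> powr s) \<longlongrightarrow> C * 0 powr s) (at_right 0)"
        using C by (intro tendsto_mult tendsto_const tendsto_powr' tendsto_ident_at) (auto simp: eventually_at_right_less eventually_mono[OF eventually_at_right_less])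
      then show "((\<lambda>\<epsilon>. C * \<epsilon> powr s) \<longlongrightarrow> 0) (at_right 0)" using C by simp
    qed
    then show ?case using conv by (auto simp: z intro!: exI[of _ limit_freq])
  qed
qed

end

theorem theorem1p1:
  fixes M N :: nat and p0 :: real
  assumes "M \<ge> 2" and "N \<ge> 2" and "0 < p0" and "p0 < 1"
  shows
    "(lyapunov_exponent M N p0 < 0 \<longrightarrow>
        (\<forall>x\<in>{0..<1}. \<forall>y\<in>{0..<1}. AE \<omega> in bernoulli_measure M p0.
           (\<lambda>n. orbit_dist M N \<omega> x y n) \<longlonglongrightarrow> 0))
     \<and>
     (lyapunov_exponent M N p0 = 0 \<longrightarrow>
        (\<forall>\<epsilon>>0. \<forall>x\<in>{0..<1}. \<forall>y\<in>{0..<1}. AE \<omega> in bernoulli_measure M p0.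
           (\<lambda>n. close_freq M N \<omega> x y \<epsilon> n) \<longlonglongrightarrow> 1)
        \<and>
        (\<exists>\<beta>0>0. \<forall>\<beta>. 0 < \<beta> \<and> \<beta> < \<beta>0 \<longrightarrow>
           (\<forall>x\<in>{0..<1}. \<forall>y\<in>{0..<1}. AE \<omega> in bernoulli_measure M p0.
              (\<exists>n. orbit_dist M N \<omega> x y n = 0) \<or> infinite {n. orbit_dist M N \<omega> x y n > \<beta>})))
     \<and>
     (lyapunov_exponent M N p0 > 0 \<longrightarrow>
        (AE (\<omega>, x, y) in bernoulli_measure M p0 \<Otimes>\<^sub>M unit_square_measure.
           \<exists>P :: real \<Rightarrow> real.
             (\<forall>\<epsilon>>0. (\<lambda>n. close_freq M N \<omega> x y \<epsilon> n) \<longlonglongrightarrow> P \<epsilon>) \<and>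
             (P \<longlongrightarrow> 0) (at_right 0)))"
proof -
  interpret random_maps M N p0 by unfold_locales (use assms in auto)
  have all: "AE \<omega> in \<nu>. Q \<omega> x y"
    if "AE \<omega> in \<nu>. \<forall>x\<in>{0..<1}. \<forall>y\<in>{0..<1}. Q \<omega> x y" "x \<in> {0..<1}" "y \<in> {0..<1}" for Q and x y :: real
    using that(1) by eventually_elim (use that in blast)
  have beta: "0 < 1 / (real N + 1)" by simp
  show ?thesis
  proof (intro conjI impI)
    assume L: "lyapunov_exponent M N p0 < 0"
    show "\<forall>x\<in>{0..<1}. \<forall>y\<in>{0..<1}. AE \<omega> in \<nu>. (\<lambda>n. orbit_dist M N \<omega> x y n) \<longlonglongrightarrow> 0"
      by (intro ballI all[OF synchronization[OF L]])
  next
    assume L: "lyapunov_exponent M N p0 = 0"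
    show "\<forall>\<epsilon>>0. \<forall>x\<in>{0..<1}. \<forall>y\<in>{0..<1}. AE \<omega> in \<nu>. (\<lambda>n. close_freq M N \<omega> x y \<epsilon> n) \<longlonglongrightarrow> 1"
      by (intro allI impI ballI all[OF intermittency[OF L]])
    show "\<exists>\<beta>0>0. \<forall>\<beta>. 0 < \<beta> \<and> \<beta> < \<beta>0 \<longrightarrow> (\<forall>x\<in>{0..<1}. \<forall>y\<in>{0..<1}. AE \<omega> in \<nu>.
        (\<exists>n. orbit_dist M N \<omega> x y n = 0) \<or> infinite {n. orbit_dist M N \<omega> x y n > \<beta>})"
    proof (intro exI[of _ "1 / (real N + 1)"] conjI beta allI impI ballI)
      fix \<beta> and x y :: real assume "0 < \<beta> \<and> \<beta> < 1 / (real N + 1)" "x \<in> {0..<1}" "y \<in> {0..<1}"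
      then show "AE \<omega> in \<nu>. (\<exists>n. orbit_dist M N \<omega> x y n = 0) \<or> infinite {n. orbit_dist M N \<omega> x y n > \<beta>}"
        using all[OF recurrent_separation[OF L, of \<beta>]] by blast
    qed
  next
    assume "lyapunov_exponent M N p0 > 0"
    then show "AE (\<omega>, x, y) in \<nu> \<Otimes>\<^sub>M unit_square_measure. \<exists>P :: real \<Rightarrow> real.
      (\<forall>\<epsilon>>0. (\<lambda>n. close_freq M N \<omega> x y \<epsilon> n) \<longlonglongrightarrow> P \<epsilon>) \<and> (P \<longlongrightarrow> 0) (at_right 0)"
      by (rule frequencies_converge)
  qed
qed

end
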